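(* The self-joinings of the system $(Y,\nu,T)$ form a Poulsen simplex.
   Context: Let $a_i=k$ if $i=10^k$ for some integer $k\ge 2$, and $a_i=8$ otherwise ($i\ge 1$). Let $X=\prod_{i\ge1}\{0,\dots,a_i-1\}$ with the product topology, and $S\colon X\to X$ the odometer (addition of $(1,0,0,\dots)$ with carry to the right), with its unique invariant probability measure $\mu$. Let $Z_k=\{\mathbf x\in X: x_k=7,\ x_i=a_i-2\text{ for all }i<k\}$ and $W_k=\{\mathbf x\in X: x_i=a_i-2\text{ for all }i<10^{2k},\ x_{10^{2k}}<a_{10^{2k}}/2\}$. Put $Y=X\setminus\bigl(\bigcup_{\ell\notin\{10^k:k\ge2\}}Z_\ell\cup\bigcup_{k\ge2}W_k\bigr)$, let $T\colon Y\to Y$ be the first return map of $S$ to $Y$, and $\nu=\mu(Y)^{-1}\mu|_Y$. A self-joining is a $(T\times T)$-invariant Borel probability measure on $Y\times Y$ with both marginals $\nu$; the set of self-joinings carries the weak* topology. A Poulsen simplex is a (Choquet) simplex whose extreme points are dense. *)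

theory Defs
  imports "HOL-Probability.Probability" "HOL-Library.Function_Algebras"
begin

section \<open>Simplices in the sense of Choquet\<close>

text \<open>The pointwise vector space structure on functions, complementing
  \<^theory>\<open>HOL-Library.Function_Algebras\<close>. Together with the product topology of
  HOL-Analysis it makes \<open>'i \<Rightarrow> real\<close> a locally convex Hausdorff space.\<close>

instantiation "fun" :: (type, real_vector) real_vector
begin

definition scaleR_fun_def: "scaleR r f = (\<lambda>x. r *\<^sub>R f x)"

instance
  by standard (simp_all add: scaleR_fun_def fun_eq_iff scaleR_add_right scaleR_add_left)

end

text \<open>Choquet's definition of a simplex: a nonempty compact convex set \<open>K\<close> such that, after
  embedding \<open>K\<close> in \<open>E \<times> \<real>\<close> at height 1, the space \<open>C - C\<close> spanned by the cone
  \<open>C = {c (x, 1) | c \<ge> 0, x \<in> K}\<close> is a lattice for the order \<open>u \<le> v \<longleftrightarrow> v - u \<in> C\<close>. (Infima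
  follow from suprema by negation.) The notion is meant for sets in a locally convex Hausdorff
  space.\<close>

definition is_cone_sup :: "'v::real_vector set \<Rightarrow> 'v \<Rightarrow> 'v \<Rightarrow> 'v \<Rightarrow> bool" where
  "is_cone_sup C u v w \<longleftrightarrow>
     w - u \<in> C \<and> w - v \<in> C \<and> (\<forall>z. z - u \<in> C \<and> z - v \<in> C \<longrightarrow> z - w \<in> C)"

definition choquet_simplex :: "'v::{real_vector, topological_space} set \<Rightarrow> bool" where
  "choquet_simplex K \<longleftrightarrow>
     K \<noteq> {} \<and> compact K \<and> convex K \<and>
     (let C = cone hull (K \<times> {1::real}); V = {a - b | a b. a \<in> C \<and> b \<in> C} in
       \<forall>u\<in>V. \<forall>v\<in>V. \<exists>w\<in>V. is_cone_sup C u v w)"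

definition poulsen_simplex :: "'v::{real_vector, topological_space} set \<Rightarrow> bool" where
  "poulsen_simplex K \<longleftrightarrow>
     choquet_simplex K \<and> metrizable_space (top_of_set K) \<and>
     K \<subseteq> closure {x. x extreme_point_of K}"


section \<open>The odometer\<close>

definition radix :: "nat \<Rightarrow> nat" where
  "radix i = (if \<exists>k\<ge>2. i = 10 ^ k then (THE k. i = 10 ^ k) else 8)"

text \<open>Coordinates are indexed from 1; a point is a function \<open>nat \<Rightarrow> nat\<close> which is
  \<^const>\<open>undefined\<close> at index 0. The topology is the one inherited from the product topology
  of \<open>nat \<Rightarrow> nat\<close> with \<open>nat\<close> discrete.\<close>

definition odo_space :: "(nat \<Rightarrow> nat) set" where
  "odo_space = (\<Pi>\<^sub>E i\<in>{1..}. {..<radix i})"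

text \<open>Adding \<open>(1, 0, 0, \<dots>)\<close> with carry to the right changes the \<open>i\<close>-th digit iff all the
  preceding digits are maximal.\<close>

definition odometer :: "(nat \<Rightarrow> nat) \<Rightarrow> nat \<Rightarrow> nat" where
  "odometer x = (\<lambda>i\<in>{1..}.
     if \<forall>j\<in>{1..<i}. x j = radix j - 1 then (x i + 1) mod radix i else x i)"

definition odo_measure :: "(nat \<Rightarrow> nat) measure" where
  "odo_measure = (THE M. sets M = sets (restrict_space borel odo_space) \<and> prob_space M \<and>
     distr M M odometer = M)"


section \<open>The induced system\<close>

definition Zset :: "nat \<Rightarrow> (nat \<Rightarrow> nat) set" where
  "Zset k = {x \<in> odo_space. x k = 7 \<and> (\<forall>i\<in>{1..<k}. x i = radix i - 2)}"

definition Wset :: "nat \<Rightarrow> (nat \<Rightarrow> nat) set" where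
  "Wset k = {x \<in> odo_space. (\<forall>i\<in>{1..<10 ^ (2 * k)}. x i = radix i - 2) \<and>
     real (x (10 ^ (2 * k))) < real (radix (10 ^ (2 * k))) / 2}"

definition Yset :: "(nat \<Rightarrow> nat) set" where
  "Yset = odo_space -
     ((\<Union>l \<in> {1..} - {10 ^ k | k. k \<ge> 2}. Zset l) \<union> (\<Union>k\<in>{2..}. Wset k))"

text \<open>The first return map to \<open>A\<close>. Points that never return, a null set by Poincare
  recurrence, are fixed by convention.\<close>

definition first_return :: "('a \<Rightarrow> 'a) \<Rightarrow> 'a set \<Rightarrow> 'a \<Rightarrow> 'a" where
  "first_return f A x =
     (if \<exists>n\<ge>1. (f ^^ n) x \<in> A then (f ^^ (LEAST n. n \<ge> 1 \<and> (f ^^ n) x \<in> A)) x else x)"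

definition Tmap :: "(nat \<Rightarrow> nat) \<Rightarrow> nat \<Rightarrow> nat" where
  "Tmap = first_return odometer Yset"

definition nu :: "(nat \<Rightarrow> nat) measure" where
  "nu = scale_measure (inverse (emeasure odo_measure Yset)) (restrict_space odo_measure Yset)"


section \<open>Self-joinings\<close>

definition self_joinings :: "((nat \<Rightarrow> nat) \<times> (nat \<Rightarrow> nat)) measure set" where
  "self_joinings = {\<eta>. sets \<eta> = sets (restrict_space borel (Yset \<times> Yset)) \<and> prob_space \<eta> \<and>
     distr \<eta> \<eta> (map_prod Tmap Tmap) = \<eta> \<and> distr \<eta> nu fst = nu \<and> distr \<eta> nu snd = nu}"

text \<open>A measure on \<open>Y \<times> Y\<close> as a functional on \<open>C(Y \<times> Y)\<close>, extended by 0 to the remaining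
  functions. \<open>Y\<close> is compact, so a Borel probability measure is determined by its functional, and
  the product topology on functionals induces the weak* topology.\<close>

definition integral_functional ::
    "((nat \<Rightarrow> nat) \<times> (nat \<Rightarrow> nat)) measure \<Rightarrow> ((nat \<Rightarrow> nat) \<times> (nat \<Rightarrow> nat) \<Rightarrow> real) \<Rightarrow> real" where
  "integral_functional \<eta> f = (if continuous_on (Yset \<times> Yset) f then \<integral>z. f z \<partial>\<eta> else 0)"

end

theory Submission
  imports Defs
begin

text \<open>Every point whose first digit is 0 lies in \<open>Y\<close>, so returns to \<open>Y\<close> take at most 8 steps, and the
  unique ergodicity of the odometer passes to \<open>T\<close>. Hence the self-joinings are exactly the
  \<open>(T \<times> T)\<close>-invariant probability measures; these form a simplex, because the supremum of two
  invariant measures is invariant.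

  The joinings \<open>\<Delta>\<^sub>d\<close> supported on the graphs of \<open>T\<^sup>d\<close> are extreme points, and they are dense. Call
  block of depth \<open>n\<close> a run of the odometer through all values of the first \<open>n\<close> digits; the number of
  its points in \<open>Y\<close> depends only on whether the word \<open>a\<^sub>1 - 2, \<dots>, a\<^sub>n - 2\<close> is removed. At position
  \<open>n + 1 = 10\<^bsup>2k\<^esup>\<close> half of the \<open>2k\<close> blocks have length \<open>N - 1\<close> and half have length \<open>N\<close>, so
  \<open>T\<^bsup>jN\<^esup>\<close> is close to \<open>T\<^sup>j\<close> on one half of \<open>Y\<close> and to the identity on the other: averages of two
  \<open>\<Delta>\<^sub>d\<close> are limits of \<open>\<Delta>\<^sub>d\<close>, and the closure of the \<open>\<Delta>\<^sub>d\<close> is convex. At position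
  \<open>n + 1 = 10\<^sup>k\<close> with \<open>k\<close> odd almost all blocks have the same length \<open>N\<close>. So \<open>T\<close> is nearly a cyclic
  permutation of \<open>N\<close> levels, and every joining is close to a convex combination of \<open>\<Delta>\<^sub>d\<close>,
  \<open>d < N\<close>.\<close>

section \<open>Measures on a compact space with clopen codes\<close>

text \<open>The radices produce both effects. At 10^(2k) the radix 2k is split by
  \<open>Wset\<close>: digits below k lose the critical level. A block with that level removed has N
  - 1 points in Y, so jN steps of T are either exactly j long blocks or j short blocks and j further
  steps. Passing whole blocks leaves the first n digits alone, hence is close to the identity, and
  the digits too near the end of their range are a bounded number out of 2k. The exponent d = a + jN
  with j = b - a then averages the graph joinings of a and b. At 10^k with k odd the lost digits are
  a bounded number out of k.

  The obstacle for compactness is that T is discontinuous, at the predecessor of the point with all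
  digits a_i - 2: arbitrarily close points have a removed image. Limits of invariant measures
  therefore need an argument. All joinings share the marginal \<nu>, so T-preimages of clopen sets
  can be exchanged for clopen sets with an error that is uniform over the joinings. This is why
  measures are handled through finite clopen partitions throughout.\<close>

lemma finite_measure_from_real:
  fixes p :: "'a set \<Rightarrow> real"
  assumes nonneg: "\<And>A. A \<in> sets M \<Longrightarrow> 0 \<le> p A"
    and sums: "\<And>F::nat \<Rightarrow> 'a set. range F \<subseteq> sets M \<Longrightarrow> disjoint_family F \<Longrightarrow> (\<lambda>i. p (F i)) sums p (\<Union>i. F i)"
  shows "\<exists>L. sets L = sets M \<and> finite_measure L \<and> (\<forall>A\<in>sets M. measure L A = p A)"
proof -
  define L where "L = measure_of (space M) (sets M) (\<lambda>A. ennreal (p A))"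
  have "(\<lambda>i::nat. p {}) sums p {}"
    using sums[of "\<lambda>_. {}"] by (simp add: disjoint_family_on_def)
  then have "(\<lambda>i::nat. p {}) \<longlonglongrightarrow> 0"
    using summable_LIMSEQ_zero sums_summable by blast
  then have p0: "p {} = 0"
    by (simp add: LIMSEQ_const_iff)
  have sets: "sets L = sets M" and space: "space L = space M"
    by (simp_all add: L_def)
  have em: "emeasure L A = ennreal (p A)" if A: "A \<in> sets M" for A
  proof (rule emeasure_measure_of[OF L_def])
    show "sets M \<subseteq> Pow (space M)"
      by (rule sets.space_closed)
    show "positive (sets L) (\<lambda>A. ennreal (p A))"
      by (simp add: positive_def p0)
    show "countably_additive (sets L) (\<lambda>A. ennreal (p A))"
    proof (rule countably_additiveI)
      fix F :: "nat \<Rightarrow> 'a set"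
      assume F: "range F \<subseteq> sets L" "disjoint_family F"
      then have "(\<lambda>i. p (F i)) sums p (\<Union>i. F i)"
        by (intro sums) (auto simp: sets)
      moreover have "\<And>i. 0 \<le> p (F i)"
        using F by (intro nonneg) (auto simp: sets)
      ultimately show "(\<Sum>i. ennreal (p (F i))) = ennreal (p (\<Union>i. F i))"
        by (intro suminf_ennreal_eq)
    qed
  qed (use A sets in auto)
  have "finite_measure L"
    by (rule finite_measureI) (simp add: space em)
  moreover have "measure L A = p A" if "A \<in> sets M" for A
    using em[OF that] nonneg[OF that] by (simp add: measure_def)
  ultimately show ?thesis
    using sets by blast
qed

text \<open>Coefficients may be negative: the real-valued \<open>measure\<close> allows differences,
  which \<open>ennreal\<close> does not, and the simplex property rests on differences of comparable
  measures.\<close>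

lemma finite_measure_lincomb:
  fixes a b :: real
  assumes M: "finite_measure M" and N: "finite_measure N" and sets: "sets N = sets M"
    and nonneg: "\<And>A. A \<in> sets M \<Longrightarrow> 0 \<le> a * measure M A + b * measure N A"
  shows "\<exists>L. sets L = sets M \<and> finite_measure L \<and>
    (\<forall>A\<in>sets M. measure L A = a * measure M A + b * measure N A)"
proof (rule finite_measure_from_real[OF nonneg])
  fix F :: "nat \<Rightarrow> 'a set"
  assume F: "range F \<subseteq> sets M" "disjoint_family F"
  show "(\<lambda>i. a * measure M (F i) + b * measure N (F i)) sums (a * measure M (\<Union>i. F i) + b * measure N (\<Union>i. F i))"
    using sums_add[OF
        sums_mult[OF finite_measure.finite_measure_UNION[OF M F]]
        sums_mult[OF finite_measure.finite_measure_UNION[OF N F(1)[folded sets] F(2)]]] .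
qed

text \<open>Take a Hahn set \<open>H\<close> on which N is at most M and off which M is at most N;
  the supremum is M on \<open>H\<close> and N off \<open>H\<close>. An upper bound dominates the two
  pieces separately, so it dominates their sum.\<close>

lemma finite_measure_sup:
  assumes M: "finite_measure M" and N: "finite_measure N" and sets: "sets N = sets M"
  shows "\<exists>L. sets L = sets M \<and> finite_measure L \<and>
    (\<forall>A\<in>sets M. measure M A \<le> measure L A \<and> measure N A \<le> measure L A) \<and>
    (\<forall>L'. sets L' = sets M \<and> finite_measure L' \<and>
      (\<forall>A\<in>sets M. measure M A \<le> measure L' A \<and> measure N A \<le> measure L' A) \<longrightarrow>
      (\<forall>A\<in>sets M. measure L A \<le> measure L' A))"
proof -
  interpret M: finite_measure M by fact
  interpret N: finite_measure N by fact
  obtain H where H: "H \<in> sets M"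
    and H1: "\<And>X. X \<in> sets M \<Longrightarrow> X \<subseteq> H \<Longrightarrow> emeasure N X \<le> emeasure M X"
    and H2: "\<And>X. X \<in> sets M \<Longrightarrow> X \<inter> H = {} \<Longrightarrow> emeasure M X \<le> emeasure N X"
    using finite_unsigned_Hahn_decomposition[OF M N sets] by (elim bexE conjE) simp
  have H1': "measure N X \<le> measure M X" if "X \<in> sets M" "X \<subseteq> H" for X
    using H1[OF that] that sets by (simp add: M.emeasure_eq_measure N.emeasure_eq_measure)
  have H2': "measure M X \<le> measure N X" if "X \<in> sets M" "X \<inter> H = {}" for X
    using H2[OF that] that sets by (simp add: M.emeasure_eq_measure N.emeasure_eq_measure)
  obtain L where L: "sets L = sets M" "finite_measure L"
    and Lm: "\<And>A. A \<in> sets M \<Longrightarrow> measure L A = measure M (A \<inter> H) + measure N (A - H)"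
  proof -
    have "\<exists>L. sets L = sets M \<and> finite_measure L \<and>
      (\<forall>A\<in>sets M. measure L A = measure M (A \<inter> H) + measure N (A - H))"
    proof (rule finite_measure_from_real)
      fix F :: "nat \<Rightarrow> 'a set"
      assume F: "range F \<subseteq> sets M" "disjoint_family F"
      have "(\<lambda>i. measure M (F i \<inter> H)) sums measure M (\<Union>i. F i \<inter> H)"
        by (intro M.finite_measure_UNION) (use F H in \<open>auto simp: disjoint_family_on_def\<close>)
      moreover have "(\<lambda>i. measure N (F i - H)) sums measure N (\<Union>i. F i - H)"
        by (intro N.finite_measure_UNION) (use F H sets in \<open>auto simp: disjoint_family_on_def\<close>)
      ultimately show "(\<lambda>i. measure M (F i \<inter> H) + measure N (F i - H)) sums
          (measure M ((\<Union>i. F i) \<inter> H) + measure N ((\<Union>i. F i) - H))"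
        by (simp add: sums_add)
    qed auto
    then show ?thesis using that by blast
  qed
  have splitM: "measure M A = measure M (A \<inter> H) + measure M (A - H)" if "A \<in> sets M" for A
    using M.finite_measure_Union[of "A \<inter> H" "A - H"] that H by (simp add: Int_Diff_Un Int_Diff_disjoint)
  have splitN: "measure N A = measure N (A \<inter> H) + measure N (A - H)" if "A \<in> sets M" for A
    using N.finite_measure_Union[of "A \<inter> H" "A - H"] that H sets by (simp add: Int_Diff_Un Int_Diff_disjoint)
  have ub: "measure M A \<le> measure L A" "measure N A \<le> measure L A" if "A \<in> sets M" for A
    using splitM[OF that] splitN[OF that] Lm[OF that] H1'[of "A \<inter> H"] H2'[of "A - H"] that H by auto
  have least: "measure L A \<le> measure L' A"
    if L': "sets L' = sets M" "finite_measure L'"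
      "\<And>A. A \<in> sets M \<Longrightarrow> measure M A \<le> measure L' A \<and> measure N A \<le> measure L' A"
      and A: "A \<in> sets M" for L' A
  proof -
    interpret L': finite_measure L' by fact
    have "measure L' A = measure L' (A \<inter> H) + measure L' (A - H)"
      using L'.finite_measure_Union[of "A \<inter> H" "A - H"] A H L' by (simp add: Int_Diff_Un Int_Diff_disjoint)
    moreover have "measure M (A \<inter> H) \<le> measure L' (A \<inter> H)" "measure N (A - H) \<le> measure L' (A - H)"
      using L'(3)[OF sets.Int[OF A H]] L'(3)[OF sets.Diff[OF A H]] by blast+
    ultimately show ?thesis
      using Lm[OF A] by linarith
  qed
  show ?thesis
    by (intro exI[of _ L] conjI ballI allI impI; (elim conjE)?) (simp_all add: L ub least)
qed

text \<open>The cells of \<open>code n\<close> form finite nested clopen partitions that generate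
  the topology. The same theory serves X, Y and the square of Y, where integrals and limits reduce
  to finitely many cell masses.\<close>

locale coded_space =
  fixes \<Omega> :: "'a::topological_space set" and code :: "nat \<Rightarrow> 'a \<Rightarrow> nat"
  assumes compact_space: "compact \<Omega>"
    and closed_space: "closed \<Omega>"
    and finite_code: "\<And>n. finite (code n ` \<Omega>)"
    and code_refine: "\<And>m n x y. m \<le> n \<Longrightarrow> x \<in> \<Omega> \<Longrightarrow> y \<in> \<Omega> \<Longrightarrow> code n x = code n y \<Longrightarrow> code m x = code m y"
    and closed_code: "\<And>n c. closed {x \<in> \<Omega>. code n x = c}"
    and code_nhds: "\<And>U x. open U \<Longrightarrow> x \<in> \<Omega> \<inter> U \<Longrightarrow> \<exists>n. \<forall>y\<in>\<Omega>. code n y = code n x \<longrightarrow> y \<in> U"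
begin

definition cyl :: "nat \<Rightarrow> nat \<Rightarrow> 'a set" where
  "cyl n c = {x \<in> \<Omega>. code n x = c}"

definition cyls :: "'a set set" where
  "cyls = {{x \<in> \<Omega>. code n x \<in> B} | n B. True}"

abbreviation bor :: "'a measure" where
  "bor \<equiv> restrict_space borel \<Omega>"

lemma space_bor [simp]: "space bor = \<Omega>"
  by (simp add: space_restrict_space)

lemma cylsI: "{x \<in> \<Omega>. code n x \<in> B} \<in> cyls"
  by (auto simp: cyls_def)

lemma cyl_in_cyls: "cyl n c \<in> cyls"
  using cylsI[of n "{c}"] by (simp add: cyl_def)

lemma cyls_lift:
  assumes "m \<le> n"
  shows "{x \<in> \<Omega>. code m x \<in> B} = {x \<in> \<Omega>. code n x \<in> code n ` {x \<in> \<Omega>. code m x \<in> B}}"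
proof (intro set_eqI iffI)
  fix x assume "x \<in> {x \<in> \<Omega>. code n x \<in> code n ` {x \<in> \<Omega>. code m x \<in> B}}"
  then obtain y where y: "x \<in> \<Omega>" "y \<in> \<Omega>" "code m y \<in> B" "code n x = code n y"
    by auto
  then show "x \<in> {x \<in> \<Omega>. code m x \<in> B}"
    using code_refine[OF assms, of x y] by simp
qed auto

lemma cyls_common:
  assumes "A \<in> cyls" "B \<in> cyls"
  obtains n C D where "A = {x \<in> \<Omega>. code n x \<in> C}" "B = {x \<in> \<Omega>. code n x \<in> D}"
proof -
  obtain m k C D where mk: "A = {x \<in> \<Omega>. code m x \<in> C}" "B = {x \<in> \<Omega>. code k x \<in> D}"
    using assms unfolding cyls_def by blast
  show ?thesis
    by (rule that[of "max m k"]) (use mk cyls_lift[of m "max m k" C] cyls_lift[of k "max m k" D] in auto)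
qed

lemma algebra_cyls: "algebra \<Omega> cyls"
proof (rule algebra_iff_Un[THEN iffD2], intro conjI ballI)
  show "cyls \<subseteq> Pow \<Omega>"
    by (auto simp: cyls_def)
  show "{} \<in> cyls"
    using cylsI[of 0 "{}"] by simp
next
  fix A assume "A \<in> cyls"
  then obtain n B where "A = {x \<in> \<Omega>. code n x \<in> B}"
    by (auto simp: cyls_def)
  then have "\<Omega> - A = {x \<in> \<Omega>. code n x \<in> - B}"
    by auto
  then show "\<Omega> - A \<in> cyls"
    using cylsI by metis
next
  fix A B assume "A \<in> cyls" "B \<in> cyls"
  then obtain n C D where "A = {x \<in> \<Omega>. code n x \<in> C}" "B = {x \<in> \<Omega>. code n x \<in> D}"
    by (rule cyls_common)
  then have "A \<union> B = {x \<in> \<Omega>. code n x \<in> C \<union> D}"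
    by auto
  then show "A \<union> B \<in> cyls"
    using cylsI by metis
qed

sublocale cyls: algebra \<Omega> cyls
  by (rule algebra_cyls)

lemma cyls_decomp: "{x \<in> \<Omega>. code n x \<in> B} = (\<Union>c\<in>B \<inter> code n ` \<Omega>. cyl n c)"
  by (auto simp: cyl_def)

lemma closed_cyls:
  assumes "A \<in> cyls" shows "closed A"
proof -
  obtain n B where "A = {x \<in> \<Omega>. code n x \<in> B}"
    using assms by (auto simp: cyls_def)
  then have "A = (\<Union>c\<in>B \<inter> code n ` \<Omega>. cyl n c)"
    using cyls_decomp by simp
  then show ?thesis
    using closed_code finite_code by (auto simp: cyl_def)
qed

lemma cyls_sets: "A \<in> cyls \<Longrightarrow> A \<in> sets bor"
  using closed_cyls[of A] cyls.sets_into_space[of A] closed_space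
  by (simp add: sets_restrict_space_iff)

lemma open_Int_cyls:
  assumes "open U"
  shows "\<Omega> \<inter> U = (\<Union>(n, c) \<in> {(n, c). cyl n c \<subseteq> U}. cyl n c)"
proof (intro set_eqI iffI)
  fix x assume x: "x \<in> \<Omega> \<inter> U"
  then obtain n where "\<forall>y\<in>\<Omega>. code n y = code n x \<longrightarrow> y \<in> U"
    using code_nhds[OF assms] by blast
  then have "cyl n (code n x) \<subseteq> U" "x \<in> cyl n (code n x)"
    using x by (auto simp: cyl_def)
  then show "x \<in> (\<Union>(n, c) \<in> {(n, c). cyl n c \<subseteq> U}. cyl n c)"
    by blast
qed (auto simp: cyl_def)

lemma sets_bor: "sets bor = sigma_sets \<Omega> cyls"
proof
  show "sigma_sets \<Omega> cyls \<subseteq> sets bor"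
    using sets.sigma_sets_subset[of cyls bor] cyls_sets by auto
  have "\<Omega> \<inter> A \<in> sigma_sets \<Omega> cyls" if "A \<in> sigma_sets UNIV {S. open S}" for A
    using that
  proof induction
    case (Basic U)
    have "countable {(n, c). cyl n c \<subseteq> U}"
      by (rule countableI_type)
    then have "(\<Union>(n, c) \<in> {(n, c). cyl n c \<subseteq> U}. cyl n c) \<in> sigma_sets \<Omega> cyls"
      by (intro sigma_sets_UNION countable_image) (use cyl_in_cyls in auto)
    then show ?case
      using Basic open_Int_cyls by simp
  next
    case Empty
    then show ?case by (simp add: sigma_sets.Empty)
  next
    case (Compl A)
    have "\<Omega> \<inter> (UNIV - A) = \<Omega> - (\<Omega> \<inter> A)" by auto
    then show ?case using Compl by (simp add: sigma_sets.Compl)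
  next
    case (Union F)
    have "\<Omega> \<inter> (\<Union>i. F i) = (\<Union>i. \<Omega> \<inter> F i)" by auto
    then show ?case using Union sigma_sets.Union[of "\<lambda>i. \<Omega> \<inter> F i"] by auto
  qed
  then show "sets bor \<subseteq> sigma_sets \<Omega> cyls"
    unfolding sets_restrict_space borel_def by (auto simp: Int_commute)
qed

lemma measure_cyls_decomp:
  assumes "sets M = sets bor" "finite_measure M"
  shows "measure M {x \<in> \<Omega>. code n x \<in> B} = (\<Sum>c\<in>B \<inter> code n ` \<Omega>. measure M (cyl n c))"
proof -
  interpret finite_measure M by fact
  show ?thesis
    unfolding cyls_decomp
    by (rule finite_measure_finite_Union)
      (use assms finite_code cyls_sets cyl_in_cyls in \<open>auto simp: disjoint_family_on_def cyl_def\<close>)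
qed

lemma measure_eqI_cyls:
  assumes M: "sets M = sets bor" "finite_measure M" and N: "sets N = sets bor" "finite_measure N"
    and eq: "\<And>A. A \<in> cyls \<Longrightarrow> measure M A = measure N A"
  shows "M = N"
proof (rule measure_eqI_generator_eq[where E = cyls and \<Omega> = \<Omega> and A = "\<lambda>_. \<Omega>"])
  interpret M: finite_measure M by fact
  interpret N: finite_measure N by fact
  show "Int_stable cyls"
    by (auto simp: Int_stable_def)
  show "emeasure M X = emeasure N X" if "X \<in> cyls" for X
    using eq[OF that] by (simp add: M.emeasure_eq_measure N.emeasure_eq_measure)
  show "range (\<lambda>_. \<Omega>) \<subseteq> cyls"
    using cyls.top by auto
  show "cyls \<subseteq> Pow \<Omega>"
    using cyls.sets_into_space by blast
  show "emeasure M \<Omega> \<noteq> \<infinity>"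
    by (simp add: M.emeasure_eq_measure)
qed (use M N sets_bor in auto)

lemma measure_eqI_cyl:
  assumes M: "sets M = sets bor" "finite_measure M" and N: "sets N = sets bor" "finite_measure N"
    and eq: "\<And>n c. c \<in> code n ` \<Omega> \<Longrightarrow> measure M (cyl n c) = measure N (cyl n c)"
  shows "M = N"
proof (rule measure_eqI_cyls[OF M N])
  fix A assume "A \<in> cyls"
  then obtain n B where "A = {x \<in> \<Omega>. code n x \<in> B}"
    by (auto simp: cyls_def)
  then show "measure M A = measure N A"
    using eq by (simp add: measure_cyls_decomp M N)
qed

lemma extend_cyls:
  fixes p :: "'a set \<Rightarrow> real"
  assumes nonneg: "\<And>A. A \<in> cyls \<Longrightarrow> 0 \<le> p A"
    and add: "\<And>A B. A \<in> cyls \<Longrightarrow> B \<in> cyls \<Longrightarrow> A \<inter> B = {} \<Longrightarrow> p (A \<union> B) = p A + p B"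
  shows "\<exists>M. sets M = sets bor \<and> finite_measure M \<and> (\<forall>A\<in>cyls. measure M A = p A)"
proof -
  have p0: "p {} = 0"
    using add[of "{}" "{}"] by simp
  have "\<exists>\<mu> :: 'a set \<Rightarrow> ennreal. (\<forall>s \<in> cyls. \<mu> s = ennreal (p s)) \<and> measure_space \<Omega> (sigma_sets \<Omega> cyls) \<mu>"
  proof (rule cyls.caratheodory_empty_continuous)
    show "positive cyls (\<lambda>s. ennreal (p s))"
      by (simp add: positive_def p0)
    show "additive cyls (\<lambda>s. ennreal (p s))"
      by (simp add: additive_def add nonneg)
    fix A :: "nat \<Rightarrow> 'a set"
    assume A: "range A \<subseteq> cyls" "decseq A" "(\<Inter>i. A i) = {}"
    \<comment> \<open>Cylinder sets are compact, so the decreasing sequence is eventually empty.\<close>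
    have "\<exists>i. A i = {}"
    proof (rule ccontr)
      assume ne: "\<not> (\<exists>i. A i = {})"
      have cl: "closed (A i)" "A i \<subseteq> \<Omega>" for i
        using A(1) closed_cyls cyls.sets_into_space by (auto simp: image_subset_iff)
      have "\<Omega> \<inter> (\<Inter>i\<in>UNIV. A i) \<noteq> {}"
      proof (rule compact_imp_fip_image[OF compact_space])
        fix I' :: "nat set" assume I': "finite I'" "I' \<subseteq> UNIV"
        obtain N where N: "\<forall>i\<in>I'. i \<le> N"
          using I'(1) by (auto simp: finite_nat_set_iff_bounded_le)
        then have "\<forall>i\<in>I'. A N \<subseteq> A i"
          using decseqD[OF A(2)] by simp
        then have "A N \<subseteq> \<Omega> \<inter> (\<Inter>i\<in>I'. A i)"
          using cl(2)[of N] by (simp add: INT_greatest)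
        then show "\<Omega> \<inter> (\<Inter>i\<in>I'. A i) \<noteq> {}"
          using ne by blast
      qed (use cl in auto)
      then show False using A by simp
    qed
    then obtain i where i: "A i = {}" by blast
    have "eventually (\<lambda>n. A n = {}) sequentially"
      using eventually_ge_at_top[of i]
      by eventually_elim (use A(2) i in \<open>auto simp: decseq_def\<close>)
    then show "(\<lambda>i. ennreal (p (A i))) \<longlonglongrightarrow> 0"
      by (intro tendsto_eventually) (auto elim!: eventually_mono simp: p0)
  qed simp
  then obtain \<mu> :: "'a set \<Rightarrow> ennreal" where \<mu>: "\<And>s. s \<in> cyls \<Longrightarrow> \<mu> s = ennreal (p s)"
    and ms: "measure_space \<Omega> (sigma_sets \<Omega> cyls) \<mu>"
    by blast
  define M where "M = measure_of \<Omega> (sigma_sets \<Omega> cyls) \<mu>"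
  have sp: "sigma_sets \<Omega> cyls \<subseteq> Pow \<Omega>"
    using sigma_sets_into_sp[of cyls \<Omega>] cyls.sets_into_space by blast
  have sets: "sets M = sigma_sets \<Omega> cyls"
    unfolding M_def using sp ms by (simp add: sets_measure_of sigma_algebra.sigma_sets_eq measure_space_def)
  have em: "emeasure M s = ennreal (p s)" if "s \<in> cyls" for s
    using emeasure_measure_of_sigma[of \<Omega> "sigma_sets \<Omega> cyls" \<mu> s] ms \<mu>[OF that] that
    by (simp add: M_def measure_space_def sigma_sets.Basic)
  have spM: "space M = \<Omega>"
    unfolding M_def using sp by (simp add: space_measure_of)
  have "finite_measure M"
    by (rule finite_measureI) (simp add: spM em)
  then show ?thesis
    using sets sets_bor em nonneg by (intro exI[of _ M]) (simp add: measure_def)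
qed

text \<open>The sets that can be approximated form a Dynkin system containing the clopen sets. The
  lemma is the substitute for continuity of T: preimages under T are replaced by clopen
  sets.\<close>

lemma approx_cyls:
  assumes M: "sets M = sets bor" "finite_measure M" and A: "A \<in> sets bor" and e: "e > 0"
  shows "\<exists>C\<in>cyls. measure M ((A - C) \<union> (C - A)) < e"
proof -
  interpret finite_measure M by fact
  have "Int_stable cyls"
    by (auto simp: Int_stable_def)
  moreover have "cyls \<subseteq> Pow \<Omega>"
    using cyls.sets_into_space by blast
  moreover have "A \<in> sigma_sets \<Omega> cyls"
    using A sets_bor by simp
  ultimately show ?thesis
    using e
  proof (induction arbitrary: e rule: sigma_sets_induct_disjoint)
    case (basic A)
    then show ?case by (intro bexI[of _ A]) auto
  next
    case empty
    then show ?case by (intro bexI[of _ "{}"]) auto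
  next
    case (compl A)
    then obtain C where C: "C \<in> cyls" "measure M ((A - C) \<union> (C - A)) < e"
      by blast
    have "A \<subseteq> \<Omega>" "C \<subseteq> \<Omega>"
      using compl sets_bor sets.sets_into_space[of A bor] C cyls.sets_into_space by auto
    then have "((\<Omega> - A) - (\<Omega> - C)) \<union> ((\<Omega> - C) - (\<Omega> - A)) = (A - C) \<union> (C - A)"
      by auto
    then show ?case using C by (intro bexI[of _ "\<Omega> - C"]) auto
  next
    case (union F)
    have F: "range F \<subseteq> sets M" "\<And>i. F i \<in> sets M"
      using union sets_bor M by auto
    have "(\<lambda>n. measure M (F n)) sums measure M (\<Union>n. F n)"
      using union F by (intro finite_measure_UNION) auto
    then have "(\<lambda>n. \<Sum>i<n. measure M (F i)) \<longlonglongrightarrow> measure M (\<Union>n. F n)"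
      by (simp add: sums_def)
    then have "\<exists>N. \<forall>n\<ge>N. \<bar>(\<Sum>i<n. measure M (F i)) - measure M (\<Union>n. F n)\<bar> < e / 2"
      using LIMSEQ_D[of "\<lambda>n. \<Sum>i<n. measure M (F i)" _ "e/2"] union.prems unfolding real_norm_def by auto
    then obtain N where N: "\<bar>(\<Sum>i<N. measure M (F i)) - measure M (\<Union>n. F n)\<bar> < e / 2"
      by blast
    define G where "G = (\<Union>i<N. F i)"
    have G: "measure M G = (\<Sum>i<N. measure M (F i))"
      unfolding G_def using union F by (intro finite_measure_finite_Union) (auto simp: disjoint_family_on_def)
    have tail: "measure M ((\<Union>n. F n) - G) < e / 2"
    proof -
      have "measure M ((\<Union>n. F n) - G) = measure M (\<Union>n. F n) - measure M G"
        by (rule finite_measure_Diff) (use F in \<open>auto simp: G_def\<close>)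
      then show ?thesis using N G by linarith
    qed
    \<comment> \<open>The summand 1 keeps the tolerance positive when N = 0.\<close>
    have "e / (2 * (real N + 1)) > 0"
      using union.prems by simp
    then have "\<forall>i. \<exists>C\<in>cyls. measure M ((F i - C) \<union> (C - F i)) < e / (2 * (real N + 1))"
      using union.IH by blast
    then obtain C where C: "\<And>i. C i \<in> cyls" "\<And>i. measure M ((F i - C i) \<union> (C i - F i)) < e / (2 * (real N + 1))"
      by metis
    have CM: "C i \<in> sets M" for i
      using C(1) cyls_sets M by simp
    define D where "D = (\<Union>i<N. C i)"
    have D: "D \<in> cyls"
      unfolding D_def using C by auto
    let ?E = "\<Union>i<N. (F i - C i) \<union> (C i - F i)"
    have EM: "?E \<in> sets M" "(\<Union>n. F n) - G \<in> sets M"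
      using F CM by (auto simp: G_def)
    have "measure M ?E \<le> (\<Sum>i<N. measure M ((F i - C i) \<union> (C i - F i)))"
      using F CM by (intro finite_measure_subadditive_finite) auto
    also have "\<dots> \<le> (\<Sum>i<N. e / (2 * (real N + 1)))"
      using C by (intro sum_mono) (simp add: less_imp_le)
    also have "\<dots> \<le> e / 2"
      using union.prems by (simp add: field_simps)
    finally have E: "measure M ?E \<le> e / 2" .
    have sub: "((\<Union>n. F n) - D) \<union> (D - (\<Union>n. F n)) \<subseteq> ((\<Union>n. F n) - G) \<union> ?E"
      by (auto simp: D_def G_def)
    have "measure M (((\<Union>n. F n) - D) \<union> (D - (\<Union>n. F n))) \<le> measure M (((\<Union>n. F n) - G) \<union> ?E)"
      using EM by (intro finite_measure_mono sub) auto
    also have "\<dots> \<le> measure M ((\<Union>n. F n) - G) + measure M ?E"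
      using EM by (intro measure_Un_le) auto
    also have "\<dots> < e"
      using tail E by simp
    finally show ?case using D by blast
  qed
qed

end

section \<open>Functionals of measures\<close>

text \<open>Basic open sets of the product topology constrain finitely many coordinates. On
  functionals of measures this is weak* approximation at finitely many test functions.\<close>

lemma closure_fun_iff:
  fixes S :: "('i \<Rightarrow> real) set"
  shows "\<phi> \<in> closure S \<longleftrightarrow> (\<forall>F e. finite F \<longrightarrow> e > 0 \<longrightarrow> (\<exists>\<psi>\<in>S. \<forall>f\<in>F. \<bar>\<psi> f - \<phi> f\<bar> < e))"
proof (intro iffI allI impI)
  fix F :: "'i set" and e :: real
  assume \<phi>: "\<phi> \<in> closure S" and F: "finite F" and e: "e > 0"
  define U where "U = Pi\<^sub>E UNIV (\<lambda>f. if f \<in> F then ball (\<phi> f) e else UNIV)"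
  have "open U"
    unfolding U_def by (rule open_PiE) (use F in \<open>auto elim: finite_subset[rotated]\<close>)
  moreover have "\<phi> \<in> U"
    using e by (auto simp: U_def)
  ultimately have "S \<inter> U \<noteq> {}"
    using \<phi> by (metis open_Int_closure_eq_empty Int_commute disjoint_iff)
  then obtain \<psi> where \<psi>: "\<psi> \<in> S" "\<psi> \<in> U" by blast
  have "\<bar>\<psi> f - \<phi> f\<bar> < e" if "f \<in> F" for f
    using \<psi>(2) that by (auto simp: U_def PiE_iff dist_real_def abs_minus_commute dest: spec[of _ f])
  then show "\<exists>\<psi>\<in>S. \<forall>f\<in>F. \<bar>\<psi> f - \<phi> f\<bar> < e"
    using \<psi>(1) by blast
next
  assume *: "\<forall>F e. finite F \<longrightarrow> e > 0 \<longrightarrow> (\<exists>\<psi>\<in>S. \<forall>f\<in>F. \<bar>\<psi> f - \<phi> f\<bar> < e)"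
  show "\<phi> \<in> closure S"
  proof (rule closure_iff_nhds_not_empty[THEN iffD2], intro allI impI)
    fix A V assume "V \<subseteq> A" "open V" "\<phi> \<in> V"
    obtain X where X: "\<phi> \<in> Pi\<^sub>E UNIV X" "\<And>i. open (X i)" "finite {i. X i \<noteq> UNIV}" "Pi\<^sub>E UNIV X \<subseteq> V"
      using product_topology_open_contains_basis[of "\<lambda>_. euclidean" UNIV V \<phi>] \<open>open V\<close> \<open>\<phi> \<in> V\<close>
      by (auto simp: open_fun_def topspace_euclidean)
    define F where "F = {i. X i \<noteq> UNIV}"
    have "\<forall>f. \<exists>e>0. ball (\<phi> f) e \<subseteq> X f"
      using X(1,2) open_contains_ball by (metis PiE_E UNIV_I)
    then obtain \<epsilon> where \<epsilon>: "\<And>f. \<epsilon> f > 0" "\<And>f. ball (\<phi> f) (\<epsilon> f) \<subseteq> X f"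
      by metis
    \<comment> \<open>\<open>insert 1\<close> covers the case of an empty \<open>F\<close>.\<close>
    define e where "e = Min (insert 1 (\<epsilon> ` F))"
    have F: "finite F" using X F_def by simp
    have e: "e > 0" "\<And>f. f \<in> F \<Longrightarrow> e \<le> \<epsilon> f"
      using F \<epsilon>(1) by (auto simp: e_def)
    obtain \<psi> where \<psi>: "\<psi> \<in> S" "\<forall>f\<in>F. \<bar>\<psi> f - \<phi> f\<bar> < e"
      using * F e by blast
    have "\<psi> f \<in> X f" for f
    proof (cases "f \<in> F")
      case True
      then have "\<psi> f \<in> ball (\<phi> f) (\<epsilon> f)"
        using \<psi>(2) e(2)[OF True] by (auto simp: dist_real_def abs_minus_commute)
      then show ?thesis using \<epsilon>(2) by blast
    next
      case False
      then show ?thesis by (simp add: F_def)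
    qed
    then have "\<psi> \<in> V" using X(4) by auto
    then show "S \<inter> A \<noteq> {}" using \<psi>(1) \<open>V \<subseteq> A\<close> by blast
  qed
qed

context coded_space
begin

definition ifun :: "'a measure \<Rightarrow> ('a \<Rightarrow> real) \<Rightarrow> real" where
  "ifun M f = (if continuous_on \<Omega> f then \<integral>z. f z \<partial>M else 0)"

definition probs :: "'a measure set" where
  "probs = {M. sets M = sets bor \<and> prob_space M}"

lemma space_eq: "sets M = sets bor \<Longrightarrow> space M = \<Omega>"
  by (drule sets_eq_imp_space_eq) simp

text \<open>Uniform continuity on a compact space, with the partitions in the place of a
  metric.\<close>

lemma continuous_code_osc:
  assumes "continuous_on \<Omega> (f :: 'a \<Rightarrow> real)" "e > 0"
  shows "\<exists>n. \<forall>x\<in>\<Omega>. \<forall>y\<in>\<Omega>. code n x = code n y \<longrightarrow> \<bar>f x - f y\<bar> < e"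
proof -
  have "\<exists>n. \<forall>y\<in>\<Omega>. code n y = code n x \<longrightarrow> \<bar>f y - f x\<bar> < e / 2" if x: "x \<in> \<Omega>" for x
  proof -
    have "open (ball (f x) (e / 2))" "f x \<in> ball (f x) (e / 2)"
      using assms(2) by auto
    then obtain U where U: "open U" "x \<in> U" "\<forall>y\<in>\<Omega>. y \<in> U \<longrightarrow> f y \<in> ball (f x) (e / 2)"
      using assms(1) x unfolding continuous_on_topological by metis
    obtain n where "\<forall>y\<in>\<Omega>. code n y = code n x \<longrightarrow> y \<in> U"
      using code_nhds[OF U(1), of x] x U(2) by blast
    then show ?thesis
      using U(3) by (intro exI[of _ n]) (auto simp: dist_real_def abs_minus_commute)
  qed
  then obtain n where n: "\<And>x y. x \<in> \<Omega> \<Longrightarrow> y \<in> \<Omega> \<Longrightarrow> code (n x) y = code (n x) x \<Longrightarrow> \<bar>f y - f x\<bar> < e / 2"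
    by metis
  \<comment> \<open>Cells are open only relative to \<Omega>. Removing the other cells, a closed
    set, from the whole space gives an open set with the same trace on \<Omega>.\<close>
  define W where "W x = - (\<Omega> - cyl (n x) (code (n x) x))" for x
  have W: "\<Omega> \<inter> W x = cyl (n x) (code (n x) x)" for x
    by (auto simp: W_def cyl_def)
  have "open (W x)" for x
    unfolding W_def by (rule open_Compl[OF closed_cyls[OF cyls.compl_sets[OF cyl_in_cyls]]])
  moreover have "\<Omega> \<subseteq> (\<Union>x\<in>\<Omega>. W x)"
    by (auto simp: W_def cyl_def)
  ultimately obtain D where D: "D \<subseteq> \<Omega>" "finite D" "\<Omega> \<subseteq> (\<Union>x\<in>D. W x)"
    using compactE_image[OF compact_space, of \<Omega> W] by metis
  define N where "N = Max (insert 0 (n ` D))"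
  have nN: "n d \<le> N" if "d \<in> D" for d
    using that D(2) by (auto simp: N_def)
  have "\<bar>f x - f y\<bar> < e" if x: "x \<in> \<Omega>" and y: "y \<in> \<Omega>" and xy: "code N x = code N y" for x y
  proof -
    obtain d where d: "d \<in> D" "x \<in> W d" using D(3) x by blast
    then have "code (n d) x = code (n d) d" using W[of d] x by (auto simp: cyl_def)
    moreover have "code (n d) x = code (n d) y"
      using code_refine[OF nN[OF d(1)] x y xy] .
    ultimately have "\<bar>f x - f d\<bar> < e / 2" "\<bar>f y - f d\<bar> < e / 2"
      using n[of d] d(1) D(1) x y by auto
    then show ?thesis by linarith
  qed
  then show ?thesis by blast
qed

lemma continuous_integrable:
  assumes M: "sets M = sets bor" "finite_measure M" and f: "continuous_on \<Omega> (f :: 'a \<Rightarrow> real)"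
  shows "integrable M f"
proof -
  interpret finite_measure M by fact
  have meas: "f \<in> borel_measurable M"
    using borel_measurable_continuous_on_restrict[OF f] measurable_cong_sets[OF M(1) refl] by blast
  have "bounded (f ` \<Omega>)"
    using compact_continuous_image[OF f compact_space] compact_imp_bounded by blast
  then obtain B where "\<forall>x\<in>\<Omega>. norm (f x) \<le> B"
    by (auto simp: bounded_iff)
  then show ?thesis
    using meas by (intro integrable_const_bound[of _ B]) (auto simp: space_eq[OF M(1)])
qed

text \<open>The step function with the value of f at one point of each cell is within e of f. Depth
  and values are chosen before the measure, so one approximation serves all the measures that are
  compared.\<close>

lemma integral_approx:
  assumes f: "continuous_on \<Omega> (f :: 'a \<Rightarrow> real)" and e: "e > 0"
  shows "\<exists>n g. \<forall>M. sets M = sets bor \<longrightarrow> finite_measure M \<longrightarrow>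
    \<bar>(\<integral>x. f x \<partial>M) - (\<Sum>c\<in>code n ` \<Omega>. g c * measure M (cyl n c))\<bar> \<le> e * measure M \<Omega>"
proof -
  obtain n where n: "\<forall>x\<in>\<Omega>. \<forall>y\<in>\<Omega>. code n x = code n y \<longrightarrow> \<bar>f x - f y\<bar> < e"
    using continuous_code_osc[OF f e] by blast
  define g where "g c = f (SOME y. y \<in> \<Omega> \<and> code n y = c)" for c
  have g: "\<bar>f x - g (code n x)\<bar> < e" if "x \<in> \<Omega>" for x
  proof -
    have "(SOME y. y \<in> \<Omega> \<and> code n y = code n x) \<in> \<Omega> \<and> code n (SOME y. y \<in> \<Omega> \<and> code n y = code n x) = code n x"
      by (rule someI[of _ x]) (use that in auto)
    then show ?thesis
      using n[rule_format, OF that, of "SOME y. y \<in> \<Omega> \<and> code n y = code n x"] by (simp add: g_def)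
  qed
  have "\<bar>(\<integral>x. f x \<partial>M) - (\<Sum>c\<in>code n ` \<Omega>. g c * measure M (cyl n c))\<bar> \<le> e * measure M \<Omega>"
    if M: "sets M = sets bor" "finite_measure M" for M
  proof -
    interpret finite_measure M by fact
    have sp: "space M = \<Omega>" by (rule space_eq[OF M(1)])
    have cylM: "cyl n c \<in> sets M" for c
      using M cyls_sets cyl_in_cyls by simp
    let ?s = "\<lambda>x. \<Sum>c\<in>code n ` \<Omega>. g c * indicator (cyl n c) x"
    have int_s: "integrable M ?s"
      by (intro Bochner_Integration.integrable_sum integrable_mult_right integrable_real_indicator cylM)
         (simp add: emeasure_eq_measure)
    have "(\<integral>x. ?s x \<partial>M) = (\<Sum>c\<in>code n ` \<Omega>. g c * measure M (cyl n c))"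
      by (subst Bochner_Integration.integral_sum)
         (use cylM sets.sets_into_space[OF cylM] in \<open>auto simp: emeasure_eq_measure Int_absorb2\<close>)
    moreover have s: "?s x = g (code n x)" if "x \<in> \<Omega>" for x
    proof -
      have "?s x = (\<Sum>c\<in>code n ` \<Omega>. if c = code n x then g c else 0)"
        using that by (intro sum.cong) (auto simp: cyl_def)
      then show ?thesis using that finite_code by simp
    qed
    moreover have "\<bar>(\<integral>x. f x \<partial>M) - (\<integral>x. ?s x \<partial>M)\<bar> \<le> (\<integral>x. e \<partial>M)"
    proof -
      have "(\<integral>x. f x \<partial>M) - (\<integral>x. ?s x \<partial>M) = (\<integral>x. f x - ?s x \<partial>M)"
        using continuous_integrable[OF M f] int_s by simp
      also have "\<bar>\<dots>\<bar> \<le> (\<integral>x. \<bar>f x - ?s x\<bar> \<partial>M)"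
        by (rule integral_abs_bound)
      also have "\<dots> \<le> (\<integral>x. e \<partial>M)"
        using continuous_integrable[OF M f] int_s s g
        by (intro integral_mono) (auto simp: sp less_imp_le)
      finally show ?thesis .
    qed
    ultimately show ?thesis
      by (simp add: sp mult.commute)
  qed
  then show ?thesis by blast
qed

text \<open>Only the values of the three measures on sets are related, possibly with negative
  coefficients. For the common step function of \<open>integral_approx\<close> the identity is one
  of finite sums, and the error is e times \<open>K\<close>, the sum of the masses weighted by the
  absolute coefficients.\<close>

lemma integral_lincomb:
  assumes f: "continuous_on \<Omega> (f :: 'a \<Rightarrow> real)"
    and L: "sets L = sets bor" "finite_measure L"
    and M: "sets M = sets bor" "finite_measure M"
    and N: "sets N = sets bor" "finite_measure N"
    and eq: "\<And>A. A \<in> sets bor \<Longrightarrow> measure L A = a * measure M A + b * measure N A"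
  shows "(\<integral>x. f x \<partial>L) = a * (\<integral>x. f x \<partial>M) + b * (\<integral>x. f x \<partial>N)"
proof -
  define K where "K = measure L \<Omega> + \<bar>a\<bar> * measure M \<Omega> + \<bar>b\<bar> * measure N \<Omega>"
  have K: "K \<ge> 0" by (simp add: K_def)
  have "\<bar>(\<integral>x. f x \<partial>L) - (a * (\<integral>x. f x \<partial>M) + b * (\<integral>x. f x \<partial>N))\<bar> \<le> e * K" if e: "e > 0" for e
  proof -
    obtain n g where ng: "\<And>M. sets M = sets bor \<Longrightarrow> finite_measure M \<Longrightarrow>
      \<bar>(\<integral>x. f x \<partial>M) - (\<Sum>c\<in>code n ` \<Omega>. g c * measure M (cyl n c))\<bar> \<le> e * measure M \<Omega>"
      using integral_approx[OF f e] by blast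
    define S where "S M = (\<Sum>c\<in>code n ` \<Omega>. g c * measure M (cyl n c))" for M
    have S: "S L = a * S M + b * S N"
      unfolding S_def sum_distrib_left sum.distrib[symmetric]
      by (intro sum.cong refl) (simp add: eq cyls_sets cyl_in_cyls algebra_simps)
    have bd: "\<bar>(\<integral>x. f x \<partial>L) - S L\<bar> \<le> e * measure L \<Omega>" "\<bar>(\<integral>x. f x \<partial>M) - S M\<bar> \<le> e * measure M \<Omega>"
      "\<bar>(\<integral>x. f x \<partial>N) - S N\<bar> \<le> e * measure N \<Omega>"
      unfolding S_def by (intro ng L M N)+
    have "\<bar>a * ((\<integral>x. f x \<partial>M) - S M)\<bar> \<le> \<bar>a\<bar> * (e * measure M \<Omega>)"
      unfolding abs_mult using bd(2) by (intro mult_left_mono) auto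
    moreover have "\<bar>b * ((\<integral>x. f x \<partial>N) - S N)\<bar> \<le> \<bar>b\<bar> * (e * measure N \<Omega>)"
      unfolding abs_mult using bd(3) by (intro mult_left_mono) auto
    moreover have "(\<integral>x. f x \<partial>L) - (a * (\<integral>x. f x \<partial>M) + b * (\<integral>x. f x \<partial>N)) =
       ((\<integral>x. f x \<partial>L) - S L) - a * ((\<integral>x. f x \<partial>M) - S M) - b * ((\<integral>x. f x \<partial>N) - S N)"
      using S by (simp add: algebra_simps)
    moreover have "e * K = e * measure L \<Omega> + \<bar>a\<bar> * (e * measure M \<Omega>) + \<bar>b\<bar> * (e * measure N \<Omega>)"
      by (simp add: K_def algebra_simps)
    ultimately show ?thesis
      using bd(1) by linarith
  qed
  note bound = this
  have "\<bar>(\<integral>x. f x \<partial>L) - (a * (\<integral>x. f x \<partial>M) + b * (\<integral>x. f x \<partial>N))\<bar> \<le> e" if "e > 0" for e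
  proof -
    have "e / (K + 1) > 0" using that K by simp
    from bound[OF this] show ?thesis
      using that K by (elim order_trans) (simp add: field_simps)
  qed
  then have "\<bar>(\<integral>x. f x \<partial>L) - (a * (\<integral>x. f x \<partial>M) + b * (\<integral>x. f x \<partial>N))\<bar> \<le> 0"
    using field_le_epsilon[of "\<bar>(\<integral>x. f x \<partial>L) - (a * (\<integral>x. f x \<partial>M) + b * (\<integral>x. f x \<partial>N))\<bar>" 0] by simp
  then show ?thesis by simp
qed

lemma ifun_lincomb:
  assumes L: "sets L = sets bor" "finite_measure L"
    and M: "sets M = sets bor" "finite_measure M"
    and N: "sets N = sets bor" "finite_measure N"
    and eq: "\<And>A. A \<in> sets bor \<Longrightarrow> measure L A = a * measure M A + b * measure N A"
  shows "ifun L = a *\<^sub>R ifun M + b *\<^sub>R ifun N"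
  using integral_lincomb[OF _ assms] by (auto simp: ifun_def fun_eq_iff scaleR_fun_def)

lemma continuous_indicator_cyls:
  assumes "A \<in> cyls" shows "continuous_on \<Omega> (indicator A :: 'a \<Rightarrow> real)"
proof -
  have "continuous_on (A \<union> (\<Omega> - A)) (\<lambda>x. if x \<in> A then 1 else 0 :: real)"
    using assms closed_cyls[of A] closed_cyls[of "\<Omega> - A"]
    by (intro continuous_on_cases) auto
  moreover have "A \<union> (\<Omega> - A) = \<Omega>" using assms cyls.sets_into_space by auto
  ultimately show ?thesis by (simp add: indicator_def of_bool_def)
qed

lemma ifun_indicator:
  assumes "sets M = sets bor" "finite_measure M" "A \<in> cyls"
  shows "ifun M (indicator A) = measure M A"
  using assms continuous_indicator_cyls[OF assms(3)] cyls_sets[OF assms(3)] cyls.sets_into_space[OF assms(3)]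
  by (simp add: ifun_def space_eq Int_absorb2)

lemma ifun_inject:
  assumes M: "sets M = sets bor" "finite_measure M" and N: "sets N = sets bor" "finite_measure N"
    and eq: "ifun M = ifun N"
  shows "M = N"
proof (rule measure_eqI_cyls[OF M N])
  fix A assume "A \<in> cyls"
  then show "measure M A = measure N A"
    using ifun_indicator[OF M] ifun_indicator[OF N] eq by metis
qed

lemma probsD: "M \<in> probs \<Longrightarrow> sets M = sets bor" "M \<in> probs \<Longrightarrow> finite_measure M"
  "M \<in> probs \<Longrightarrow> measure M \<Omega> = 1"
  by (auto simp: probs_def prob_space.finite_measure space_eq dest: prob_space.prob_space)

lemma probsI:
  assumes "sets M = sets bor" "finite_measure M" "measure M \<Omega> = 1"
  shows "M \<in> probs"
  using assms finite_measure.emeasure_eq_measure[of M \<Omega>]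
  by (auto simp: probs_def space_eq intro!: prob_spaceI)

text \<open>Weak* approximation is reduced to the cells of a single depth: finitely many test
  functions are replaced by step functions, whose cells are unions of cells of the largest depth
  \<open>m\<close>.\<close>

lemma ifun_closure_of_cyl:
  assumes M: "M \<in> probs" and S: "S \<subseteq> probs"
    and ap: "\<And>n e. e > 0 \<Longrightarrow> \<exists>N\<in>S. \<forall>c\<in>code n ` \<Omega>. \<bar>measure N (cyl n c) - measure M (cyl n c)\<bar> < e"
  shows "ifun M \<in> closure (ifun ` S)"
proof (rule closure_fun_iff[THEN iffD2], intro allI impI)
  fix F :: "('a \<Rightarrow> real) set" and e :: real
  assume F: "finite F" and e: "e > 0"
  let ?F = "{f \<in> F. continuous_on \<Omega> f}"
  have "\<forall>f\<in>?F. \<exists>p. \<forall>M. sets M = sets bor \<longrightarrow> finite_measure M \<longrightarrow>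
    \<bar>(\<integral>x. f x \<partial>M) - (\<Sum>c\<in>code (fst p) ` \<Omega>. snd p c * measure M (cyl (fst p) c))\<bar> \<le> (e/4) * measure M \<Omega>"
  proof
    fix f assume "f \<in> ?F"
    then obtain n g where "\<forall>M. sets M = sets bor \<longrightarrow> finite_measure M \<longrightarrow>
      \<bar>(\<integral>x. f x \<partial>M) - (\<Sum>c\<in>code n ` \<Omega>. g c * measure M (cyl n c))\<bar> \<le> (e/4) * measure M \<Omega>"
      using integral_approx[of f "e/4"] e by auto
    then show "\<exists>p. \<forall>M. sets M = sets bor \<longrightarrow> finite_measure M \<longrightarrow>
      \<bar>(\<integral>x. f x \<partial>M) - (\<Sum>c\<in>code (fst p) ` \<Omega>. snd p c * measure M (cyl (fst p) c))\<bar> \<le> (e/4) * measure M \<Omega>"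
      by (intro exI[of _ "(n, g)"]) simp
  qed
  from bchoice[OF this] obtain p where p: "\<forall>f\<in>?F. \<forall>M. sets M = sets bor \<longrightarrow> finite_measure M \<longrightarrow>
    \<bar>(\<integral>x. f x \<partial>M) - (\<Sum>c\<in>code (fst (p f)) ` \<Omega>. snd (p f) c * measure M (cyl (fst (p f)) c))\<bar> \<le> (e/4) * measure M \<Omega>" ..
  define n g where "n f = fst (p f)" and "g f = snd (p f)" for f
  have ng: "\<bar>(\<integral>x. f x \<partial>M) - (\<Sum>c\<in>code (n f) ` \<Omega>. g f c * measure M (cyl (n f) c))\<bar> \<le> (e/4) * measure M \<Omega>"
    if "f \<in> ?F" "sets M = sets bor" "finite_measure M" for f M
    using p that by (simp add: n_def g_def)
  define m where "m = Max (insert 0 (n ` F))"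
  have nm: "n f \<le> m" if "f \<in> F" for f
    using that F by (auto simp: m_def)
  define K where "K = Max (insert 0 ((\<lambda>f. \<Sum>c\<in>code (n f) ` \<Omega>. \<bar>g f c\<bar>) ` F))"
  have K: "K \<ge> 0" "\<And>f. f \<in> F \<Longrightarrow> (\<Sum>c\<in>code (n f) ` \<Omega>. \<bar>g f c\<bar>) \<le> K"
    using F by (auto simp: K_def)
  define Q where "Q = real (card (code m ` \<Omega>)) + 1"
  have Q: "Q > 0" by (simp add: Q_def add_nonneg_pos)
  \<comment> \<open>A cell of smaller depth has fewer than \<open>Q\<close> parts and the step
    functions have coefficient sums at most \<open>K\<close>, so their integrals differ by at most
    e/4. Replacing f under each of the two measures costs another e/4.\<close>
  have "e / (4 * (K + 1)) / Q > 0"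
    using e K(1) Q by simp
  then obtain N where N: "N \<in> S" "\<And>c. c \<in> code m ` \<Omega> \<Longrightarrow> \<bar>measure N (cyl m c) - measure M (cyl m c)\<bar> < e / (4 * (K + 1)) / Q"
    using ap by meson
  have NP: "N \<in> probs" using N S by blast
  have small: "\<bar>measure N (cyl k c) - measure M (cyl k c)\<bar> \<le> e / (4 * (K + 1))" if km: "k \<le> m" for k c
  proof -
    obtain B where B: "cyl k c = {x \<in> \<Omega>. code m x \<in> B}"
      using cyls_lift[OF km, of "{c}"] by (simp add: cyl_def)
    have "measure N (cyl k c) - measure M (cyl k c) =
      (\<Sum>c\<in>B \<inter> code m ` \<Omega>. measure N (cyl m c) - measure M (cyl m c))"
      unfolding B using measure_cyls_decomp probsD[OF M] probsD[OF NP] by (simp add: sum_subtractf)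
    also have "\<bar>\<dots>\<bar> \<le> (\<Sum>c\<in>B \<inter> code m ` \<Omega>. \<bar>measure N (cyl m c) - measure M (cyl m c)\<bar>)"
      by (rule sum_abs)
    also have "\<dots> \<le> (\<Sum>c\<in>B \<inter> code m ` \<Omega>. e / (4 * (K + 1)) / Q)"
      using N by (intro sum_mono) (simp add: less_imp_le)
    also have "\<dots> = real (card (B \<inter> code m ` \<Omega>)) * (e / (4 * (K + 1)) / Q)" by simp
    also have "\<dots> \<le> Q * (e / (4 * (K + 1)) / Q)"
    proof (intro mult_right_mono)
      have "card (B \<inter> code m ` \<Omega>) \<le> card (code m ` \<Omega>)"
        by (intro card_mono finite_code) auto
      then show "real (card (B \<inter> code m ` \<Omega>)) \<le> Q" by (simp add: Q_def)
    qed (use e K(1) Q in simp)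
    also have "\<dots> = e / (4 * (K + 1))"
    proof -
      have "Q * (r / Q) = r" for r
        using Q by simp
      then show ?thesis .
    qed
    finally show ?thesis .
  qed
  have "\<bar>ifun N f - ifun M f\<bar> < e" if f: "f \<in> F" for f
  proof (cases "continuous_on \<Omega> f")
    case True
    define s where "s M = (\<Sum>c\<in>code (n f) ` \<Omega>. g f c * measure M (cyl (n f) c))" for M
    have 1: "\<bar>(\<integral>x. f x \<partial>M) - s M\<bar> \<le> e / 4" "\<bar>(\<integral>x. f x \<partial>N) - s N\<bar> \<le> e / 4"
      using ng[of f M] ng[of f N] f True probsD[OF M] probsD[OF NP] by (simp_all add: s_def)
    have "\<bar>s N - s M\<bar> = \<bar>\<Sum>c\<in>code (n f) ` \<Omega>. g f c * (measure N (cyl (n f) c) - measure M (cyl (n f) c))\<bar>"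
      by (simp add: s_def sum_subtractf[symmetric] right_diff_distrib)
    also have "\<dots> \<le> (\<Sum>c\<in>code (n f) ` \<Omega>. \<bar>g f c * (measure N (cyl (n f) c) - measure M (cyl (n f) c))\<bar>)"
      by (rule sum_abs)
    also have "\<dots> \<le> (\<Sum>c\<in>code (n f) ` \<Omega>. \<bar>g f c\<bar> * (e / (4 * (K + 1))))"
      unfolding abs_mult using small[OF nm[OF f]] by (intro sum_mono mult_left_mono) auto
    also have "\<dots> \<le> K * (e / (4 * (K + 1)))"
      unfolding sum_distrib_right[symmetric] using K e f by (intro mult_right_mono) auto
    also have "\<dots> \<le> e / 4"
      using K(1) e by (simp add: field_simps)
    finally have "\<bar>(\<integral>x. f x \<partial>N) - (\<integral>x. f x \<partial>M)\<bar> < e"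
      using 1 e by linarith
    then show ?thesis
      using True by (simp add: ifun_def)
  next
    case False
    then show ?thesis using e by (simp add: ifun_def)
  qed
  then show "\<exists>\<psi>\<in>ifun ` S. \<forall>f\<in>F. \<bar>\<psi> f - ifun M f\<bar> < e"
    using N(1) by blast
qed

lemma ifun_closure_cyls:
  assumes M: "M \<in> probs" and S: "S \<subseteq> probs" and cl: "ifun M \<in> closure (ifun ` S)" and e: "e > 0"
    and C: "finite \<C>" "\<C> \<subseteq> cyls"
  shows "\<exists>N\<in>S. \<forall>A\<in>\<C>. \<bar>measure N A - measure M A\<bar> < e"
proof -
  obtain N where N: "N \<in> S" "\<forall>f\<in>indicator ` \<C>. \<bar>ifun N f - ifun M f\<bar> < e"
    using closure_fun_iff[THEN iffD1, OF cl] e C(1) by blast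
  have NP: "N \<in> probs"
    using N(1) S by blast
  have "\<bar>measure N A - measure M A\<bar> < e" if A: "A \<in> \<C>" for A
    using bspec[OF N(2) imageI[OF A]] ifun_indicator[OF probsD(1,2)[OF M] subsetD[OF C(2) A]]
      ifun_indicator[OF probsD(1,2)[OF NP] subsetD[OF C(2) A]] by simp
  then show ?thesis
    using N(1) by blast
qed

lemma ifun_bounded:
  assumes f: "continuous_on \<Omega> f" and B: "\<And>x. x \<in> \<Omega> \<Longrightarrow> \<bar>f x\<bar> \<le> B" and M: "M \<in> probs"
  shows "\<bar>ifun M f\<bar> \<le> B"
proof -
  interpret prob_space M using M by (simp add: probs_def)
  have "\<bar>\<integral>x. f x \<partial>M\<bar> \<le> (\<integral>x. \<bar>f x\<bar> \<partial>M)"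
    by (rule integral_abs_bound)
  also have "\<dots> \<le> (\<integral>x. B \<partial>M)"
    using continuous_integrable[OF probsD(1,2)[OF M] f] B
    by (intro integral_mono) (auto simp: space_eq[OF probsD(1)[OF M]])
  finally show ?thesis
    using f by (simp add: ifun_def prob_space)
qed

text \<open>The functionals lie in a product of compact intervals, so closedness suffices. A limit
  functional is nonnegative and additive on indicators of clopen sets, and
  \<open>extend_cyls\<close> turns it into a measure.\<close>

lemma compact_probs: "compact (ifun ` probs)" and closed_probs: "closed (ifun ` probs)"
proof -
  define b where "b f = (if continuous_on \<Omega> f then SUP x\<in>\<Omega>. \<bar>f x\<bar> else 0)" for f :: "'a \<Rightarrow> real"
  have "ifun M f \<in> {- b f..b f}" if "M \<in> probs" for M f
  proof (cases "continuous_on \<Omega> f")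
    case True
    then have "compact ((\<lambda>x. \<bar>f x\<bar>) ` \<Omega>)"
      by (intro compact_continuous_image continuous_intros compact_space)
    then have bdd: "bdd_above ((\<lambda>x. \<bar>f x\<bar>) ` \<Omega>)"
      by (intro bounded_imp_bdd_above compact_imp_bounded)
    have "\<bar>ifun M f\<bar> \<le> b f"
      using True bdd by (intro ifun_bounded that) (auto simp: b_def intro: cSUP_upper)
    then show ?thesis by (auto simp: abs_le_iff)
  qed (simp add: ifun_def b_def)
  then have sub: "ifun ` probs \<subseteq> Pi\<^sub>E UNIV (\<lambda>f. {- b f..b f})"
    by (auto simp: PiE_iff)
  have "compactin (product_topology (\<lambda>_. euclidean) UNIV) (Pi\<^sub>E UNIV (\<lambda>f. {- b f..b f}))"
    by (simp add: compactin_PiE)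
  then have cpt: "compact (Pi\<^sub>E UNIV (\<lambda>f. {- b f..b f}))"
    by (simp add: euclidean_product_topology)
  have "closed (ifun ` probs)"
  proof -
    have "\<phi> \<in> ifun ` probs" if \<phi>: "\<phi> \<in> closure (ifun ` probs)" for \<phi>
    proof -
      have ap: "\<exists>M\<in>probs. \<forall>f\<in>F. \<bar>ifun M f - \<phi> f\<bar> < e" if "finite F" "e > 0" for F e
        using closure_fun_iff[THEN iffD1, OF \<phi>] that by blast
      define p where "p A = \<phi> (indicator A)" for A
      have p_nonneg: "0 \<le> p A" if A: "A \<in> cyls" for A
      proof (rule ccontr)
        assume "\<not> 0 \<le> p A"
        then obtain M where M: "M \<in> probs" "\<bar>ifun M (indicator A) - p A\<bar> < - p A"
          using ap[of "{indicator A}" "- p A"] by (auto simp: p_def)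
        then show False
          using ifun_indicator[OF probsD(1,2)[OF M(1)] A] measure_nonneg[of M A] by linarith
      qed
      have p_add: "p (A \<union> B) = p A + p B" if AB: "A \<in> cyls" "B \<in> cyls" "A \<inter> B = {}" for A B
      proof (rule ccontr)
        assume ne: "p (A \<union> B) \<noteq> p A + p B"
        define e where "e = \<bar>p (A \<union> B) - (p A + p B)\<bar> / 3"
        have "e > 0" using ne by (simp add: e_def)
        then obtain M where M: "M \<in> probs"
          "\<bar>ifun M (indicator A) - p A\<bar> < e" "\<bar>ifun M (indicator B) - p B\<bar> < e"
          "\<bar>ifun M (indicator (A \<union> B)) - p (A \<union> B)\<bar> < e"
          using ap[of "{indicator A, indicator B, indicator (A \<union> B)}" e] by (auto simp: p_def)
        interpret finite_measure M using M probsD by blast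
        have "measure M (A \<union> B) = measure M A + measure M B"
          using AB cyls_sets probsD[OF M(1)] by (intro finite_measure_Union) auto
        then have "ifun M (indicator (A \<union> B)) = ifun M (indicator A) + ifun M (indicator B)"
          using ifun_indicator[OF probsD(1,2)[OF M(1)]] AB(1,2) cyls.Un[OF AB(1,2)] by simp
        then have "\<bar>p (A \<union> B) - (p A + p B)\<bar> < 3 * e"
          using M(2-4) by linarith
        then show False by (simp add: e_def)
      qed
      obtain M where M: "sets M = sets bor" "finite_measure M" "\<And>A. A \<in> cyls \<Longrightarrow> measure M A = p A"
        using extend_cyls[of p, OF p_nonneg p_add] by blast
      have "p \<Omega> = 1"
      proof (rule ccontr)
        assume "p \<Omega> \<noteq> 1"
        then obtain N where N: "N \<in> probs" "\<bar>ifun N (indicator \<Omega>) - p \<Omega>\<bar> < \<bar>1 - p \<Omega>\<bar>"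
          using ap[of "{indicator \<Omega>}" "\<bar>1 - p \<Omega>\<bar>"] by (auto simp: p_def)
        then show False
          using ifun_indicator[OF probsD(1,2)[OF N(1)] cyls.top] probsD[OF N(1)] by simp
      qed
      then have MP: "M \<in> probs"
        using M cyls.top by (intro probsI) auto
      have "\<phi> f = ifun M f" for f
      proof (cases "continuous_on \<Omega> f")
        case True
        have "\<bar>\<phi> f - ifun M f\<bar> \<le> e" if e: "e > 0" for e
        proof -
          obtain n g where ng: "\<And>M. sets M = sets bor \<Longrightarrow> finite_measure M \<Longrightarrow>
            \<bar>(\<integral>x. f x \<partial>M) - (\<Sum>c\<in>code n ` \<Omega>. g c * measure M (cyl n c))\<bar> \<le> (e/4) * measure M \<Omega>"
            using integral_approx[OF True, of "e/4"] e by auto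
          define K where "K = (\<Sum>c\<in>code n ` \<Omega>. \<bar>g c\<bar>)"
          have K: "K \<ge> 0" by (simp add: K_def sum_nonneg)
          define d where "d = min (e/4) (e / (4 * (K + 1)))"
          have d: "d > 0" "d \<le> e/4" "d \<le> e / (4 * (K + 1))"
            unfolding d_def using e K by (simp_all only: min.cobounded1 min.cobounded2) simp
          \<comment> \<open>One measure N is close to \<open>\<phi>\<close> both at f and at the
            indicators of all cells of depth n, so \<open>\<phi> f\<close> and
            \<open>ifun M f\<close> are compared through the same step function.\<close>
          obtain N where N: "N \<in> probs" "\<bar>ifun N f - \<phi> f\<bar> < d"
            "\<And>c. c \<in> code n ` \<Omega> \<Longrightarrow> \<bar>ifun N (indicator (cyl n c)) - \<phi> (indicator (cyl n c))\<bar> < d"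
            using ap[of "insert f ((\<lambda>c. indicator (cyl n c)) ` (code n ` \<Omega>))" d] d(1) finite_code by auto
          define s where "s M = (\<Sum>c\<in>code n ` \<Omega>. g c * measure M (cyl n c))" for M
          have 1: "\<bar>ifun M f - s M\<bar> \<le> e / 4" "\<bar>ifun N f - s N\<bar> \<le> e / 4"
            using ng[of M] ng[of N] True probsD[OF MP] probsD[OF N(1)] by (simp_all add: s_def ifun_def)
          have "\<bar>s N - s M\<bar> = \<bar>\<Sum>c\<in>code n ` \<Omega>. g c * (measure N (cyl n c) - measure M (cyl n c))\<bar>"
            by (simp add: s_def sum_subtractf[symmetric] right_diff_distrib)
          also have "\<dots> \<le> (\<Sum>c\<in>code n ` \<Omega>. \<bar>g c * (measure N (cyl n c) - measure M (cyl n c))\<bar>)"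
            by (rule sum_abs)
          also have "\<dots> \<le> (\<Sum>c\<in>code n ` \<Omega>. \<bar>g c\<bar> * d)"
            unfolding abs_mult
            using N(3) ifun_indicator[OF probsD(1,2)[OF N(1)] cyl_in_cyls] M(3)[OF cyl_in_cyls]
            by (intro sum_mono mult_left_mono) (auto simp: p_def less_imp_le)
          also have "\<dots> = K * d"
            by (simp add: K_def sum_distrib_right)
          also have "\<dots> \<le> K * (e / (4 * (K + 1)))"
            using K d(3) by (intro mult_left_mono)
          also have "\<dots> \<le> e / 4"
            using K e by (simp add: field_simps)
          finally show ?thesis
            using 1 N(2) d(2) by linarith
        qed
        then have "\<bar>\<phi> f - ifun M f\<bar> \<le> 0"
          using field_le_epsilon[of "\<bar>\<phi> f - ifun M f\<bar>" 0] by simp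
        then show ?thesis by simp
      next
        case False
        \<comment> \<open>Every \<open>ifun M\<close> vanishes at a function that is not continuous
          on \<Omega>, hence so does the limit.\<close>
        have "\<bar>\<phi> f\<bar> \<le> e" if "e > 0" for e
          using ap[of "{f}" e] that False by (auto simp: ifun_def)
        then have "\<bar>\<phi> f\<bar> \<le> 0"
          using field_le_epsilon[of "\<bar>\<phi> f\<bar>" 0] by simp
        then show ?thesis using False by (simp add: ifun_def)
      qed
      then show ?thesis using MP by (auto simp: fun_eq_iff intro!: image_eqI[of _ _ M])
    qed
    then show ?thesis
      by (metis closure_subset closure_closed closed_closure subsetI subset_antisym)
  qed
  then show "closed (ifun ` probs)" .
  then show "compact (ifun ` probs)"
    using closed_Int_compact[OF _ cpt, of "ifun ` probs"] sub by (simp add: Int_absorb2)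
qed

text \<open>Evaluation at the countably many indicators of cells is continuous and separates
  measures. On a compact set it is therefore a homeomorphism onto its image in the metrizable space
  of real sequences.\<close>

lemma metrizable_functionals:
  assumes K: "K \<subseteq> ifun ` probs" "compact K"
  shows "metrizable_space (top_of_set K)"
proof -
  define \<Phi> where "\<Phi> \<phi> = (\<lambda>i. \<phi> (indicator (cyl (fst (prod_decode i)) (snd (prod_decode i)))))"
    for \<phi> :: "('a \<Rightarrow> real) \<Rightarrow> real"
  have "continuous_on K \<Phi>"
    unfolding \<Phi>_def by (intro continuous_on_coordinatewise_then_product continuous_on_subset[OF continuous_on_product_coordinates]) auto
  moreover have "inj_on \<Phi> K"
  proof (rule inj_onI)
    fix \<phi> \<psi> assume \<phi>\<psi>: "\<phi> \<in> K" "\<psi> \<in> K" and eq: "\<Phi> \<phi> = \<Phi> \<psi>"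
    then obtain M N where MN: "M \<in> probs" "\<phi> = ifun M" "N \<in> probs" "\<psi> = ifun N"
      using K by blast
    have "M = N"
    proof (rule measure_eqI_cyl)
      fix n c
      show "measure M (cyl n c) = measure N (cyl n c)"
        using fun_cong[OF eq, of "prod_encode (n, c)"] MN
          ifun_indicator[OF probsD(1,2)[OF MN(1)] cyl_in_cyls] ifun_indicator[OF probsD(1,2)[OF MN(3)] cyl_in_cyls]
        by (simp add: \<Phi>_def)
    qed (use MN probsD in auto)
    then show "\<phi> = \<psi>" using MN by simp
  qed
  ultimately obtain g where "homeomorphism K (\<Phi> ` K) \<Phi> g"
    using homeomorphism_compact[OF K(2)] by blast
  then have "top_of_set K homeomorphic_space top_of_set (\<Phi> ` K)"
    unfolding homeomorphic_space_def homeomorphic_maps_def homeomorphism_def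
    by (intro exI[of _ \<Phi>] exI[of _ g]) auto
  moreover have "metrizable_space (top_of_set (\<Phi> ` K))"
    by (simp add: metrizable_space_euclidean metrizable_space_subtopology)
  ultimately show ?thesis
    using homeomorphic_metrizable_space by blast
qed

end

section \<open>The simplex of invariant probability measures\<close>

context coded_space
begin

definition invariant :: "('a \<Rightarrow> 'a) \<Rightarrow> 'a measure \<Rightarrow> bool" where
  "invariant \<tau> M \<longleftrightarrow> (\<forall>A\<in>sets bor. measure M (\<tau> -` A \<inter> \<Omega>) = measure M A)"

definition inv_probs :: "('a \<Rightarrow> 'a) \<Rightarrow> 'a measure set" where
  "inv_probs \<tau> = {M \<in> probs. invariant \<tau> M}"

definition inv_fins :: "('a \<Rightarrow> 'a) \<Rightarrow> 'a measure set" where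
  "inv_fins \<tau> = {M. sets M = sets bor \<and> finite_measure M \<and> invariant \<tau> M}"

text \<open>The mass is the height coordinate in the definition of \<open>choquet_simplex\<close>:
  this map sends the finite invariant measures onto the cone over the invariant probability
  measures.\<close>

definition height_functional :: "'a measure \<Rightarrow> (('a \<Rightarrow> real) \<Rightarrow> real) \<times> real" where
  "height_functional M = (ifun M, measure M \<Omega>)"

lemma distr_eq_iff_invariant:
  assumes M: "sets M = sets bor" "finite_measure M" and \<tau>: "\<tau> \<in> measurable bor bor"
  shows "distr M M \<tau> = M \<longleftrightarrow> invariant \<tau> M"
proof -
  interpret finite_measure M by fact
  have \<tau>M: "\<tau> \<in> measurable M M"
    using \<tau> M(1) measurable_cong_sets by blast
  have sp: "space M = \<Omega>" by (rule space_eq[OF M(1)])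
  have em: "emeasure (distr M M \<tau>) A = ennreal (measure M (\<tau> -` A \<inter> \<Omega>))" if "A \<in> sets bor" for A
    using emeasure_distr[OF \<tau>M, of A] that M(1) by (simp add: sp emeasure_eq_measure)
  show ?thesis
  proof
    assume eq: "distr M M \<tau> = M"
    show "invariant \<tau> M"
      unfolding invariant_def using em by (simp add: eq emeasure_eq_measure)
  next
    assume "invariant \<tau> M"
    then show "distr M M \<tau> = M"
      by (intro measure_eqI) (simp_all add: em M(1) invariant_def emeasure_eq_measure)
  qed
qed

lemma invariant_lincomb:
  assumes "invariant \<tau> M" "invariant \<tau> N" "\<tau> \<in> measurable bor bor"
    and eq: "\<And>A. A \<in> sets bor \<Longrightarrow> measure L A = a * measure M A + b * measure N A"
  shows "invariant \<tau> L"
  unfolding invariant_def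
proof
  fix A assume A: "A \<in> sets bor"
  have "\<tau> -` A \<inter> \<Omega> \<in> sets bor"
    using measurable_sets[OF assms(3) A] by simp
  then show "measure L (\<tau> -` A \<inter> \<Omega>) = measure L A"
    using A assms(1,2) by (simp add: eq invariant_def)
qed

lemma height_functional_lincomb:
  assumes L: "sets L = sets bor" "finite_measure L"
    and M: "sets M = sets bor" "finite_measure M"
    and N: "sets N = sets bor" "finite_measure N"
    and eq: "\<And>A. A \<in> sets bor \<Longrightarrow> measure L A = a * measure M A + b * measure N A"
  shows "height_functional L = a *\<^sub>R height_functional M + b *\<^sub>R height_functional N"
  using ifun_lincomb[OF assms] eq[OF cyls_sets[OF cyls.top]] by (simp add: height_functional_def)

lemma inv_fins_lincomb:
  fixes a b :: real
  assumes \<tau>: "\<tau> \<in> measurable bor bor" and M: "M \<in> inv_fins \<tau>" and N: "N \<in> inv_fins \<tau>"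
    and nonneg: "\<And>A. A \<in> sets bor \<Longrightarrow> 0 \<le> a * measure M A + b * measure N A"
  obtains L where "L \<in> inv_fins \<tau>" "\<And>A. A \<in> sets bor \<Longrightarrow> measure L A = a * measure M A + b * measure N A"
    "height_functional L = a *\<^sub>R height_functional M + b *\<^sub>R height_functional N"
proof -
  have M': "sets M = sets bor" "finite_measure M" "invariant \<tau> M"
    and N': "sets N = sets bor" "finite_measure N" "invariant \<tau> N"
    using M N by (auto simp: inv_fins_def)
  obtain L where L: "sets L = sets bor" "finite_measure L"
    "\<And>A. A \<in> sets bor \<Longrightarrow> measure L A = a * measure M A + b * measure N A"
    using finite_measure_lincomb[OF M'(2) N'(2), of a b] M' N' nonneg by auto
  have "L \<in> inv_fins \<tau>"
    using L invariant_lincomb[OF M'(3) N'(3) \<tau> L(3)] by (simp add: inv_fins_def)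
  then show ?thesis
    using that L(3) height_functional_lincomb[OF L(1,2) M'(1,2) N'(1,2) L(3)] by blast
qed

lemma inv_probs_subset_fins: "inv_probs \<tau> \<subseteq> inv_fins \<tau>"
  by (auto simp: inv_probs_def inv_fins_def probsD)

lemma inv_finsD: "M \<in> inv_fins \<tau> \<Longrightarrow> sets M = sets bor" "M \<in> inv_fins \<tau> \<Longrightarrow> finite_measure M"
  by (auto simp: inv_fins_def)

lemma cone_inv_probs:
  assumes \<tau>: "\<tau> \<in> measurable bor bor" and ne: "inv_probs \<tau> \<noteq> {}"
  shows "cone hull (ifun ` inv_probs \<tau> \<times> {1}) = height_functional ` inv_fins \<tau>"
proof (intro set_eqI iffI)
  fix v assume "v \<in> cone hull (ifun ` inv_probs \<tau> \<times> {1 :: real})"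
  then obtain c M where cM: "c \<ge> 0" "M \<in> inv_probs \<tau>" "v = c *\<^sub>R (ifun M, 1)"
    unfolding cone_hull_expl by auto
  have MF: "M \<in> inv_fins \<tau>" using cM inv_probs_subset_fins by blast
  obtain L where "L \<in> inv_fins \<tau>" "height_functional L = c *\<^sub>R height_functional M + 0 *\<^sub>R height_functional M"
    by (rule inv_fins_lincomb[OF \<tau> MF MF, of c 0]) (use cM in auto)
  then show "v \<in> height_functional ` inv_fins \<tau>"
    using cM by (intro image_eqI[of _ _ L]) (auto simp: height_functional_def inv_probs_def probsD)
next
  fix v assume "v \<in> height_functional ` inv_fins \<tau>"
  then obtain M where M: "M \<in> inv_fins \<tau>" "v = height_functional M" by blast
  interpret finite_measure M using inv_finsD[OF M(1)] by blast
  \<comment> \<open>Supplies a direction for the zero measure, which cannot be normalised.\<close>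
  obtain M0 where M0: "M0 \<in> inv_probs \<tau>" using ne by blast
  then have M0': "M0 \<in> inv_fins \<tau>" using inv_probs_subset_fins by blast
  define c where "c = measure M \<Omega>"
  have c: "c \<ge> 0" by (simp add: c_def)
  have "\<exists>N\<in>inv_probs \<tau>. v = c *\<^sub>R (ifun N, 1)"
  proof (cases "c = 0")
    case True
    have "measure M A = 0" if "A \<in> sets bor" for A
    proof -
      have "measure M A \<le> measure M \<Omega>"
        using that sets.sets_into_space[of A bor] cyls_sets[OF cyls.top] inv_finsD[OF M(1)]
        by (intro finite_measure_mono) auto
      then show ?thesis using True measure_nonneg[of M A] unfolding c_def by linarith
    qed
    then have "height_functional M = 0 *\<^sub>R height_functional M0 + 0 *\<^sub>R height_functional M0"
      using inv_finsD[OF M(1)] inv_finsD[OF M0'] by (intro height_functional_lincomb) auto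
    then show ?thesis using True M M0 by (intro bexI[of _ M0]) (auto simp: zero_prod_def)
  next
    case False
    obtain N where N: "N \<in> inv_fins \<tau>" "\<And>A. A \<in> sets bor \<Longrightarrow> measure N A = inverse c * measure M A + 0 * measure M A"
      "height_functional N = inverse c *\<^sub>R height_functional M + 0 *\<^sub>R height_functional M"
      by (rule inv_fins_lincomb[OF \<tau> M(1) M(1), of "inverse c" 0]) (use c in auto)
    have 1: "measure N \<Omega> = 1"
      using N(2)[OF cyls_sets[OF cyls.top]] False by (simp add: c_def)
    then have "N \<in> inv_probs \<tau>"
      using N(1) inv_finsD[OF N(1)] probsI by (auto simp: inv_probs_def inv_fins_def)
    moreover have "v = c *\<^sub>R height_functional N"
      using N(3) False M by simp
    ultimately show ?thesis using 1 by (auto simp: height_functional_def)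
  qed
  then show "v \<in> cone hull (ifun ` inv_probs \<tau> \<times> {1})"
    unfolding cone_hull_expl using c by blast
qed

lemma convex_inv_probs:
  assumes \<tau>: "\<tau> \<in> measurable bor bor"
  shows "convex (ifun ` inv_probs \<tau>)"
proof (rule convexI)
  fix x y u v :: real and \<phi> \<psi>
  assume \<phi>\<psi>: "\<phi> \<in> ifun ` inv_probs \<tau>" "\<psi> \<in> ifun ` inv_probs \<tau>" and uv: "0 \<le> u" "0 \<le> v" "u + v = 1"
  obtain M N where MN: "M \<in> inv_probs \<tau>" "\<phi> = ifun M" "N \<in> inv_probs \<tau>" "\<psi> = ifun N"
    using \<phi>\<psi> by blast
  have MN': "M \<in> inv_fins \<tau>" "N \<in> inv_fins \<tau>" using MN inv_probs_subset_fins by auto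
  obtain L where L: "L \<in> inv_fins \<tau>"
    "height_functional L = u *\<^sub>R height_functional M + v *\<^sub>R height_functional N"
    by (rule inv_fins_lincomb[OF \<tau> MN', of u v]) (use uv in auto)
  have "ifun L = u *\<^sub>R \<phi> + v *\<^sub>R \<psi>" "measure L \<Omega> = u + v"
    using L(2) MN probsD by (auto simp: height_functional_def inv_probs_def)
  moreover from this have "L \<in> inv_probs \<tau>"
    using L(1) inv_finsD[OF L(1)] probsI uv by (auto simp: inv_probs_def inv_fins_def)
  ultimately show "u *\<^sub>R \<phi> + v *\<^sub>R \<psi> \<in> ifun ` inv_probs \<tau>"
    by (metis image_eqI)
qed

text \<open>The supremum is taken among all finite measures, where \<open>finite_measure_sup\<close>
  provides it. Its leastness there yields both its invariance and its leastness for the order of the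
  cone.\<close>

lemma choquet_simplex_inv_probs:
  assumes \<tau>: "\<tau> \<in> measurable bor bor" and ne: "inv_probs \<tau> \<noteq> {}" and cpt: "compact (ifun ` inv_probs \<tau>)"
  shows "choquet_simplex (ifun ` inv_probs \<tau>)"
proof -
  let ?C = "height_functional ` inv_fins \<tau>"
  let ?V = "{a - b | a b. a \<in> ?C \<and> b \<in> ?C}"
  note comb = inv_fins_lincomb[OF \<tau>]
  have "\<exists>w\<in>?V. is_cone_sup ?C u v w" if uv: "u \<in> ?V" "v \<in> ?V" for u v
  proof -
    obtain \<alpha>1 \<beta>1 where 1: "\<alpha>1 \<in> inv_fins \<tau>" "\<beta>1 \<in> inv_fins \<tau>" "u = height_functional \<alpha>1 - height_functional \<beta>1"
      using uv(1) by blast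
    obtain \<alpha>2 \<beta>2 where 2: "\<alpha>2 \<in> inv_fins \<tau>" "\<beta>2 \<in> inv_fins \<tau>" "v = height_functional \<alpha>2 - height_functional \<beta>2"
      using uv(2) by blast
    \<comment> \<open>A common subtrahend, the sum of \<open>\<beta>1\<close> and
      \<open>\<beta>2\<close>: with \<open>u\<close> and \<open>v\<close> written as
      \<open>\<alpha>\<close> and \<open>\<beta>\<close> minus \<open>s\<close>, their supremum is
      that of two positive measures, minus \<open>s\<close>.\<close>
    obtain s where s: "s \<in> inv_fins \<tau>" "height_functional s = 1 *\<^sub>R height_functional \<beta>1 + 1 *\<^sub>R height_functional \<beta>2"
      by (rule comb[OF 1(2) 2(2), of 1 1]) auto
    obtain \<alpha> where \<alpha>: "\<alpha> \<in> inv_fins \<tau>" "height_functional \<alpha> = 1 *\<^sub>R height_functional \<alpha>1 + 1 *\<^sub>R height_functional \<beta>2"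
      by (rule comb[OF 1(1) 2(2), of 1 1]) auto
    obtain \<beta> where \<beta>: "\<beta> \<in> inv_fins \<tau>" "height_functional \<beta> = 1 *\<^sub>R height_functional \<alpha>2 + 1 *\<^sub>R height_functional \<beta>1"
      by (rule comb[OF 2(1) 1(2), of 1 1]) auto
    have u: "u = height_functional \<alpha> - height_functional s" and v: "v = height_functional \<beta> - height_functional s"
      using 1 2 s \<alpha> \<beta> by simp_all
    note \<alpha>' = inv_finsD[OF \<alpha>(1)] and \<beta>' = inv_finsD[OF \<beta>(1)]
    obtain \<gamma> where \<gamma>: "sets \<gamma> = sets bor" "finite_measure \<gamma>"
      and ub: "\<And>A. A \<in> sets bor \<Longrightarrow> measure \<alpha> A \<le> measure \<gamma> A" "\<And>A. A \<in> sets bor \<Longrightarrow> measure \<beta> A \<le> measure \<gamma> A"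
      and least: "\<And>L A. sets L = sets bor \<Longrightarrow> finite_measure L \<Longrightarrow>
        (\<And>A. A \<in> sets bor \<Longrightarrow> measure \<alpha> A \<le> measure L A \<and> measure \<beta> A \<le> measure L A) \<Longrightarrow>
        A \<in> sets bor \<Longrightarrow> measure \<gamma> A \<le> measure L A"
    proof -
      have "sets \<beta> = sets \<alpha>" using \<alpha>' \<beta>' by simp
      from finite_measure_sup[OF \<alpha>'(2) \<beta>'(2) this] obtain L where
        L: "sets L = sets bor" "finite_measure L"
        and L1: "\<forall>A\<in>sets bor. measure \<alpha> A \<le> measure L A \<and> measure \<beta> A \<le> measure L A"
        and L2: "\<forall>L'. sets L' = sets bor \<and> finite_measure L' \<and>
          (\<forall>A\<in>sets bor. measure \<alpha> A \<le> measure L' A \<and> measure \<beta> A \<le> measure L' A) \<longrightarrow>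
          (\<forall>A\<in>sets bor. measure L A \<le> measure L' A)"
        unfolding \<alpha>'(1) by (elim exE conjE) assumption
      show ?thesis
      proof (rule that[OF L])
        fix A assume "A \<in> sets bor"
        then show "measure \<alpha> A \<le> measure L A" "measure \<beta> A \<le> measure L A"
          using L1 by simp_all
      next
        fix L' A
        assume L': "sets L' = sets bor" "finite_measure L'"
          and le: "\<And>A. A \<in> sets bor \<Longrightarrow> measure \<alpha> A \<le> measure L' A \<and> measure \<beta> A \<le> measure L' A"
          and A: "A \<in> sets bor"
        show "measure L A \<le> measure L' A"
          by (rule L2[THEN spec, THEN mp, THEN bspec, OF _ A]) (use L' le in simp)
      qed
    qed
    \<comment> \<open>The image of the supremum is another upper bound of the same total mass.\<close>
    have "invariant \<tau> \<gamma>"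
    proof -
      interpret \<gamma>: finite_measure \<gamma> by fact
      have sp: "space \<gamma> = \<Omega>" by (rule space_eq[OF \<gamma>(1)])
      have \<tau>\<gamma>: "\<tau> \<in> measurable \<gamma> bor" using \<tau> \<gamma>(1) measurable_cong_sets by blast
      define \<gamma>' where "\<gamma>' = distr \<gamma> bor \<tau>"
      have m': "measure \<gamma>' A = measure \<gamma> (\<tau> -` A \<inter> \<Omega>)" if "A \<in> sets bor" for A
        using measure_distr[OF \<tau>\<gamma> that] by (simp add: \<gamma>'_def sp)
      have ps: "\<tau> -` A \<inter> \<Omega> \<in> sets bor" if "A \<in> sets bor" for A
        using measurable_sets[OF \<tau> that] by simp
      have le: "measure \<gamma> A \<le> measure \<gamma>' A" if "A \<in> sets bor" for A
      proof (rule least[OF _ _ _ that])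
        show "sets \<gamma>' = sets bor" by (simp add: \<gamma>'_def)
        show "finite_measure \<gamma>'" unfolding \<gamma>'_def by (rule \<gamma>.finite_measure_distr[OF \<tau>\<gamma>])
        fix A assume A: "A \<in> sets bor"
        have "measure \<alpha> (\<tau> -` A \<inter> \<Omega>) = measure \<alpha> A" "measure \<beta> (\<tau> -` A \<inter> \<Omega>) = measure \<beta> A"
          using A \<alpha>(1) \<beta>(1) by (auto simp: inv_fins_def invariant_def)
        then show "measure \<alpha> A \<le> measure \<gamma>' A \<and> measure \<beta> A \<le> measure \<gamma>' A"
          using ub[OF ps[OF A]] by (simp add: m'[OF A])
      qed
      have "measure \<gamma> (\<tau> -` A \<inter> \<Omega>) = measure \<gamma> A" if A: "A \<in> sets bor" for A
      proof (rule antisym)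
        \<comment> \<open>As both measures have the same total mass, \<open>le\<close> at the
          complement gives the converse inequality.\<close>
        have A': "\<Omega> - A \<in> sets bor" using sets.compl_sets[OF A] by simp
        have "\<Omega> - (\<tau> -` A \<inter> \<Omega>) = \<tau> -` (\<Omega> - A) \<inter> \<Omega>"
          using measurable_space[OF \<tau>] by auto
        then have "measure \<gamma> \<Omega> - measure \<gamma> (\<tau> -` A \<inter> \<Omega>) = measure \<gamma>' (\<Omega> - A)"
          using \<gamma>.finite_measure_compl[of "\<tau> -` A \<inter> \<Omega>"] ps[OF A] \<gamma>(1) sp by (simp add: m'[OF A'])
        moreover have "measure \<gamma> \<Omega> - measure \<gamma> A = measure \<gamma> (\<Omega> - A)"
          using \<gamma>.finite_measure_compl[of A] A \<gamma>(1) sp by simp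
        ultimately show "measure \<gamma> (\<tau> -` A \<inter> \<Omega>) \<le> measure \<gamma> A"
          using le[OF A'] by linarith
        show "measure \<gamma> A \<le> measure \<gamma> (\<tau> -` A \<inter> \<Omega>)"
          using le[OF A] m'[OF A] by simp
      qed
      then show ?thesis by (simp add: invariant_def)
    qed
    then have \<gamma>I: "\<gamma> \<in> inv_fins \<tau>" using \<gamma> by (simp add: inv_fins_def)
    define w where "w = height_functional \<gamma> - height_functional s"
    have "w \<in> ?V" unfolding w_def 
      by (rule CollectI, rule exI[of _ "height_functional \<gamma>"], rule exI[of _ "height_functional s"])
        (intro conjI refl imageI \<gamma>I s(1))
    moreover have "is_cone_sup ?C u v w"
      unfolding is_cone_sup_def
    proof (intro conjI allI impI)
      obtain L where "L \<in> inv_fins \<tau>" "height_functional L = 1 *\<^sub>R height_functional \<gamma> + (-1) *\<^sub>R height_functional \<alpha>"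
        by (rule comb[OF \<gamma>I \<alpha>(1), of 1 "-1"]) (use ub in auto)
      then show "w - u \<in> ?C" by (intro image_eqI[of _ _ L]) (auto simp: w_def u)
      obtain L where "L \<in> inv_fins \<tau>" "height_functional L = 1 *\<^sub>R height_functional \<gamma> + (-1) *\<^sub>R height_functional \<beta>"
        by (rule comb[OF \<gamma>I \<beta>(1), of 1 "-1"]) (use ub in auto)
      then show "w - v \<in> ?C" by (intro image_eqI[of _ _ L]) (auto simp: w_def v)
      fix z assume "z - u \<in> ?C \<and> z - v \<in> ?C"
      then obtain \<zeta>1 \<zeta>2 where \<zeta>: "\<zeta>1 \<in> inv_fins \<tau>" "z - u = height_functional \<zeta>1"
        "\<zeta>2 \<in> inv_fins \<tau>" "z - v = height_functional \<zeta>2"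
        by blast
      obtain M where M: "M \<in> inv_fins \<tau>" "\<And>A. A \<in> sets bor \<Longrightarrow> measure M A = 1 * measure \<alpha> A + 1 * measure \<zeta>1 A"
        "height_functional M = 1 *\<^sub>R height_functional \<alpha> + 1 *\<^sub>R height_functional \<zeta>1"
        by (rule comb[OF \<alpha>(1) \<zeta>(1), of 1 1]) auto
      obtain N where N: "N \<in> inv_fins \<tau>" "\<And>A. A \<in> sets bor \<Longrightarrow> measure N A = 1 * measure \<beta> A + 1 * measure \<zeta>2 A"
        "height_functional N = 1 *\<^sub>R height_functional \<beta> + 1 *\<^sub>R height_functional \<zeta>2"
        by (rule comb[OF \<beta>(1) \<zeta>(3), of 1 1]) auto
      \<comment> \<open>\<open>z\<close> plus \<open>s\<close> represents both the sum of
        \<open>\<alpha>\<close> and \<open>\<zeta>1\<close> and the sum of \<open>\<beta>\<close>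
        and \<open>\<zeta>2\<close>. By injectivity of \<open>ifun\<close> these are one measure, an
        upper bound of \<open>\<alpha>\<close> and \<open>\<beta>\<close>, so it dominates
        \<open>\<gamma>\<close>.\<close>
      have zM: "height_functional M = z + height_functional s" and zN: "height_functional N = z + height_functional s"
        using M(3) N(3) \<zeta>(2,4)[symmetric] u v by simp_all
      then have "ifun M = ifun N"
        by (simp add: height_functional_def prod_eq_iff)
      then have MN: "M = N"
        using inv_finsD[OF M(1)] inv_finsD[OF N(1)] by (intro ifun_inject)
      have \<gamma>M: "measure \<gamma> A \<le> measure M A" if "A \<in> sets bor" for A
      proof (rule least[OF _ _ _ that])
        fix A assume A: "A \<in> sets bor"
        then show "measure \<alpha> A \<le> measure M A \<and> measure \<beta> A \<le> measure M A"
          using M(2)[OF A] N(2)[OF A, folded MN] measure_nonneg[of \<zeta>1 A] measure_nonneg[of \<zeta>2 A] by linarith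
      qed (use inv_finsD[OF M(1)] in auto)
      obtain L where "L \<in> inv_fins \<tau>" "height_functional L = 1 *\<^sub>R height_functional M + (-1) *\<^sub>R height_functional \<gamma>"
        by (rule comb[OF M(1) \<gamma>I, of 1 "-1"]) (use \<gamma>M in auto)
      then show "z - w \<in> ?C" using zM by (intro image_eqI[of _ _ L]) (auto simp: w_def)
    qed
    ultimately show ?thesis by (rule bexI[rotated])
  qed
  then have "\<forall>u\<in>?V. \<forall>v\<in>?V. \<exists>w\<in>?V. is_cone_sup ?C u v w"
    by (intro ballI)
  then show ?thesis
    unfolding choquet_simplex_def cone_inv_probs[OF \<tau> ne] Let_def
    using ne cpt convex_inv_probs[OF \<tau>] by (intro conjI) simp_all
qed

end

section \<open>Subspaces and squares of coded spaces, and measurable maps into them\<close>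

lemma (in coded_space) coded_subspace:
  assumes "closed A" "A \<subseteq> \<Omega>"
  shows "coded_space A code"
proof
  show "compact A"
    using closed_Int_compact[OF assms(1) compact_space] assms(2) by (simp add: Int_absorb2)
  show "closed A" by fact
  show "finite (code n ` A)" for n
    using finite_code[of n] assms(2) by (meson finite_subset image_mono)
  show "code m x = code m y" if "m \<le> n" "x \<in> A" "y \<in> A" "code n x = code n y" for m n x y
    using code_refine[OF that(1) _ _ that(4)] that assms(2) by blast
  show "closed {x \<in> A. code n x = c}" for n c
  proof -
    have "{x \<in> A. code n x = c} = A \<inter> {x \<in> \<Omega>. code n x = c}"
      using assms(2) by auto
    then show ?thesis using closed_Int[OF assms(1) closed_code[of n c]] by simp
  qed
  show "\<exists>n. \<forall>y\<in>A. code n y = code n x \<longrightarrow> y \<in> U" if "open U" "x \<in> A \<inter> U" for U x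
    using code_nhds[OF that(1), of x] that(2) assms(2) by blast
qed

lemma (in coded_space) coded_square:
  "coded_space (\<Omega> \<times> \<Omega>) (\<lambda>n z. prod_encode (code n (fst z), code n (snd z)))"
proof
  show "compact (\<Omega> \<times> \<Omega>)"
    by (intro compact_Times compact_space)
  show "closed (\<Omega> \<times> \<Omega>)"
    by (intro closed_Times closed_space)
  show "finite ((\<lambda>z. prod_encode (code n (fst z), code n (snd z))) ` (\<Omega> \<times> \<Omega>))" for n
    by (rule finite_subset[of _ "prod_encode ` (code n ` \<Omega> \<times> code n ` \<Omega>)"]) (auto simp: finite_code)
  show "prod_encode (code m (fst x), code m (snd x)) = prod_encode (code m (fst y), code m (snd y))"
    if "m \<le> n" "x \<in> \<Omega> \<times> \<Omega>" "y \<in> \<Omega> \<times> \<Omega>"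
      "prod_encode (code n (fst x), code n (snd x)) = prod_encode (code n (fst y), code n (snd y))" for m n x y
    using that code_refine[OF that(1), of "fst x" "fst y"] code_refine[OF that(1), of "snd x" "snd y"]
    by (auto simp: prod_encode_eq)
  show "closed {z \<in> \<Omega> \<times> \<Omega>. prod_encode (code n (fst z), code n (snd z)) = c}" for n c
  proof -
    obtain u v where c: "c = prod_encode (u, v)"
      by (metis prod_decode_inverse surj_pair)
    have "{z \<in> \<Omega> \<times> \<Omega>. prod_encode (code n (fst z), code n (snd z)) = c} =
        {x \<in> \<Omega>. code n x = u} \<times> {x \<in> \<Omega>. code n x = v}"
      by (auto simp: c prod_encode_eq)
    then show ?thesis
      by (simp add: closed_Times closed_code)
  qed
  show "\<exists>n. \<forall>y\<in>\<Omega> \<times> \<Omega>. prod_encode (code n (fst y), code n (snd y)) =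
      prod_encode (code n (fst x), code n (snd x)) \<longrightarrow> y \<in> U"
    if U: "open U" "x \<in> \<Omega> \<times> \<Omega> \<inter> U" for U x
  proof -
    obtain A B where AB: "open A" "open B" "x \<in> A \<times> B" "A \<times> B \<subseteq> U"
      using open_prod_elim[OF U(1)] U(2) by blast
    obtain m where m: "\<forall>y\<in>\<Omega>. code m y = code m (fst x) \<longrightarrow> y \<in> A"
      using code_nhds[OF AB(1), of "fst x"] AB(3) U(2) by auto
    obtain k where k: "\<forall>y\<in>\<Omega>. code k y = code k (snd x) \<longrightarrow> y \<in> B"
      using code_nhds[OF AB(2), of "snd x"] AB(3) U(2) by auto
    have "y \<in> U" if y: "y \<in> \<Omega> \<times> \<Omega>" "code (max m k) (fst y) = code (max m k) (fst x)"
      "code (max m k) (snd y) = code (max m k) (snd x)" for y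
    proof -
      have "code m (fst y) = code m (fst x)" "code k (snd y) = code k (snd x)"
        using code_refine[of m "max m k" "fst y" "fst x"] code_refine[of k "max m k" "snd y" "snd x"] y U(2)
        by auto
      then have "fst y \<in> A" "snd y \<in> B" using m k y(1) by auto
      then show ?thesis using AB(4) by (cases y) auto
    qed
    then show ?thesis
      by (intro exI[of _ "max m k"]) (auto simp: prod_encode_eq)
  qed
qed

lemma (in coded_space) measurable_code:
  assumes "f \<in> space M \<rightarrow> \<Omega>" "\<And>n c. f -` cyl n c \<inter> space M \<in> sets M"
  shows "f \<in> measurable M bor"
proof (rule measurable_sigma_sets[OF sets_bor])
  show "f -` A \<inter> space M \<in> sets M" if A': "A \<in> cyls" for A
  proof -
    obtain n B where "A = {x \<in> \<Omega>. code n x \<in> B}"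
      using A' by (auto simp: cyls_def)
    then have A: "A = (\<Union>c\<in>B \<inter> code n ` \<Omega>. cyl n c)"
      by (simp add: cyls_decomp)
    have "f -` A \<inter> space M = (\<Union>c\<in>B \<inter> code n ` \<Omega>. f -` cyl n c \<inter> space M)"
      by (auto simp: A)
    moreover have "(\<Union>c\<in>B \<inter> code n ` \<Omega>. f -` cyl n c \<inter> space M) \<in> sets M"
      by (intro sets.finite_UN finite_Int disjI2 finite_code assms(2))
    ultimately show ?thesis
      by (simp only:)
  qed
  show "cyls \<subseteq> Pow \<Omega>"
    using cyls.sets_into_space by blast
qed (fact assms(1))


section \<open>Digit expansions and the odometer\<close>

lemma radix_pow: "k \<ge> 2 \<Longrightarrow> radix (10 ^ k) = k"
  unfolding radix_def by (auto simp: power_inject_exp)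

lemma radix_other: "\<not> (\<exists>k\<ge>2. i = 10 ^ k) \<Longrightarrow> radix i = 8"
  by (auto simp: radix_def)

lemma radix_ge2: "radix i \<ge> 2"
  using radix_pow radix_other by (cases "\<exists>k\<ge>2. i = 10 ^ k") auto

lemma radix_1: "radix (Suc 0) = 8"
proof (rule radix_other)
  show "\<not> (\<exists>k\<ge>2. Suc 0 = 10 ^ k)"
  proof
    assume "\<exists>k\<ge>2. Suc 0 = 10 ^ k"
    then obtain k where k: "k \<ge> 2" "Suc 0 = 10 ^ k" by blast
    then have "(10::nat) ^ k = 10 ^ 0" by simp
    then show False using k power_inject_exp[of "10::nat" k 0] by simp
  qed
qed

text \<open>\<open>hgt n\<close> is the number of words of length n, the height of the n-th tower of
  the odometer, and \<open>val n x\<close> is the level of x in that tower. The first digit is the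
  least significant one, since carries move to the right.\<close>

primrec hgt :: "nat \<Rightarrow> nat" where
  "hgt 0 = 1"
| "hgt (Suc n) = hgt n * radix (Suc n)"

primrec val :: "nat \<Rightarrow> (nat \<Rightarrow> nat) \<Rightarrow> nat" where
  "val 0 x = 0"
| "val (Suc n) x = val n x + x (Suc n) * hgt n"

lemma hgt_pos [simp]: "hgt n > 0"
  using radix_ge2 by (induction n) (auto intro: order.strict_trans2[of 0 2])

lemma hgt_dvd: "m \<le> n \<Longrightarrow> hgt m dvd hgt n"
  by (induction n rule: dec_induct) auto

lemma odo_digit_less: "x \<in> odo_space \<Longrightarrow> i \<ge> 1 \<Longrightarrow> x i < radix i"
  by (auto simp: odo_space_def PiE_iff)

lemma val_less: "x \<in> odo_space \<Longrightarrow> val n x < hgt n"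
proof (induction n)
  case (Suc n)
  have "val n x + x (Suc n) * hgt n < hgt n + x (Suc n) * hgt n"
    using Suc by simp
  also have "\<dots> = Suc (x (Suc n)) * hgt n" by simp
  also have "\<dots> \<le> radix (Suc n) * hgt n"
    using odo_digit_less[OF Suc.prems, of "Suc n"] by (intro mult_right_mono) auto
  finally show ?case by (simp add: mult.commute)
qed simp

lemma val_Suc_mod: "x \<in> odo_space \<Longrightarrow> val (Suc n) x mod hgt n = val n x"
  using val_less[of x n] by simp

lemma val_Suc_div: "x \<in> odo_space \<Longrightarrow> val (Suc n) x div hgt n = x (Suc n)"
  using val_less[of x n] by simp

lemma val_mod: "x \<in> odo_space \<Longrightarrow> m \<le> n \<Longrightarrow> val n x mod hgt m = val m x"
proof (induction n)
  case (Suc n)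
  show ?case
  proof (cases "m = Suc n")
    case False
    then have "m \<le> n" using Suc by simp
    have "val (Suc n) x mod hgt m = (val (Suc n) x mod hgt n) mod hgt m"
      by (rule mod_mod_cancel[OF hgt_dvd[OF \<open>m \<le> n\<close>], symmetric])
    then show ?thesis
      using Suc \<open>m \<le> n\<close> val_Suc_mod by metis
  next
    case True
    then show ?thesis
      using mod_less[OF val_less[OF Suc.prems(1), of "Suc n"]] by (simp only:)
  qed
qed simp

lemma val_eq_mono:
  "x \<in> odo_space \<Longrightarrow> y \<in> odo_space \<Longrightarrow> m \<le> n \<Longrightarrow> val n x = val n y \<Longrightarrow> val m x = val m y"
  using val_mod by metis

lemma val_eq_digits:
  "x \<in> odo_space \<Longrightarrow> y \<in> odo_space \<Longrightarrow> val n x = val n y \<Longrightarrow> 1 \<le> i \<Longrightarrow> i \<le> n \<Longrightarrow> x i = y i"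
  using val_eq_mono[of x y i n] val_Suc_div[of x "i - 1"] val_Suc_div[of y "i - 1"] by simp

text \<open>Turns the carry condition of \<open>odometer\<close> into arithmetic of levels, from
  which \<open>val_odometer\<close> obtains addition of 1 modulo \<open>hgt n\<close>.\<close>

lemma val_max_iff:
  assumes x: "x \<in> odo_space"
  shows "(\<forall>j\<in>{1..<Suc n}. x j = radix j - 1) \<longleftrightarrow> Suc (val n x) = hgt n"
proof (induction n)
  case (Suc n)
  let ?a = "radix (Suc n)" and ?d = "x (Suc n)"
  have d: "?d < ?a" using odo_digit_less[OF x] by simp
  have v: "val n x < hgt n" by (rule val_less[OF x])
  have a: "?a \<ge> 2" by (rule radix_ge2)
  have "{1..<Suc (Suc n)} = insert (Suc n) {1..<Suc n}" by auto
  then have "(\<forall>j\<in>{1..<Suc (Suc n)}. x j = radix j - 1) \<longleftrightarrow> ?d = ?a - 1 \<and> Suc (val n x) = hgt n"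
    using Suc by simp
  also have "\<dots> \<longleftrightarrow> Suc (val (Suc n) x) = hgt (Suc n)"
  proof
    assume *: "?d = ?a - 1 \<and> Suc (val n x) = hgt n"
    then have "Suc (val (Suc n) x) = hgt n + (?a - 1) * hgt n" by simp
    also have "\<dots> = Suc (?a - 1) * hgt n" by simp
    also have "Suc (?a - 1) = ?a" using a by simp
    finally show "Suc (val (Suc n) x) = hgt (Suc n)" by (simp add: mult.commute)
  next
    assume *: "Suc (val (Suc n) x) = hgt (Suc n)"
    have "?d = ?a - 1"
    proof (rule ccontr)
      assume "?d \<noteq> ?a - 1"
      then have "Suc ?d < ?a" using d by simp
      then have "Suc (Suc ?d) * hgt n \<le> ?a * hgt n" by (intro mult_right_mono) auto
      moreover have "Suc (val (Suc n) x) < Suc (Suc ?d) * hgt n"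
        using v by simp
      ultimately show False using * by (simp add: mult.commute)
    qed
    moreover from this have "?a * hgt n = hgt n + ?d * hgt n"
      using a by (metis One_nat_def Suc_pred add_gr_0 gr0I mult_Suc not_numeral_le_zero)
    ultimately show "?d = ?a - 1 \<and> Suc (val n x) = hgt n"
      using * by (simp add: mult.commute)
  qed
  finally show ?case .
qed simp

lemma odometer_in:
  assumes x: "x \<in> odo_space"
  shows "odometer x \<in> odo_space"
  unfolding odo_space_def
proof (rule PiE_I)
  fix i :: nat assume "i \<in> {1..}"
  then have "x i < radix i" "i \<ge> 1" using odo_digit_less[OF x, of i] by auto
  then show "odometer x i \<in> {..<radix i}"
    by (simp add: odometer_def)
qed (simp add: odometer_def)

lemma val_odometer:
  assumes x: "x \<in> odo_space"
  shows "val n (odometer x) = Suc (val n x) mod hgt n"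
proof (induction n)
  case (Suc n)
  let ?a = "radix (Suc n)" and ?d = "x (Suc n)"
  have d: "?d < ?a" using odo_digit_less[OF x] by simp
  have v: "val n x < hgt n" by (rule val_less[OF x])
  have dig: "odometer x (Suc n) = (if Suc (val n x) = hgt n then Suc ?d mod ?a else ?d)"
    using val_max_iff[OF x, of n] by (simp add: odometer_def)
  show ?case
  proof (cases "Suc (val n x) = hgt n")
    case True
    have "Suc (val (Suc n) x) = Suc ?d * hgt n" using True by simp
    then have "Suc (val (Suc n) x) mod hgt (Suc n) = (hgt n * Suc ?d) mod (hgt n * ?a)"
      by (simp only: mult.commute hgt.simps)
    also have "\<dots> = hgt n * (Suc ?d mod ?a)"
      by (rule mult_mod_right[symmetric])
    finally show ?thesis
      using Suc True dig by (simp add: mult.commute)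
  next
    case False
    then have lt: "Suc (val n x) < hgt n" using v by simp
    have "Suc (val (Suc n) x) < Suc ?d * hgt n" using lt by simp
    also have "\<dots> \<le> ?a * hgt n" using d by (intro mult_right_mono) auto
    finally have "Suc (val (Suc n) x) < hgt (Suc n)" by (simp add: mult.commute)
    then show ?thesis using Suc lt dig by simp
  qed
qed simp

lemma funpow_odometer_in: "x \<in> odo_space \<Longrightarrow> (odometer ^^ i) x \<in> odo_space"
  by (induction i) (auto simp: odometer_in)

lemma val_funpow:
  assumes "x \<in> odo_space"
  shows "val n ((odometer ^^ i) x) = (val n x + i) mod hgt n"
proof (induction i)
  case 0
  then show ?case using val_less[OF assms] by simp
next
  case (Suc i)
  then show ?case
    using val_odometer[OF funpow_odometer_in[OF assms]] by (simp add: mod_Suc_eq)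
qed

definition odo_zero :: "nat \<Rightarrow> nat" where
  "odo_zero = (\<lambda>i\<in>{1..}. 0)"

lemma odo_zero_in: "odo_zero \<in> odo_space"
  using radix_ge2 by (auto simp: odo_zero_def odo_space_def intro: order.strict_trans2[of 0 2])

lemma val_odo_zero: "val n odo_zero = 0"
  by (induction n) (auto simp: odo_zero_def)

lemma val_surj: "c < hgt n \<Longrightarrow> \<exists>x\<in>odo_space. val n x = c"
  using funpow_odometer_in[OF odo_zero_in, of c] val_funpow[OF odo_zero_in, of n c] val_odo_zero[of n]
  by (intro bexI[of _ "(odometer ^^ c) odo_zero"]) auto

lemma val_image: "val n ` odo_space = {..<hgt n}"
  using val_less val_surj by (auto simp: image_iff) metis

text \<open>The singleton factor at index 0 makes the space a product over all of
  \<open>nat\<close>, so that Tychonoff's theorem applies.\<close>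

lemma odo_space_eq: "odo_space = Pi\<^sub>E UNIV (\<lambda>i. if i \<ge> 1 then {..<radix i} else {undefined})"
  by (auto simp: odo_space_def PiE_iff extensional_def split: if_splits)

lemma closed_odo_space: "closed odo_space"
  unfolding odo_space_eq using closedin_product_topology[of "\<lambda>_::nat. euclidean :: nat topology" UNIV]
  by (auto simp: euclidean_product_topology finite_imp_closed)

lemma compact_odo_space: "compact odo_space"
proof -
  have "compactin (product_topology (\<lambda>_. euclidean) UNIV) (Pi\<^sub>E UNIV (\<lambda>i. if i \<ge> 1 then {..<radix i} else {undefined}))"
    by (auto simp: compactin_PiE finite_imp_compact)
  then show ?thesis
    unfolding odo_space_eq by (simp add: euclidean_product_topology)
qed

lemma continuous_val: "continuous_on UNIV (val n)"
  by (induction n) (auto intro!: continuous_intros continuous_on_product_coordinates)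

lemma closed_val: "closed {x \<in> odo_space. val n x = c}"
proof -
  have "closed {x. val n x = c}"
    by (rule closed_Collect_eq[OF continuous_val continuous_on_const])
  then have "closed (odo_space \<inter> {x. val n x = c})"
    using closed_odo_space by auto
  then show ?thesis by (simp add: Collect_conj_eq)
qed

lemma val_nhds:
  assumes "open U" "x \<in> odo_space \<inter> U"
  shows "\<exists>n. \<forall>y\<in>odo_space. val n y = val n x \<longrightarrow> y \<in> U"
proof -
  obtain B where B: "x \<in> Pi\<^sub>E UNIV B" "finite {i. B i \<noteq> UNIV}" "Pi\<^sub>E UNIV B \<subseteq> U"
    using product_topology_open_contains_basis[of "\<lambda>_. euclidean" UNIV U x] assms
    by (auto simp: open_fun_def)
  define n where "n = Max (insert 0 {i. B i \<noteq> UNIV})"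
  have n: "i \<le> n" if "B i \<noteq> UNIV" for i
    using that B(2) by (auto simp: n_def)
  have "y \<in> U" if y: "y \<in> odo_space" "val n y = val n x" for y
  proof -
    have "y i \<in> B i" for i
    proof (cases "B i = UNIV")
      case False
      have "y i = x i"
      proof (cases "i = 0")
        case True
        then show ?thesis using assms(2) y(1) by (auto simp: odo_space_def PiE_iff extensional_def)
      next
        case False
        then show ?thesis
          using val_eq_digits[OF y(1) _ y(2), of i] assms(2) n[OF \<open>B i \<noteq> UNIV\<close>] by auto
      qed
      then show ?thesis using B(1) by auto
    qed simp
    then show ?thesis using B(3) by auto
  qed
  then show ?thesis by blast
qed

interpretation X: coded_space odo_space val
proof
  show "finite (val n ` odo_space)" for n by (simp add: val_image)
qed (auto simp: compact_odo_space closed_odo_space closed_val intro!: val_nhds intro: val_eq_mono)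

lemma X_cyl_iff: "x \<in> X.cyl n c \<longleftrightarrow> x \<in> odo_space \<and> val n x = c"
  by (simp add: X.cyl_def)

lemma odometer_measurable: "odometer \<in> measurable X.bor X.bor"
proof (rule X.measurable_code)
  fix n c
  have "odometer -` X.cyl n c \<inter> space X.bor = {x \<in> odo_space. val n x \<in> {v. Suc v mod hgt n = c}}"
    by (auto simp: X.cyl_def odometer_in val_odometer)
  then show "odometer -` X.cyl n c \<inter> space X.bor \<in> sets X.bor"
    by (simp only: X.cyls_sets[OF X.cylsI])
qed (auto simp: odometer_in)

section \<open>Existence and uniqueness of the invariant measure of the odometer\<close>

lemma odometer_vimage_cyl:
  assumes "Suc c < hgt n"
  shows "odometer -` X.cyl n (Suc c) \<inter> odo_space = X.cyl n c"
proof -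
  have "Suc v mod hgt n = Suc c \<longleftrightarrow> v = c" if "v < hgt n" for v
    using assms that by (cases "Suc v = hgt n") auto
  then show ?thesis
    by (auto simp: X.cyl_def odometer_in val_odometer val_less)
qed

text \<open>The odometer permutes the cells of depth n cyclically, so an invariant measure gives
  them all the same mass. As the cells determine a measure, this is unique ergodicity.\<close>

lemma odometer_invariant_cyl:
  assumes M: "sets M = sets X.bor" "finite_measure M" and inv: "X.invariant odometer M" and c: "c < hgt n"
  shows "measure M (X.cyl n c) = measure M odo_space / real (hgt n)"
proof -
  have step: "measure M (X.cyl n (Suc c)) = measure M (X.cyl n c)" if "Suc c < hgt n" for c
    using inv[unfolded X.invariant_def, rule_format, OF X.cyls_sets[OF X.cyl_in_cyls[of n "Suc c"]]] that
    by (simp add: odometer_vimage_cyl)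
  have eq: "measure M (X.cyl n c) = measure M (X.cyl n 0)" if "c < hgt n" for c
    using that by (induction c) (auto simp: step)
  have "measure M odo_space = (\<Sum>c\<in>UNIV \<inter> val n ` odo_space. measure M (X.cyl n c))"
    using X.measure_cyls_decomp[OF M, of n UNIV] by simp
  also have "\<dots> = (\<Sum>c<hgt n. measure M (X.cyl n 0))"
    by (rule sum.cong) (auto simp: val_image intro: eq)
  finally have "measure M odo_space = real (hgt n) * measure M (X.cyl n 0)"
    by simp
  then show ?thesis using eq[OF c] by simp
qed

lemma card_mod_class:
  fixes h k :: nat
  assumes "h > 0"
  shows "card {c \<in> {..<k * h}. c mod h \<in> B} = k * card ({..<h} \<inter> B)"
proof -
  have "card {c \<in> {..<k * h}. c mod h \<in> B} = (\<Sum>c<k * h. of_bool (c mod h \<in> B))"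
    by (simp add: Int_def)
  also have "\<dots> = (\<Sum>m<k. \<Sum>c = m * h..<m * h + h. of_bool (c mod h \<in> B))"
    by (rule sum.nat_group[symmetric])
  also have "\<dots> = (\<Sum>m<k. \<Sum>c = 0..<h. of_bool (c \<in> B))"
  proof (rule sum.cong[OF refl])
    fix m
    have "(\<Sum>c = 0 + m * h..<h + m * h. of_bool (c mod h \<in> B)) = (\<Sum>c = 0..<h. of_bool ((c + m * h) mod h \<in> B))"
      by (rule sum.shift_bounds_nat_ivl)
    also have "\<dots> = (\<Sum>c = 0..<h. of_bool (c \<in> B))"
      by (rule sum.cong) auto
    finally show "(\<Sum>c = m * h..<m * h + h. of_bool (c mod h \<in> B)) = (\<Sum>c = 0..<h. of_bool (c \<in> B) :: nat)"
      by (simp only: add_0 add.commute[of h])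
  qed
  also have "\<dots> = k * card ({..<h} \<inter> B)"
    by (simp add: Int_def atLeast0LessThan)
  finally show ?thesis .
qed

text \<open>The premeasure of a clopen set is the proportion of words occurring in it. By
  \<open>card_mod_class\<close> all words have equally many extensions of a given length, so the
  proportion does not depend on the depth.\<close>

lemma exists_odo_measure:
  "\<exists>M. sets M = sets X.bor \<and> finite_measure M \<and> (\<forall>n c. c < hgt n \<longrightarrow> measure M (X.cyl n c) = 1 / real (hgt n))"
proof -
  define q where "q n A = real (card (val n ` A)) / real (hgt n)" for n A
  \<comment> \<open>A clopen set can be described at many depths; choosing one makes the proportion
    a function of the set alone.\<close>
  define depth where "depth A = (SOME m. \<exists>B. A = {x \<in> odo_space. val m x \<in> B})" for A
  have q_stable: "q n {x \<in> odo_space. val m x \<in> B} = q m {x \<in> odo_space. val m x \<in> B}" if mn: "m \<le> n" for n m B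
  proof -
    obtain k where k: "hgt n = k * hgt m"
      using hgt_dvd[OF mn] by (metis dvdE mult.commute)
    have im: "val n ` {x \<in> odo_space. val m x \<in> B} = {c \<in> {..<hgt n}. c mod hgt m \<in> B}" if "m \<le> n" for n
    proof (intro set_eqI iffI)
      fix c assume "c \<in> {c \<in> {..<hgt n}. c mod hgt m \<in> B}"
      then obtain x where "x \<in> odo_space" "val n x = c" "c mod hgt m \<in> B"
        using val_surj by auto
      then show "c \<in> val n ` {x \<in> odo_space. val m x \<in> B}"
        using val_mod[OF _ that] by (auto intro!: image_eqI[of _ _ x])
    qed (use val_less val_mod[OF _ that] in auto)
    have "card (val n ` {x \<in> odo_space. val m x \<in> B}) = k * card ({..<hgt m} \<inter> B)"
      unfolding im[OF mn] k by (rule card_mod_class) simp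
    moreover have "card (val m ` {x \<in> odo_space. val m x \<in> B}) = card ({..<hgt m} \<inter> B)"
      unfolding im[OF order_refl] by (rule arg_cong[of _ _ card]) auto
    moreover have "k > 0" using k by (metis gr0I hgt_pos mult_is_0 neq0_conv)
    ultimately show ?thesis by (simp add: q_def k)
  qed
  have depth: "\<exists>B. A = {x \<in> odo_space. val (depth A) x \<in> B}" if "A \<in> X.cyls" for A
  proof -
    have "\<exists>m. \<exists>B. A = {x \<in> odo_space. val m x \<in> B}"
      using that by (auto simp: X.cyls_def)
    then show ?thesis
      unfolding depth_def by (rule someI_ex)
  qed
  have dep: "q n A = q (depth A) A" if "A \<in> X.cyls" "depth A \<le> n" for n A
  proof -
    have "\<exists>B. A = {x \<in> odo_space. val (depth A) x \<in> B}"
      using depth that(1) by simp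
    then obtain B where B: "A = {x \<in> odo_space. val (depth A) x \<in> B}" ..
    show ?thesis using q_stable[OF that(2), of B] unfolding B[symmetric] .
  qed
  have det: "x \<in> A \<longleftrightarrow> y \<in> A" if "A \<in> X.cyls" "depth A \<le> n" "x \<in> odo_space" "y \<in> odo_space" "val n x = val n y" for A n x y
  proof -
    have "\<exists>B. A = {x \<in> odo_space. val (depth A) x \<in> B}"
      using depth that(1) by simp
    then obtain B where B: "A = {x \<in> odo_space. val (depth A) x \<in> B}" ..
    have "z \<in> A \<longleftrightarrow> val (depth A) z \<in> B" if "z \<in> odo_space" for z
      using B that by blast
    then show ?thesis using val_eq_mono[OF that(3,4,2,5)] that(3,4) by simp
  qed
  have "\<exists>M. sets M = sets X.bor \<and> finite_measure M \<and> (\<forall>A\<in>X.cyls. measure M A = q (depth A) A)"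
  proof (rule X.extend_cyls)
    show "0 \<le> q (depth A) A" for A by (simp add: q_def)
    fix A B assume AB: "A \<in> X.cyls" "B \<in> X.cyls" "A \<inter> B = {}"
    define n where "n = Max {depth A, depth B, depth (A \<union> B)}"
    have n: "depth A \<le> n" "depth B \<le> n" "depth (A \<union> B) \<le> n" by (auto simp: n_def)
    have sub: "A \<subseteq> odo_space" "B \<subseteq> odo_space" using AB X.cyls.sets_into_space by auto
    have "val n x \<noteq> val n y" if "x \<in> A" "y \<in> B" for x y
    proof
      assume "val n x = val n y"
      then have "y \<in> A"
        using det[OF AB(1) n(1), of x y] that subsetD[OF sub(1)] subsetD[OF sub(2)] by simp
      then show False using that(2) AB(3) by blast
    qed
    then have "val n ` A \<inter> val n ` B = {}"
      by blast
    moreover have "finite (val n ` A)" "finite (val n ` B)"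
      using sub X.finite_code by (meson finite_subset image_mono)+
    ultimately have "q n (A \<union> B) = q n A + q n B"
      by (simp add: q_def image_Un card_Un_disjoint add_divide_distrib)
    then show "q (depth (A \<union> B)) (A \<union> B) = q (depth A) A + q (depth B) B"
      by (simp only: dep[OF AB(1) n(1), symmetric] dep[OF AB(2) n(2), symmetric]
          dep[OF X.cyls.Un[OF AB(1,2)] n(3), symmetric])
  qed
  then obtain M where M: "sets M = sets X.bor" "finite_measure M" "\<And>A. A \<in> X.cyls \<Longrightarrow> measure M A = q (depth A) A"
    by blast
  have "measure M (X.cyl n c) = 1 / real (hgt n)" if "c < hgt n" for n c
  proof -
    let ?A = "X.cyl n c"
    define N where "N = max n (depth ?A)"
    have "q (depth ?A) ?A = q N ?A"
      using dep[OF X.cyl_in_cyls, of n c N] by (simp add: N_def)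
    also have "\<dots> = q n ?A"
      using q_stable[of n N "{c}"] by (simp add: X.cyl_def N_def)
    also have "val n ` ?A = {c}"
      using val_surj[OF that] by (auto simp: X.cyl_def)
    then have "q n ?A = 1 / real (hgt n)"
      by (simp add: q_def)
    finally show ?thesis using M(3) X.cyl_in_cyls by simp
  qed
  then show ?thesis using M by blast
qed

text \<open>Existence together with uniqueness gives the definite description in
  \<open>odo_measure\<close> its meaning.\<close>

lemma odo_measure_props:
  "sets odo_measure = sets X.bor \<and> prob_space odo_measure \<and> distr odo_measure odo_measure odometer = odo_measure"
proof -
  have hgt_real: "real (hgt n) \<noteq> 0" for n
    using hgt_pos[of n] by simp
  obtain M where M: "sets M = sets X.bor" "finite_measure M"
    and Mc: "\<And>n c. c < hgt n \<Longrightarrow> measure M (X.cyl n c) = 1 / real (hgt n)"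
    using exists_odo_measure by blast
  have "measure M odo_space = measure M (X.cyl 0 0)"
    by (rule arg_cong[of _ _ "measure M"]) (auto simp: X.cyl_def)
  then have M1: "measure M odo_space = 1" using Mc[of 0 0] by simp
  have MP: "M \<in> X.probs" using M M1 by (rule X.probsI)
  interpret finite_measure M by fact
  have oM: "odometer \<in> measurable M X.bor"
    using odometer_measurable M(1) measurable_cong_sets by blast
  have "distr M M odometer = M"
  proof (rule X.measure_eqI_cyl)
    show "sets (distr M M odometer) = sets X.bor" by (simp add: M(1))
    have "odometer \<in> measurable M M"
      using oM M(1) measurable_cong_sets by blast
    then show "finite_measure (distr M M odometer)" by (rule finite_measure_distr)
    fix n c assume c: "c \<in> val n ` odo_space"
    then have c': "c < hgt n" by (simp add: val_image)
    \<comment> \<open>The cyclic predecessor of c: level 0 is entered from the top level.\<close>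
    define d where "d = (if c = 0 then hgt n - 1 else c - 1)"
    have d: "d < hgt n" using c' by (auto simp: d_def)
    have "Suc v mod hgt n = c \<longleftrightarrow> v = d" if "v < hgt n" for v
      using c' that by (cases "Suc v = hgt n") (auto simp: d_def)
    then have step: "Suc (val n x) mod hgt n = c \<longleftrightarrow> val n x = d" if "x \<in> odo_space" for x
      using val_less[OF that] by simp
    have "x \<in> odometer -` X.cyl n c \<inter> odo_space \<longleftrightarrow> x \<in> X.cyl n d" for x
      by (cases "x \<in> odo_space") (simp_all add: X_cyl_iff odometer_in val_odometer step)
    then have "odometer -` X.cyl n c \<inter> odo_space = X.cyl n d"
      by blast
    moreover have "measure (distr M M odometer) (X.cyl n c) = measure M (odometer -` X.cyl n c \<inter> odo_space)"
      using \<open>odometer \<in> measurable M M\<close> X.cyls_sets[OF X.cyl_in_cyls] M(1)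
      by (simp add: measure_distr X.space_eq[OF M(1)])
    ultimately show "measure (distr M M odometer) (X.cyl n c) = measure M (X.cyl n c)"
      using Mc c' d by simp
  qed (use M in auto)
  then have ex: "sets M = sets X.bor \<and> prob_space M \<and> distr M M odometer = M"
    using MP by (simp add: X.probs_def)
  have un: "N = M" if N: "sets N = sets X.bor \<and> prob_space N \<and> distr N N odometer = N" for N
  proof -
    have NP: "N \<in> X.probs" using N by (simp add: X.probs_def)
    have "X.invariant odometer N"
      using X.distr_eq_iff_invariant[OF X.probsD(1,2)[OF NP] odometer_measurable] N by simp
    then have Nc: "measure N (X.cyl n c) = 1 / real (hgt n)" if "c < hgt n" for n c
      using odometer_invariant_cyl[OF X.probsD(1,2)[OF NP] _ that] X.probsD(3)[OF NP] by simp
    show ?thesis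
      by (rule X.measure_eqI_cyl) (use X.probsD[OF NP] M Mc Nc in \<open>auto simp: val_image\<close>)
  qed
  have "odo_measure = M"
    unfolding odo_measure_def by (rule the_equality) (fact ex, fact un)
  then show ?thesis using ex by (simp only:)
qed

lemma sets_odo_measure [simp]: "sets odo_measure = sets X.bor"
  using odo_measure_props by simp

lemma space_odo_measure [simp]: "space odo_measure = odo_space"
  by (rule X.space_eq) simp

interpretation odo: prob_space odo_measure
  using odo_measure_props by simp

lemma odo_invariant: "X.invariant odometer odo_measure"
  using X.distr_eq_iff_invariant[OF sets_odo_measure odo.finite_measure_axioms odometer_measurable] odo_measure_props
  by simp

lemma odo_invariantD: "A \<in> sets X.bor \<Longrightarrow> measure odo_measure (odometer -` A \<inter> odo_space) = measure odo_measure A"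
  using odo_invariant by (simp add: X.invariant_def)

lemma odo_measure_cyl: "c < hgt n \<Longrightarrow> measure odo_measure (X.cyl n c) = 1 / real (hgt n)"
  using odometer_invariant_cyl[OF sets_odo_measure odo.finite_measure_axioms odo_invariant, of c n] odo.prob_space
  by simp

text \<open>Arbitrary total mass is allowed because \<open>nu_unique\<close> applies this to a
  measure lifted from Y to X, whose mass is not known beforehand.\<close>

lemma odometer_unique:
  assumes M: "sets M = sets X.bor" "finite_measure M" and inv: "X.invariant odometer M" and A: "A \<in> sets X.bor"
  shows "measure M A = measure M odo_space * measure odo_measure A"
proof -
  obtain N where N: "sets N = sets X.bor" "finite_measure N"
    "\<And>A. A \<in> sets X.bor \<Longrightarrow> measure N A = measure M odo_space * measure odo_measure A + 0 * measure odo_measure A"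
    using finite_measure_lincomb[OF odo.finite_measure_axioms odo.finite_measure_axioms, of "measure M odo_space" 0] by auto
  have "M = N"
  proof (rule X.measure_eqI_cyl[OF M N(1,2)])
    fix n c assume "c \<in> val n ` odo_space"
    then have "c < hgt n" by (simp add: val_image)
    then show "measure M (X.cyl n c) = measure N (X.cyl n c)"
      using odometer_invariant_cyl[OF M inv] N(3)[OF X.cyls_sets[OF X.cyl_in_cyls]] odo_measure_cyl by simp
  qed
  then show ?thesis using N(3)[OF A] by simp
qed

section \<open>First return maps\<close>

text \<open>Time 0 is counted and time i is not: for x and \<open>(f ^^ i) x\<close> in A the value
  is the number of steps that the first return map takes from x to
  \<open>(f ^^ i) x\<close>.\<close>

definition visits :: "('a \<Rightarrow> 'a) \<Rightarrow> 'a set \<Rightarrow> 'a \<Rightarrow> nat \<Rightarrow> nat" where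
  "visits f A x i = (\<Sum>j<i. of_bool ((f ^^ j) x \<in> A))"

lemma visits_0 [simp]: "visits f A x 0 = 0"
  by (simp add: visits_def)

lemma visits_Suc: "visits f A x (Suc i) = visits f A x i + of_bool ((f ^^ i) x \<in> A)"
  by (simp only: visits_def sum.lessThan_Suc)

lemma visits_add: "visits f A x (i + j) = visits f A x i + visits f A ((f ^^ i) x) j"
proof (induction j)
  case (Suc j)
  have "(f ^^ (i + j)) x = (f ^^ j) ((f ^^ i) x)"
    by (metis add.commute comp_apply funpow_add)
  then show ?case
    using Suc by (simp add: visits_Suc del: funpow.simps)
qed simp

lemma visits_mono: "i \<le> j \<Longrightarrow> visits f A x i \<le> visits f A x j"
  using visits_add[of f A x i "j - i"] by simp

text \<open>The counter grows by at most one per step, and only at visits, so no value is skipped.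
  This converts a number of T-steps into odometer time.\<close>

lemma visits_attained:
  "t < visits f A x i \<Longrightarrow> \<exists>j<i. (f ^^ j) x \<in> A \<and> visits f A x j = t"
proof (induction i)
  case (Suc i)
  show ?case
  proof (cases "t < visits f A x i")
    case True
    then show ?thesis using Suc.IH less_Suc_eq by blast
  next
    case False
    then have "(f ^^ i) x \<in> A \<and> visits f A x i = t"
      using Suc.prems by (cases "(f ^^ i) x \<in> A") (simp_all add: visits_Suc)
    then show ?thesis by blast
  qed
qed simp

lemma first_return_exists:
  assumes "1 \<le> i" "(f ^^ i) x \<in> A"
  obtains r where "1 \<le> r" "r \<le> i" "(f ^^ r) x \<in> A" "\<And>j. 1 \<le> j \<Longrightarrow> j < r \<Longrightarrow> (f ^^ j) x \<notin> A"
    "first_return f A x = (f ^^ r) x"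
proof -
  define r where "r = (LEAST n. n \<ge> 1 \<and> (f ^^ n) x \<in> A)"
  have r: "r \<ge> 1 \<and> (f ^^ r) x \<in> A"
    unfolding r_def by (rule LeastI[of _ i]) (use assms in simp)
  have "r \<le> i"
    unfolding r_def by (rule Least_le) (use assms in simp)
  moreover have "(f ^^ j) x \<notin> A" if "1 \<le> j" "j < r" for j
    using not_less_Least[of j "\<lambda>n. n \<ge> 1 \<and> (f ^^ n) x \<in> A"] that unfolding r_def by blast
  moreover have "first_return f A x = (f ^^ r) x"
    unfolding first_return_def r_def using assms by auto
  ultimately show ?thesis using that r by blast
qed

text \<open>Induction on time, cutting off the first return \<open>r\<close>: before time r the only
  visit is the one at time 0, and it accounts for one step of the return map.\<close>

lemma funpow_first_return:
  "x \<in> A \<Longrightarrow> (f ^^ i) x \<in> A \<Longrightarrow> (first_return f A ^^ visits f A x i) x = (f ^^ i) x"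
proof (induction i arbitrary: x rule: less_induct)
  case (less i)
  show ?case
  proof (cases "i = 0")
    case False
    then have "1 \<le> i" by simp
    then obtain r where r: "1 \<le> r" "r \<le> i" "(f ^^ r) x \<in> A" "\<And>j. 1 \<le> j \<Longrightarrow> j < r \<Longrightarrow> (f ^^ j) x \<notin> A"
      "first_return f A x = (f ^^ r) x"
      using first_return_exists[OF _ less.prems(2)] by metis
    have v1: "visits f A x j = 1" if "1 \<le> j" "j \<le> r" for j
      using that
    proof (induction j rule: dec_induct)
      case base
      then show ?case using less.prems(1) by (simp add: visits_def)
    next
      case (step j)
      then show ?case using r(4)[of j] by (simp add: visits_Suc)
    qed
    have eq: "(f ^^ (i - r)) ((f ^^ r) x) = (f ^^ i) x"
      using r(2) by (metis comp_apply funpow_add le_add_diff_inverse2)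
    have "visits f A x i = Suc (visits f A ((f ^^ r) x) (i - r))"
      using visits_add[of f A x r "i - r"] v1[OF r(1) order_refl] r(2) by simp
    moreover have "(first_return f A ^^ visits f A ((f ^^ r) x) (i - r)) ((f ^^ r) x) = (f ^^ i) x"
      unfolding eq[symmetric]
      by (rule less.IH) (use r False eq less.prems in auto)
    ultimately show ?thesis
      by (simp add: funpow_swap1 r(5))
  qed simp
qed

section \<open>The induced system\<close>

text \<open>The digits at position q that expel a point with critical prefix from Y: 7 for
  \<open>Zset\<close>, and for \<open>Wset\<close> the lower half of the 2k digits at position
  10^(2k). At 10^k with k odd and at least 3 no digit is removed.\<close>

definition removed :: "nat \<Rightarrow> nat set" where
  "removed q = {d. (q \<notin> {10 ^ k | k. k \<ge> 2} \<and> d = 7) \<or> (\<exists>k\<ge>2. q = 10 ^ (2 * k) \<and> d < k)}"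

text \<open>The value of the word \<open>a\<^sub>1 - 2, \<dots>, a\<^sub>n - 2\<close>. Among the points with the same first
  \<open>n\<close> digits, only those with this word can be partly in \<open>Y\<close> and partly outside.\<close>

primrec crit :: "nat \<Rightarrow> nat" where
  "crit 0 = 0"
| "crit (Suc n) = crit n + (radix (Suc n) - 2) * hgt n"

lemma crit_less: "crit n < hgt n"
proof (induction n)
  case (Suc n)
  define s where "s = radix (Suc n) - 2"
  have s: "radix (Suc n) = s + 2" using radix_ge2[of "Suc n"] by (simp add: s_def)
  have "crit (Suc n) = crit n + s * hgt n" by (simp add: s)
  also have "\<dots> < hgt n + s * hgt n" using Suc by simp
  also have "\<dots> \<le> hgt (Suc n)" by (simp add: s algebra_simps)
  finally show ?case .
qed simp

lemma val_crit_Suc: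
  assumes x: "x \<in> odo_space"
  shows "val (Suc n) x = crit (Suc n) \<longleftrightarrow> val n x = crit n \<and> x (Suc n) = radix (Suc n) - 2"
proof
  assume eq: "val (Suc n) x = crit (Suc n)"
  have c: "crit (Suc n) mod hgt n = crit n" "crit (Suc n) div hgt n = radix (Suc n) - 2"
    using crit_less[of n] by simp_all
  have "val (Suc n) x mod hgt n = val n x" "val (Suc n) x div hgt n = x (Suc n)"
    by (rule val_Suc_mod[OF x], rule val_Suc_div[OF x])
  then show "val n x = crit n \<and> x (Suc n) = radix (Suc n) - 2"
    unfolding eq c by simp
qed simp

lemma val_crit_iff:
  assumes x: "x \<in> odo_space"
  shows "val n x = crit n \<longleftrightarrow> (\<forall>i\<in>{1..<Suc n}. x i = radix i - 2)"
proof (induction n)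
  case (Suc n)
  have "{1..<Suc (Suc n)} = insert (Suc n) {1..<Suc n}" by auto
  then show ?case
    unfolding val_crit_Suc[OF x] Suc by auto
qed simp

lemma val_crit_mono: "x \<in> odo_space \<Longrightarrow> m \<le> n \<Longrightarrow> val n x = crit n \<Longrightarrow> val m x = crit m"
  by (simp add: val_crit_iff)

lemma Yset_iff:
  "x \<in> Yset \<longleftrightarrow> x \<in> odo_space \<and> (\<forall>n. val n x = crit n \<longrightarrow> x (Suc n) \<notin> removed (Suc n))"
proof (cases "x \<in> odo_space")
  case x: True
  have Z: "x \<in> Zset (Suc n) \<longleftrightarrow> x (Suc n) = 7 \<and> val n x = crit n" for n
    by (simp add: Zset_def x val_crit_iff[OF x])
  have W: "x \<in> Wset k \<longleftrightarrow> val (10 ^ (2 * k) - 1) x = crit (10 ^ (2 * k) - 1) \<and> x (10 ^ (2 * k)) < k"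
    if k: "k \<ge> 2" for k
  proof -
    have "Suc (10 ^ (2 * k) - 1) = (10::nat) ^ (2 * k)" by simp
    moreover have "radix (10 ^ (2 * k)) = 2 * k"
      using k by (intro radix_pow) simp
    moreover have "real (x (10 ^ (2 * k))) < real (2 * k) / 2 \<longleftrightarrow> x (10 ^ (2 * k)) < k"
      by simp
    ultimately show ?thesis
      by (simp only: Wset_def x val_crit_iff[OF x] mem_Collect_eq simp_thms)
  qed
  have "(\<exists>l\<in>{1..} - {10 ^ k | k. k \<ge> 2}. x \<in> Zset l) \<longleftrightarrow>
      (\<exists>n. val n x = crit n \<and> Suc n \<notin> {10 ^ k | k. k \<ge> 2} \<and> x (Suc n) = 7)"
  proof
    assume "\<exists>l\<in>{1..} - {10 ^ k | k. k \<ge> 2}. x \<in> Zset l"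
    then obtain l where l: "l \<ge> 1" "l \<notin> {10 ^ k | k. k \<ge> 2}" "x \<in> Zset l" by auto
    then obtain n where "l = Suc n" by (cases l) auto
    then show "\<exists>n. val n x = crit n \<and> Suc n \<notin> {10 ^ k | k. k \<ge> 2} \<and> x (Suc n) = 7"
      using l(2,3) Z by blast
  next
    assume "\<exists>n. val n x = crit n \<and> Suc n \<notin> {10 ^ k | k. k \<ge> 2} \<and> x (Suc n) = 7"
    then obtain n where "val n x = crit n" "Suc n \<notin> {10 ^ k | k. k \<ge> 2}" "x (Suc n) = 7" by blast
    then show "\<exists>l\<in>{1..} - {10 ^ k | k. k \<ge> 2}. x \<in> Zset l"
      using Z by (intro bexI[of _ "Suc n"]) auto
  qed
  moreover have "(\<exists>k\<in>{2..}. x \<in> Wset k) \<longleftrightarrow>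
      (\<exists>n. val n x = crit n \<and> (\<exists>k\<ge>2. Suc n = 10 ^ (2 * k) \<and> x (Suc n) < k))"
  proof
    assume "\<exists>k\<in>{2..}. x \<in> Wset k"
    then obtain k where "k \<ge> 2" "x \<in> Wset k" by auto
    then show "\<exists>n. val n x = crit n \<and> (\<exists>k\<ge>2. Suc n = 10 ^ (2 * k) \<and> x (Suc n) < k)"
      using W by (intro exI[of _ "10 ^ (2 * k) - 1"]) auto
  next
    assume "\<exists>n. val n x = crit n \<and> (\<exists>k\<ge>2. Suc n = 10 ^ (2 * k) \<and> x (Suc n) < k)"
    then obtain n k where nk: "val n x = crit n" "k \<ge> 2" "Suc n = 10 ^ (2 * k)" "x (Suc n) < k" by blast
    then have "n = 10 ^ (2 * k) - 1" by (metis diff_Suc_1)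
    then show "\<exists>k\<in>{2..}. x \<in> Wset k"
      using W[OF nk(2)] nk by (intro bexI[of _ k]) auto
  qed
  ultimately show ?thesis
    unfolding Yset_def removed_def by (simp add: x) blast
qed (simp add: Yset_def)

lemma Yset_in_odo: "x \<in> Yset \<Longrightarrow> x \<in> odo_space"
  by (simp add: Yset_iff)

text \<open>The critical word is never expelled itself. Hence a point with a critical prefix has
  passed all the tests that lie inside this prefix.\<close>

lemma crit_digit_kept: "radix q - 2 \<notin> removed q"
proof
  assume "radix q - 2 \<in> removed q"
  then have "(q \<notin> {10 ^ k | k. k \<ge> 2} \<and> radix q - 2 = 7) \<or> (\<exists>k\<ge>2. q = 10 ^ (2 * k) \<and> radix q - 2 < k)"
    by (simp only: removed_def mem_Collect_eq)
  then show False
  proof (elim disjE exE conjE)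
    assume q: "q \<notin> {10 ^ k | k. k \<ge> 2}" "radix q - 2 = 7"
    then have "radix q = 8" by (intro radix_other) blast
    then show False using q by simp
  next
    fix k :: nat assume k: "2 \<le> k" "q = 10 ^ (2 * k)" "radix q - 2 < k"
    then have "radix q = 2 * k" using radix_pow[of "2 * k"] by simp
    then show False using k by simp
  qed
qed

text \<open>Membership in Y is tested after each critical prefix. Tests at depths below n read only
  common digits, the test at depth n reads digit n + 1, and none follows once that digit leaves the
  critical word.\<close>

lemma Yset_cong:
  assumes x: "x \<in> odo_space" and y: "y \<in> odo_space" and eq: "val n x = val n y"
    and dig: "val n x = crit n \<Longrightarrow> x (Suc n) \<in> removed (Suc n) \<longleftrightarrow> y (Suc n) \<in> removed (Suc n)"
      "val n x = crit n \<Longrightarrow> x (Suc n) \<noteq> radix (Suc n) - 2 \<and> y (Suc n) \<noteq> radix (Suc n) - 2"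
  shows "x \<in> Yset \<longleftrightarrow> y \<in> Yset"
proof -
  have imp: "y \<in> Yset" if x: "x \<in> odo_space" and y: "y \<in> odo_space" and eq: "val n x = val n y"
    and dig: "val n x = crit n \<Longrightarrow> x (Suc n) \<in> removed (Suc n) \<longleftrightarrow> y (Suc n) \<in> removed (Suc n)"
      "val n x = crit n \<Longrightarrow> x (Suc n) \<noteq> radix (Suc n) - 2 \<and> y (Suc n) \<noteq> radix (Suc n) - 2"
    and xY: "x \<in> Yset" for x y
  proof -
    have "y (Suc m) \<notin> removed (Suc m)" if m: "val m y = crit m" for m
    proof (cases "m < n")
      case True
      have "val m x = crit m" using val_eq_mono[OF x y _ eq, of m] m True by simp
      then have "x (Suc m) \<notin> removed (Suc m)" using xY by (simp add: Yset_iff)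
      moreover have "x (Suc m) = y (Suc m)"
        using val_eq_digits[OF x y eq, of "Suc m"] True by simp
      ultimately show ?thesis by simp
    next
      case False
      then have crit: "val n y = crit n" using val_crit_mono[OF y _ m, of n] by simp
      then have xc: "val n x = crit n" using eq by simp
      show ?thesis
      proof (cases "m = n")
        case True
        then show ?thesis using xY xc dig(1) by (simp add: Yset_iff)
      next
        case False
        then have "val (Suc n) y = crit (Suc n)"
          using val_crit_mono[OF y _ m, of "Suc n"] \<open>\<not> m < n\<close> by simp
        then have "y (Suc n) = radix (Suc n) - 2"
          using val_crit_Suc[OF y, of n] by simp
        then show ?thesis using dig(2) xc by simp
      qed
    qed
    then show ?thesis using y by (simp add: Yset_iff)
  qed
  show ?thesis
    using imp[OF x y eq] imp[OF y x eq[symmetric]] dig eq by auto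
qed

lemma Yset_noncrit:
  "x \<in> odo_space \<Longrightarrow> y \<in> odo_space \<Longrightarrow> val n x = val n y \<Longrightarrow> val n x \<noteq> crit n \<Longrightarrow> x \<in> Yset \<longleftrightarrow> y \<in> Yset"
  using Yset_cong[of x y n] by blast

lemma removed_1: "removed (Suc 0) = {7}"
proof -
  have ne: "Suc 0 \<noteq> 10 ^ k" if "k \<ge> 2" for k
    using that by (cases k) auto
  then have "Suc 0 \<notin> {10 ^ k | k. k \<ge> 2}"
    by blast
  moreover have "\<not> (\<exists>k\<ge>2. Suc 0 = 10 ^ (2 * k) \<and> d < k)" for d
  proof
    assume "\<exists>k\<ge>2. Suc 0 = 10 ^ (2 * k) \<and> d < k"
    then obtain k where "k \<ge> 2" "Suc 0 = 10 ^ (2 * k)" by blast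
    then show False using ne[of "2 * k"] by simp
  qed
  ultimately show ?thesis
    by (simp only: removed_def simp_thms singleton_conv)
qed

text \<open>The critical word starts with 6, so only the test on the first digit itself applies, and
  it expels 7.\<close>

lemma Yset_first_digit:
  assumes x: "x \<in> odo_space" and "val 1 x = 0"
  shows "x \<in> Yset"
proof -
  have c: "crit (Suc 0) = 6" by (simp add: radix_1)
  have "x (Suc n) \<notin> removed (Suc n)" if n: "val n x = crit n" for n
  proof (cases n)
    case 0
    then show ?thesis using assms(2) by (simp add: removed_1)
  next
    case (Suc m)
    then have "val (Suc 0) x = crit (Suc 0)" using val_crit_mono[OF x _ n, of "Suc 0"] by simp
    then show ?thesis using assms(2) c by simp
  qed
  then show ?thesis using x by (simp add: Yset_iff)
qed

lemma Yset_return: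
  assumes x: "x \<in> odo_space"
  obtains i where "1 \<le> i" "i \<le> 8" "(odometer ^^ i) x \<in> Yset"
proof -
  have h: "hgt 1 = 8" by (simp add: radix_1)
  have v: "val 1 x < 8" using val_less[OF x, of 1] h by simp
  have "val 1 ((odometer ^^ (8 - val 1 x)) x) = 0"
    using val_funpow[OF x, of 1 "8 - val 1 x"] v h by simp
  then have "(odometer ^^ (8 - val 1 x)) x \<in> Yset"
    by (intro Yset_first_digit funpow_odometer_in x)
  then show ?thesis using that[of "8 - val 1 x"] v by simp
qed

lemma digit_cyls: "{x \<in> odo_space. x (Suc n) \<in> D} \<in> X.cyls"
proof -
  have "{x \<in> odo_space. x (Suc n) \<in> D} = {x \<in> odo_space. val (Suc n) x \<in> {v. v div hgt n \<in> D}}"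
    by (intro Collect_cong conj_cong refl) (simp add: val_Suc_div del: val.simps)
  then show ?thesis by (simp only: X.cylsI)
qed

lemma digit_sets: "{x \<in> odo_space. x (Suc n) \<in> D} \<in> sets X.bor"
  by (rule X.cyls_sets[OF digit_cyls])

lemma closed_Yset: "closed Yset"
proof -
  have "Yset = (\<Inter>n. odo_space - (X.cyl n (crit n) \<inter> {x \<in> odo_space. x (Suc n) \<in> removed (Suc n)}))"
    by (auto simp: Yset_iff X.cyl_def)
  moreover have "closed (\<Inter>n. odo_space - (X.cyl n (crit n) \<inter> {x \<in> odo_space. x (Suc n) \<in> removed (Suc n)}))"
    by (intro closed_INT ballI X.closed_cyls X.cyls.compl_sets X.cyls.Int X.cyl_in_cyls digit_cyls)
  ultimately show ?thesis by (simp only:)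
qed

lemma Yset_subset: "Yset \<subseteq> odo_space"
  using Yset_in_odo by blast

interpretation Y: coded_space Yset val
  by (rule X.coded_subspace[OF closed_Yset Yset_subset])

lemma Yset_sets: "Yset \<in> sets X.bor"
  using closed_Yset closed_odo_space Yset_subset by (simp add: sets_restrict_space_iff)

lemma sets_Y_iff: "A \<in> sets Y.bor \<longleftrightarrow> A \<in> sets X.bor \<and> A \<subseteq> Yset"
  using closed_Yset closed_odo_space Yset_subset by (auto simp: sets_restrict_space_iff)

section \<open>Invariance and unique ergodicity of the induced map\<close>

lemma funpow_odometer_measurable: "(odometer ^^ j) \<in> measurable X.bor X.bor"
proof (induction j)
  case (Suc j)
  then show ?case
    using measurable_comp[OF Suc odometer_measurable] by (simp only: funpow.simps(2))
qed (simp add: id_def)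

lemma funpow_vimage_sets: "A \<in> sets X.bor \<Longrightarrow> {x \<in> odo_space. (odometer ^^ j) x \<in> A} \<in> sets X.bor"
  using measurable_sets[OF funpow_odometer_measurable, of A j] by (simp add: vimage_def Int_def conj_commute)

definition hits :: "nat \<Rightarrow> (nat \<Rightarrow> nat) set \<Rightarrow> (nat \<Rightarrow> nat) set" where
  "hits j A = {x \<in> odo_space. (\<forall>i\<in>{1..<j}. (odometer ^^ i) x \<notin> Yset) \<and> (odometer ^^ j) x \<in> A}"

lemma hits_sets: "A \<in> sets X.bor \<Longrightarrow> hits j A \<in> sets X.bor"
proof -
  assume A: "A \<in> sets X.bor"
  have "hits j A = {x \<in> odo_space. (odometer ^^ j) x \<in> A} - (\<Union>i\<in>{1..<j}. {x \<in> odo_space. (odometer ^^ i) x \<in> Yset})"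
    by (auto simp: hits_def)
  then show ?thesis
    using funpow_vimage_sets[OF A] funpow_vimage_sets[OF Yset_sets] by simp
qed

lemma hits_empty:
  assumes "j > 8" shows "hits j A = {}"
proof -
  have False if "x \<in> hits j A" for x
  proof -
    have "x \<in> odo_space" using that by (simp add: hits_def)
    then obtain i where "1 \<le> i" "i \<le> 8" "(odometer ^^ i) x \<in> Yset" by (rule Yset_return)
    then show False using that assms by (auto simp: hits_def)
  qed
  then show ?thesis by blast
qed

lemma Tmap_vimage:
  assumes A: "A \<subseteq> Yset"
  shows "Tmap -` A \<inter> Yset = (\<Union>j\<in>{1..8}. hits j A \<inter> Yset)"
proof (intro set_eqI iffI)
  fix x assume x: "x \<in> Tmap -` A \<inter> Yset"
  then have xX: "x \<in> odo_space" by (simp add: Yset_in_odo)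
  obtain i where i: "1 \<le> i" "i \<le> 8" "(odometer ^^ i) x \<in> Yset" using Yset_return[OF xX] .
  obtain r where r: "1 \<le> r" "r \<le> i" "\<And>j. 1 \<le> j \<Longrightarrow> j < r \<Longrightarrow> (odometer ^^ j) x \<notin> Yset"
    "Tmap x = (odometer ^^ r) x"
    using first_return_exists[OF i(1,3)] unfolding Tmap_def by metis
  have "x \<in> hits r A" using r x xX by (auto simp: hits_def)
  then show "x \<in> (\<Union>j\<in>{1..8}. hits j A \<inter> Yset)" using r i x by auto
next
  fix x assume "x \<in> (\<Union>j\<in>{1..8}. hits j A \<inter> Yset)"
  then obtain j where j: "1 \<le> j" "j \<le> 8" "x \<in> hits j A" "x \<in> Yset" by auto
  then have jA: "(odometer ^^ j) x \<in> A" "\<forall>i\<in>{1..<j}. (odometer ^^ i) x \<notin> Yset" by (simp_all add: hits_def)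
  have "(odometer ^^ j) x \<in> Yset" using jA A by blast
  from first_return_exists[OF j(1) this] obtain r where r: "1 \<le> r" "r \<le> j" "(odometer ^^ r) x \<in> Yset"
    "Tmap x = (odometer ^^ r) x"
    unfolding Tmap_def by metis
  have "r = j" using jA(2) r by (metis atLeastLessThan_iff le_neq_implies_less)
  then show "x \<in> Tmap -` A \<inter> Yset" using r j jA by simp
qed

lemma hits_disjoint:
  assumes "A \<subseteq> Yset" "i \<noteq> j" "1 \<le> i" "1 \<le> j"
  shows "hits i A \<inter> hits j A = {}"
proof -
  have False if "x \<in> hits i A" "x \<in> hits j A" "1 \<le> i" "i < j" for x i j
    using that assms(1) by (auto simp: hits_def)
  then show ?thesis using assms(2-4) by (metis disjoint_iff linorder_neqE_nat)
qed

lemma Tmap_in: "x \<in> Yset \<Longrightarrow> Tmap x \<in> Yset"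
  using first_return_exists Yset_return[OF Yset_in_odo] unfolding Tmap_def by metis

lemma funpow_Tmap_in: "x \<in> Yset \<Longrightarrow> (Tmap ^^ n) x \<in> Yset"
  by (induction n) (auto simp: Tmap_in)

lemma Tmap_measurable: "Tmap \<in> measurable Y.bor Y.bor"
proof (rule measurableI)
  fix A assume A: "A \<in> sets Y.bor"
  then have A': "A \<subseteq> Yset" "A \<in> sets X.bor" by (simp_all add: sets_Y_iff)
  have "(\<Union>j\<in>{1..8}. hits j A \<inter> Yset) \<in> sets X.bor"
    by (intro sets.finite_UN sets.Int hits_sets A' Yset_sets) simp
  then show "Tmap -` A \<inter> space Y.bor \<in> sets Y.bor"
    using Tmap_vimage[OF A'(1)] by (simp add: sets_Y_iff)
qed (simp add: Tmap_in)

text \<open>Split \<open>hits j A\<close> along Y: by invariance of the odometer the part outside Y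
  has the mass of \<open>hits (Suc j) A\<close>. Starting from the mass of A, the parts inside Y add
  up to the preimage of A under T.\<close>

lemma measure_Tmap_vimage:
  assumes A: "A \<in> sets Y.bor"
  shows "measure odo_measure (Tmap -` A \<inter> Yset) = measure odo_measure A"
proof -
  have A': "A \<subseteq> Yset" "A \<in> sets X.bor" using A by (simp_all add: sets_Y_iff)
  note hs = hits_sets[OF A'(2)]
  have step: "measure odo_measure (hits j A) = measure odo_measure (hits j A \<inter> Yset) + measure odo_measure (hits (Suc j) A)"
    if "1 \<le> j" for j
  proof -
    have "hits (Suc j) A = odometer -` (hits j A - Yset) \<inter> odo_space"
    proof (intro set_eqI)
      fix x
      have fs: "(odometer ^^ Suc i) x = (odometer ^^ i) (odometer x)" for i
        by (metis funpow_swap1 funpow.simps(2) comp_apply)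
      have all: "(\<forall>i\<in>{1..<Suc j}. (odometer ^^ i) x \<notin> Yset) \<longleftrightarrow>
        odometer x \<notin> Yset \<and> (\<forall>i\<in>{1..<j}. (odometer ^^ i) (odometer x) \<notin> Yset)"
      proof -
        have eq: "{1..<Suc j} = insert 1 (Suc ` {1..<j})"
          using that by (auto simp: image_iff)
        have P: "(\<forall>i\<in>{1..<Suc j}. P i) \<longleftrightarrow> P 1 \<and> (\<forall>i\<in>{1..<j}. P (Suc i))" for P
          unfolding eq by blast
        have "(odometer ^^ 1) x = odometer x" by simp
        then show ?thesis using P[of "\<lambda>i. (odometer ^^ i) x \<notin> Yset"] by (simp only: fs)
      qed
      show "x \<in> hits (Suc j) A \<longleftrightarrow> x \<in> odometer -` (hits j A - Yset) \<inter> odo_space"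
        unfolding hits_def mem_Collect_eq all fs by (auto simp: odometer_in)
    qed
    then have "measure odo_measure (hits (Suc j) A) = measure odo_measure (hits j A - Yset)"
      using odo_invariantD[of "hits j A - Yset"] hs Yset_sets by simp
    moreover have "measure odo_measure (hits j A) = measure odo_measure (hits j A \<inter> Yset) + measure odo_measure (hits j A - Yset)"
      using odo.finite_measure_Union[of "hits j A \<inter> Yset" "hits j A - Yset"] hs Yset_sets
      by (simp add: Int_Diff_Un Int_Diff_disjoint)
    ultimately show ?thesis by simp
  qed
  have "measure odo_measure A = (\<Sum>j\<in>{1..n}. measure odo_measure (hits j A \<inter> Yset)) + measure odo_measure (hits (Suc n) A)" for n
  proof (induction n)
    case 0
    have "hits (Suc 0) A = odometer -` A \<inter> odo_space" by (auto simp: hits_def)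
    then show ?case using odo_invariantD[OF A'(2)] by simp
  next
    case (Suc n)
    then show ?case using step[of "Suc n"] by simp
  qed
  \<comment> \<open>Returns take at most 8 steps, so the remainder \<open>hits 9 A\<close> is
    empty.\<close>
  from this[of 8] have "measure odo_measure A = (\<Sum>j\<in>{1..8}. measure odo_measure (hits j A \<inter> Yset))"
    by (simp add: hits_empty)
  also have "\<dots> = measure odo_measure (\<Union>j\<in>{1..8}. hits j A \<inter> Yset)"
  proof (rule odo.finite_measure_finite_Union[symmetric])
    show "disjoint_family_on (\<lambda>j. hits j A \<inter> Yset) {1..8}"
      using hits_disjoint[OF A'(1)] unfolding disjoint_family_on_def by fastforce
  qed (use hs Yset_sets in auto)
  also have "\<dots> = measure odo_measure (Tmap -` A \<inter> Yset)"
    by (simp only: Tmap_vimage[OF A'(1)])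
  finally show ?thesis by simp
qed

lemma measure_Yset_pos: "measure odo_measure Yset > 0"
proof -
  have "X.cyl 1 0 \<subseteq> Yset" using Yset_first_digit by (auto simp: X.cyl_def)
  then have "measure odo_measure (X.cyl 1 0) \<le> measure odo_measure Yset"
    using Yset_sets by (intro odo.finite_measure_mono) auto
  moreover have "measure odo_measure (X.cyl 1 0) > 0"
    using odo_measure_cyl[of 0 1] by (simp add: radix_1)
  ultimately show ?thesis by linarith
qed

lemma sets_nu [simp]: "sets nu = sets Y.bor"
proof -
  have "sets nu = sets (restrict_space odo_measure Yset)" by (simp add: nu_def)
  also have "\<dots> = (\<lambda>A. A \<inter> Yset) ` sets X.bor" by (simp add: sets_restrict_space Int_commute image_def)
  also have "\<dots> = sets Y.bor"
  proof (intro set_eqI iffI)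
    fix A assume "A \<in> sets Y.bor"
    then have "A \<in> sets X.bor" "A = A \<inter> Yset" by (auto simp: sets_Y_iff)
    then show "A \<in> (\<lambda>A. A \<inter> Yset) ` sets X.bor" by blast
  qed (use Yset_sets in \<open>auto simp: sets_Y_iff\<close>)
  finally show ?thesis .
qed

lemma measure_nu: "A \<in> sets Y.bor \<Longrightarrow> measure nu A = measure odo_measure A / measure odo_measure Yset"
proof -
  assume A: "A \<in> sets Y.bor"
  then have A': "A \<subseteq> Yset" "A \<in> sets X.bor" by (simp_all add: sets_Y_iff)
  have "emeasure (restrict_space odo_measure Yset) A = emeasure odo_measure A"
    by (rule emeasure_restrict_space) (use A' Yset_sets Yset_subset in \<open>auto simp: Int_absorb2\<close>)
  then have "emeasure nu A = inverse (emeasure odo_measure Yset) * emeasure odo_measure A"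
    by (simp add: nu_def)
  also have "\<dots> = ennreal (measure odo_measure A / measure odo_measure Yset)"
    using measure_Yset_pos by (simp add: odo.emeasure_eq_measure inverse_ennreal ennreal_mult[symmetric] divide_inverse mult.commute)
  finally show ?thesis by (simp add: measure_def)
qed

lemma nu_probs: "nu \<in> Y.probs"
proof (rule Y.probsI)
  have Y: "Yset \<in> sets Y.bor" by (simp add: sets_Y_iff Yset_sets)
  then show "measure nu Yset = 1" using measure_nu measure_Yset_pos by simp
  then show "finite_measure nu"
    by (intro finite_measureI) (auto simp: Y.space_eq[OF sets_nu] measure_def)
qed simp

interpretation nu: prob_space nu
  using nu_probs by (simp add: Y.probs_def)

lemma space_nu [simp]: "space nu = Yset"
  by (rule Y.space_eq) simp

lemma Tmap_vimage_sets: "A \<in> sets Y.bor \<Longrightarrow> Tmap -` A \<inter> Yset \<in> sets Y.bor"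
  using measurable_sets[OF Tmap_measurable, of A] by simp

lemma nu_invariant: "Y.invariant Tmap nu"
  unfolding Y.invariant_def using measure_Tmap_vimage Tmap_vimage_sets by (simp add: measure_nu)

text \<open>A T-invariant measure lifts to an odometer-invariant one along the tower of return times
  over Y. The lift \<open>L\<close> is a multiple of the odometer measure and agrees with m on
  Y.\<close>

lemma nu_unique:
  assumes m: "sets m = sets Y.bor" "finite_measure m" and inv: "Y.invariant Tmap m" and A: "A \<in> sets Y.bor"
  shows "measure m A = measure m Yset * measure nu A"
proof -
  interpret m: finite_measure m by fact
  \<comment> \<open>Base points of floor j, those with return time greater than j, whose image on
    that floor lies in A. The bound 8 on return times leaves floors 0 to 7.\<close>
  define F where "F j A = {y \<in> Yset. (\<forall>i\<in>{1..<Suc j}. (odometer ^^ i) y \<notin> Yset) \<and> (odometer ^^ j) y \<in> A}" for j A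
  have F_sets: "F j A \<in> sets m" if "A \<in> sets X.bor" for j A
  proof -
    have "F j A = Yset \<inter> {x \<in> odo_space. (odometer ^^ j) x \<in> A} - (\<Union>i\<in>{1..<Suc j}. {x \<in> odo_space. (odometer ^^ i) x \<in> Yset})"
      using Yset_subset by (auto simp: F_def)
    moreover have "\<dots> \<in> sets X.bor"
      using funpow_vimage_sets[OF that] funpow_vimage_sets[OF Yset_sets] Yset_sets by simp
    ultimately show ?thesis
      unfolding m(1) by (auto simp: sets_Y_iff F_def)
  qed
  obtain L where L: "sets L = sets X.bor" "finite_measure L"
    "\<And>A. A \<in> sets X.bor \<Longrightarrow> measure L A = (\<Sum>j<8. measure m (F j A))"
  proof -
    have "\<exists>L. sets L = sets X.bor \<and> finite_measure L \<and> (\<forall>A\<in>sets X.bor. measure L A = (\<Sum>j<8. measure m (F j A)))"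
    proof (rule finite_measure_from_real)
      fix G :: "nat \<Rightarrow> (nat \<Rightarrow> nat) set"
      assume G: "range G \<subseteq> sets X.bor" "disjoint_family G"
      have "(\<lambda>i. measure m (F j (G i))) sums measure m (F j (\<Union>i. G i))" for j
      proof -
        have "F j (\<Union>i. G i) = (\<Union>i. F j (G i))" by (auto simp: F_def)
        moreover have "range (\<lambda>i. F j (G i)) \<subseteq> sets m" using F_sets G(1) by blast
        moreover have "disjoint_family (\<lambda>i. F j (G i))"
          using G(2) unfolding disjoint_family_on_def F_def by blast
        ultimately show ?thesis using m.finite_measure_UNION by simp
      qed
      then show "(\<lambda>i. \<Sum>j<8. measure m (F j (G i))) sums (\<Sum>j<8. measure m (F j (\<Union>i. G i)))"
        by (rule sums_sum)
    qed (simp add: sum_nonneg)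
    then show ?thesis using that by blast
  qed
  have "X.invariant odometer L"
    unfolding X.invariant_def
  proof
    fix A assume A: "A \<in> sets X.bor"
    let ?B = "odometer -` A \<inter> odo_space" and ?A = "A \<inter> Yset"
    have B: "?B \<in> sets X.bor" using measurable_sets[OF odometer_measurable A] by simp
    have AY: "?A \<in> sets X.bor" "?A \<subseteq> Yset" "?A \<in> sets Y.bor" using A Yset_sets by (auto simp: sets_Y_iff)
    have hm: "hits (Suc j) ?A \<inter> Yset \<in> sets m" for j
      unfolding m(1) using hits_sets[OF AY(1)] Yset_sets by (auto simp: sets_Y_iff)
    \<comment> \<open>One more step of the odometer leads either to the next floor or back to Y.
      Summed over all floors, the returns contribute the mass of \<open>A \<inter> Yset\<close> by
      invariance under T, which is floor 0 of A.\<close>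
    have split: "measure m (F j ?B) = measure m (F (Suc j) A) + measure m (hits (Suc j) ?A \<inter> Yset)" for j
    proof -
      have "{1..<Suc (Suc j)} = insert (Suc j) {1..<Suc j}" by auto
      then have "F j ?B = F (Suc j) A \<union> (hits (Suc j) ?A \<inter> Yset)" "F (Suc j) A \<inter> (hits (Suc j) ?A \<inter> Yset) = {}"
        using Yset_subset funpow_odometer_in by (auto simp: F_def hits_def)
      then show ?thesis using m.finite_measure_Union[OF F_sets[OF A] hm] by simp
    qed
    have F0: "F 0 A = ?A" by (auto simp: F_def)
    have F8: "F 8 A = {}"
    proof -
      have "F 8 A \<subseteq> hits 9 UNIV" using Yset_subset by (auto simp: F_def hits_def)
      then show ?thesis using hits_empty[of 9 UNIV] by simp
    qed
    have "(\<Sum>j<8. measure m (hits (Suc j) ?A \<inter> Yset)) = (\<Sum>j\<in>{1..8}. measure m (hits j ?A \<inter> Yset))"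
      by (rule sum.reindex_bij_witness[of _ "\<lambda>j. j - 1" Suc]) auto
    also have "\<dots> = measure m (\<Union>j\<in>{1..8}. hits j ?A \<inter> Yset)"
    proof (rule m.finite_measure_finite_Union[symmetric])
      show "disjoint_family_on (\<lambda>j. hits j ?A \<inter> Yset) {1..8}"
        using hits_disjoint[OF AY(2)] unfolding disjoint_family_on_def by fastforce
      show "(\<lambda>j. hits j ?A \<inter> Yset) ` {1..8} \<subseteq> sets m"
        unfolding m(1) using hits_sets[OF AY(1)] Yset_sets by (auto simp: sets_Y_iff)
    qed simp
    also have "\<dots> = measure m ?A"
      by (simp only: Tmap_vimage[OF AY(2), symmetric] bspec[OF inv[unfolded Y.invariant_def] AY(3)])
    finally have h: "(\<Sum>j<8. measure m (hits (Suc j) ?A \<inter> Yset)) = measure m ?A" .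
    have "(\<Sum>j<8. measure m (F (Suc j) A)) + measure m (F 0 A) = (\<Sum>j<8. measure m (F j A)) + measure m (F 8 A)"
      using sum.lessThan_Suc_shift[of "\<lambda>j. measure m (F j A)" 8] sum.lessThan_Suc[of "\<lambda>j. measure m (F j A)" 8] by simp
    then have "(\<Sum>j<8. measure m (F (Suc j) A)) + measure m ?A = (\<Sum>j<8. measure m (F j A))"
      by (simp add: F0 F8)
    then show "measure L ?B = measure L A"
      unfolding L(3)[OF A] L(3)[OF B] split sum.distrib h .
  qed
  note u = odometer_unique[OF L(1,2) this]
  have Lm: "measure L A = measure m A" if "A \<in> sets Y.bor" for A
  proof -
    have A: "A \<in> sets X.bor" "A \<subseteq> Yset" using that by (simp_all add: sets_Y_iff)
    have "F j A = {}" if "j \<ge> 1" for j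
      using that A(2) by (auto simp: F_def)
    moreover have "F 0 A = A"
      using A(2) by (auto simp: F_def)
    ultimately have "measure m (F j A) = (if j = 0 then measure m A else 0)" for j
      by (cases "j = 0") simp_all
    then have "(\<Sum>j<8. measure m (F j A)) = (\<Sum>j<8::nat. if j = 0 then measure m A else 0)"
      by (intro sum.cong refl)
    also have "\<dots> = measure m A" by simp
    finally show ?thesis using L(3)[OF A(1)] by simp
  qed
  have YY: "Yset \<in> sets Y.bor" by (simp add: sets_Y_iff Yset_sets)
  have "measure m A = measure L odo_space * measure odo_measure A"
    using Lm[OF A] u A by (simp add: sets_Y_iff)
  moreover have "measure m Yset = measure L odo_space * measure odo_measure Yset"
    using Lm[OF YY] u Yset_sets by simp
  ultimately show ?thesis
    using measure_nu[OF A] measure_Yset_pos by simp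
qed

section \<open>Self-joinings\<close>

interpretation YY: coded_space "Yset \<times> Yset" "\<lambda>n z. prod_encode (val n (fst z), val n (snd z))"
  by (rule Y.coded_square)

abbreviation TT :: "(nat \<Rightarrow> nat) \<times> (nat \<Rightarrow> nat) \<Rightarrow> (nat \<Rightarrow> nat) \<times> (nat \<Rightarrow> nat)" where
  "TT \<equiv> map_prod Tmap Tmap"

lemma YY_cyl: "YY.cyl n (prod_encode (u, v)) = Y.cyl n u \<times> Y.cyl n v"
  by (auto simp: YY.cyl_def Y.cyl_def prod_encode_eq)

lemma YY_cyl_decode: "YY.cyl n c = Y.cyl n (fst (prod_decode c)) \<times> Y.cyl n (snd (prod_decode c))"
  using YY_cyl[of n "fst (prod_decode c)" "snd (prod_decode c)"] by simp

lemma Y_cyl_sets: "Y.cyl n c \<in> sets Y.bor"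
  by (rule Y.cyls_sets[OF Y.cyl_in_cyls])

lemma Y_top_sets: "Yset \<in> sets Y.bor"
  by (rule Y.cyls_sets[OF Y.cyls.top])

lemma Pair_measurable_Y:
  assumes f: "f \<in> measurable M Y.bor" and g: "g \<in> measurable M Y.bor"
  shows "(\<lambda>x. (f x, g x)) \<in> measurable M YY.bor"
proof (rule YY.measurable_code)
  fix n c
  have "(\<lambda>x. (f x, g x)) -` YY.cyl n c \<inter> space M =
    (f -` Y.cyl n (fst (prod_decode c)) \<inter> space M) \<inter> (g -` Y.cyl n (snd (prod_decode c)) \<inter> space M)"
    unfolding YY_cyl_decode by auto
  then show "(\<lambda>x. (f x, g x)) -` YY.cyl n c \<inter> space M \<in> sets M"
    using measurable_sets[OF f Y_cyl_sets] measurable_sets[OF g Y_cyl_sets] by (simp only: sets.Int)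
qed (use measurable_space[OF f] measurable_space[OF g] in auto)

lemma YY_code_set: "{z \<in> Yset \<times> Yset. P (val n (fst z)) (val n (snd z))} \<in> YY.cyls"
proof -
  have "{z \<in> Yset \<times> Yset. P (val n (fst z)) (val n (snd z))} =
    {z \<in> Yset \<times> Yset. prod_encode (val n (fst z), val n (snd z)) \<in> {e. P (fst (prod_decode e)) (snd (prod_decode e))}}"
    by simp
  then show ?thesis by (simp only: YY.cylsI)
qed

lemma YY_code_set_fst: "{z \<in> Yset \<times> Yset. P (val n (fst z))} \<in> YY.cyls"
  by (rule YY_code_set)

lemma YY_code_set_snd: "{z \<in> Yset \<times> Yset. P (val n (snd z))} \<in> YY.cyls"
  by (rule YY_code_set)

lemma fst_measurable_Y: "fst \<in> measurable YY.bor Y.bor"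
proof (rule Y.measurable_code)
  fix n c
  have "fst -` Y.cyl n c \<inter> space YY.bor = {z \<in> Yset \<times> Yset. val n (fst z) = c}"
    by (auto simp: Y.cyl_def)
  then show "fst -` Y.cyl n c \<inter> space YY.bor \<in> sets YY.bor"
    using YY.cyls_sets[OF YY_code_set_fst[of "\<lambda>u. u = c" n]] by (simp only:)
qed auto

lemma snd_measurable_Y: "snd \<in> measurable YY.bor Y.bor"
proof (rule Y.measurable_code)
  fix n c
  have "snd -` Y.cyl n c \<inter> space YY.bor = {z \<in> Yset \<times> Yset. val n (snd z) = c}"
    by (auto simp: Y.cyl_def)
  then show "snd -` Y.cyl n c \<inter> space YY.bor \<in> sets YY.bor"
    using YY.cyls_sets[OF YY_code_set_snd[of "\<lambda>u. u = c" n]] by (simp only:)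
qed auto

lemma TT_measurable: "TT \<in> measurable YY.bor YY.bor"
proof -
  have "(\<lambda>z. (Tmap (fst z), Tmap (snd z))) \<in> measurable YY.bor YY.bor"
    by (intro Pair_measurable_Y measurable_compose[OF fst_measurable_Y Tmap_measurable]
        measurable_compose[OF snd_measurable_Y Tmap_measurable])
  moreover have "TT = (\<lambda>z. (Tmap (fst z), Tmap (snd z)))"
    by (simp add: fun_eq_iff map_prod_def split_beta)
  ultimately show ?thesis by simp
qed

lemma fst_vimage: "A \<subseteq> Yset \<Longrightarrow> fst -` A \<inter> (Yset \<times> Yset) = A \<times> Yset"
  by auto

lemma snd_vimage: "A \<subseteq> Yset \<Longrightarrow> snd -` A \<inter> (Yset \<times> Yset) = Yset \<times> A"
  by auto

lemma Y_sets_subset: "A \<in> sets Y.bor \<Longrightarrow> A \<subseteq> Yset"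
  by (simp add: sets_Y_iff)

lemma rect_sets: "A \<in> sets Y.bor \<Longrightarrow> B \<in> sets Y.bor \<Longrightarrow> A \<times> B \<in> sets YY.bor"
proof -
  assume A: "A \<in> sets Y.bor" and B: "B \<in> sets Y.bor"
  have "A \<times> B = (fst -` A \<inter> (Yset \<times> Yset)) \<inter> (snd -` B \<inter> (Yset \<times> Yset))"
    using Y_sets_subset[OF A] Y_sets_subset[OF B] by auto
  then show ?thesis
    using measurable_sets[OF fst_measurable_Y A] measurable_sets[OF snd_measurable_Y B] by simp
qed

lemma TT_vimage_rect:
  "A \<subseteq> Yset \<Longrightarrow> B \<subseteq> Yset \<Longrightarrow> TT -` (A \<times> B) \<inter> (Yset \<times> Yset) = (Tmap -` A \<inter> Yset) \<times> (Tmap -` B \<inter> Yset)"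
  by auto

text \<open>A joining without invariance: a limit of joinings is estimated with it before the limit
  is known to be invariant.\<close>

definition coupling :: "((nat \<Rightarrow> nat) \<times> (nat \<Rightarrow> nat)) measure \<Rightarrow> bool" where
  "coupling \<eta> \<longleftrightarrow> \<eta> \<in> YY.probs \<and>
     (\<forall>A\<in>sets Y.bor. measure \<eta> (A \<times> Yset) = measure nu A \<and> measure \<eta> (Yset \<times> A) = measure nu A)"

lemma Y_eq_nu:
  assumes "sets m = sets Y.bor" "finite_measure m" "Y.invariant Tmap m" "measure m Yset = 1"
  shows "m = nu"
proof (rule Y.measure_eqI_cyls[OF assms(1,2) sets_nu])
  show "finite_measure nu" by (rule nu.finite_measure_axioms)
  show "measure m A = measure nu A" if "A \<in> Y.cyls" for A
    using nu_unique[OF assms(1-3) Y.cyls_sets[OF that]] assms(4) by simp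
qed

lemma marginals:
  assumes \<eta>: "\<eta> \<in> YY.inv_probs TT"
  shows "distr \<eta> nu fst = nu" "distr \<eta> nu snd = nu"
proof -
  have P: "\<eta> \<in> YY.probs" and inv: "YY.invariant TT \<eta>"
    using \<eta> by (auto simp: YY.inv_probs_def)
  note \<eta>' = YY.probsD[OF P]
  interpret finite_measure \<eta> by (rule \<eta>'(2))
  have sp: "space \<eta> = Yset \<times> Yset" by (rule YY.space_eq[OF \<eta>'(1)])
  have inv': "measure \<eta> (TT -` A \<inter> (Yset \<times> Yset)) = measure \<eta> A" if "A \<in> sets YY.bor" for A
    using inv that unfolding YY.invariant_def by blast
  have fm: "fst \<in> measurable \<eta> nu" "snd \<in> measurable \<eta> nu"
    using fst_measurable_Y snd_measurable_Y measurable_cong_sets[OF \<eta>'(1) sets_nu] by auto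
  have m1: "measure (distr \<eta> nu fst) A = measure \<eta> (A \<times> Yset)" if "A \<in> sets Y.bor" for A
    using measure_distr[OF fm(1), of A] that Y_sets_subset[OF that] by (simp add: sp fst_vimage)
  have m2: "measure (distr \<eta> nu snd) A = measure \<eta> (Yset \<times> A)" if "A \<in> sets Y.bor" for A
    using measure_distr[OF fm(2), of A] that Y_sets_subset[OF that] by (simp add: sp snd_vimage)
  have TY: "Tmap -` Yset \<inter> Yset = Yset"
    using Tmap_in by auto
  show "distr \<eta> nu fst = nu"
  proof (rule Y_eq_nu)
    show "Y.invariant Tmap (distr \<eta> nu fst)"
      unfolding Y.invariant_def
    proof
      fix A assume A: "A \<in> sets Y.bor"
      show "measure (distr \<eta> nu fst) (Tmap -` A \<inter> Yset) = measure (distr \<eta> nu fst) A"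
        unfolding m1[OF A] m1[OF Tmap_vimage_sets[OF A]]
        using inv'[OF rect_sets[OF A Y_top_sets]]
        by (simp only: TT_vimage_rect[OF Y_sets_subset[OF A] order_refl] TY)
    qed
    show "measure (distr \<eta> nu fst) Yset = 1"
      using m1[OF Y_top_sets] \<eta>'(3) by simp
  qed (use finite_measure_distr[OF fm(1)] in auto)
  show "distr \<eta> nu snd = nu"
  proof (rule Y_eq_nu)
    show "Y.invariant Tmap (distr \<eta> nu snd)"
      unfolding Y.invariant_def
    proof
      fix A assume A: "A \<in> sets Y.bor"
      show "measure (distr \<eta> nu snd) (Tmap -` A \<inter> Yset) = measure (distr \<eta> nu snd) A"
        unfolding m2[OF A] m2[OF Tmap_vimage_sets[OF A]]
        using inv'[OF rect_sets[OF Y_top_sets A]]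
        by (simp only: TT_vimage_rect[OF order_refl Y_sets_subset[OF A]] TY)
    qed
    show "measure (distr \<eta> nu snd) Yset = 1"
      using m2[OF Y_top_sets] \<eta>'(3) by simp
  qed (use finite_measure_distr[OF fm(2)] in auto)
qed

lemma marginals_coupling:
  assumes P: "\<eta> \<in> YY.probs" and m: "distr \<eta> nu fst = nu" "distr \<eta> nu snd = nu"
  shows "coupling \<eta>"
proof -
  note \<eta>' = YY.probsD[OF P]
  have sp: "space \<eta> = Yset \<times> Yset" by (rule YY.space_eq[OF \<eta>'(1)])
  have fm: "fst \<in> measurable \<eta> nu" "snd \<in> measurable \<eta> nu"
    using fst_measurable_Y snd_measurable_Y measurable_cong_sets[OF \<eta>'(1) sets_nu] by auto
  have "measure \<eta> (A \<times> Yset) = measure nu A \<and> measure \<eta> (Yset \<times> A) = measure nu A" if "A \<in> sets Y.bor" for A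
    using measure_distr[OF fm(1), of A] measure_distr[OF fm(2), of A] that Y_sets_subset[OF that] m
    by (simp add: sp fst_vimage snd_vimage)
  then show ?thesis using P by (simp add: coupling_def)
qed

lemma inv_probs_coupling: "\<eta> \<in> YY.inv_probs TT \<Longrightarrow> coupling \<eta>"
  using marginals_coupling marginals by (auto simp: YY.inv_probs_def)

text \<open>\<open>T\<close> is uniquely ergodic, so the condition on the marginals holds for every invariant
  probability measure.\<close>

lemma self_joinings_eq: "self_joinings = YY.inv_probs TT"
proof (intro set_eqI iffI)
  fix \<eta> assume "\<eta> \<in> self_joinings"
  then have \<eta>: "sets \<eta> = sets YY.bor" "prob_space \<eta>" "distr \<eta> \<eta> TT = \<eta>"
    by (auto simp: self_joinings_def)
  then have P: "\<eta> \<in> YY.probs" by (simp add: YY.probs_def)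
  then show "\<eta> \<in> YY.inv_probs TT"
    using YY.distr_eq_iff_invariant[OF YY.probsD(1,2)[OF P] TT_measurable] \<eta>(3)
    by (simp add: YY.inv_probs_def)
next
  fix \<eta> assume \<eta>: "\<eta> \<in> YY.inv_probs TT"
  then have P: "\<eta> \<in> YY.probs" and inv: "YY.invariant TT \<eta>" by (auto simp: YY.inv_probs_def)
  then have "distr \<eta> \<eta> TT = \<eta>"
    using YY.distr_eq_iff_invariant[OF YY.probsD(1,2)[OF P] TT_measurable] by simp
  then show "\<eta> \<in> self_joinings"
    using P marginals[OF \<eta>] by (simp add: self_joinings_def YY.probs_def)
qed

lemma integral_functional_eq: "integral_functional = YY.ifun"
  by (simp add: fun_eq_iff integral_functional_def YY.ifun_def)

section \<open>Compactness of the set of self-joinings\<close>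

lemma (in finite_measure) measure_sym_diff_le:
  assumes "P \<in> sets M" "Q \<in> sets M" "R \<in> sets M" "(P - Q) \<union> (Q - P) \<subseteq> R"
  shows "\<bar>measure M P - measure M Q\<bar> \<le> measure M R"
proof -
  have "measure M P \<le> measure M (Q \<union> R)" "measure M Q \<le> measure M (P \<union> R)"
    using assms by (auto intro!: finite_measure_mono)
  moreover have "measure M (Q \<union> R) \<le> measure M Q + measure M R" "measure M (P \<union> R) \<le> measure M P + measure M R"
    using assms by (auto intro!: measure_Un_le)
  ultimately show ?thesis by linarith
qed

abbreviation sdiff :: "'a set \<Rightarrow> 'a set \<Rightarrow> 'a set" where
  "sdiff A B \<equiv> (A - B) \<union> (B - A)"

text \<open>The error is visible in the marginals, so the bound is the same for every
  coupling.\<close>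

lemma coupling_rect_diff:
  assumes \<eta>: "coupling \<eta>" and s: "A \<in> sets Y.bor" "A' \<in> sets Y.bor" "B \<in> sets Y.bor" "B' \<in> sets Y.bor"
  shows "\<bar>measure \<eta> (A \<times> B) - measure \<eta> (A' \<times> B')\<bar> \<le> measure nu (sdiff A A') + measure nu (sdiff B B')"
proof -
  have P: "\<eta> \<in> YY.probs" using \<eta> by (simp add: coupling_def)
  interpret finite_measure \<eta> by (rule YY.probsD(2)[OF P])
  note se = YY.probsD(1)[OF P]
  have d: "sdiff A A' \<in> sets Y.bor" "sdiff B B' \<in> sets Y.bor" using s by auto
  let ?R = "sdiff A A' \<times> Yset \<union> Yset \<times> sdiff B B'"
  have R: "sdiff A A' \<times> Yset \<in> sets \<eta>" "Yset \<times> sdiff B B' \<in> sets \<eta>"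
    unfolding se by (intro rect_sets d Y_top_sets)+
  have "\<bar>measure \<eta> (A \<times> B) - measure \<eta> (A' \<times> B')\<bar> \<le> measure \<eta> ?R"
  proof (rule measure_sym_diff_le)
    show "A \<times> B \<in> sets \<eta>" "A' \<times> B' \<in> sets \<eta>" unfolding se by (intro rect_sets s)+
    show "?R \<in> sets \<eta>" using R by blast
    show "sdiff (A \<times> B) (A' \<times> B') \<subseteq> ?R" using s[THEN Y_sets_subset] by auto
  qed
  also have "\<dots> \<le> measure \<eta> (sdiff A A' \<times> Yset) + measure \<eta> (Yset \<times> sdiff B B')"
    by (rule measure_Un_le[OF R])
  also have "\<dots> = measure nu (sdiff A A') + measure nu (sdiff B B')"
    using \<eta> d unfolding coupling_def by simp
  finally show ?thesis .
qed

lemma rect_cyls: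
  assumes "C \<in> Y.cyls" "D \<in> Y.cyls" shows "C \<times> D \<in> YY.cyls"
proof -
  obtain n P Q where "C = {x \<in> Yset. val n x \<in> P}" "D = {x \<in> Yset. val n x \<in> Q}"
    using assms by (rule Y.cyls_common)
  then have "C \<times> D = {z \<in> Yset \<times> Yset. val n (fst z) \<in> P \<and> val n (snd z) \<in> Q}"
    by auto
  then show ?thesis
    using YY_code_set[of "\<lambda>u v. u \<in> P \<and> v \<in> Q" n] by (simp only:)
qed

text \<open>T is not continuous, so invariance does not pass to limits by itself. The marginals do,
  since they are read on clopen sets. A T-preimage of a clopen set is then exchanged for a clopen
  set, at the same cost for the limit and for the joinings approximating it.\<close>

lemma closed_joinings: "closed (YY.ifun ` YY.inv_probs TT)"
proof -
  let ?J = "YY.inv_probs TT"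
  have JP: "?J \<subseteq> YY.probs" by (auto simp: YY.inv_probs_def)
  have "\<phi> \<in> YY.ifun ` ?J" if \<phi>: "\<phi> \<in> closure (YY.ifun ` ?J)" for \<phi>
  proof -
    have "closure (YY.ifun ` ?J) \<subseteq> YY.ifun ` YY.probs"
      using JP by (intro closure_minimal YY.closed_probs image_mono)
    then obtain \<eta> where \<eta>: "\<eta> \<in> YY.probs" "\<phi> = YY.ifun \<eta>" using \<phi> by blast
    have near: "\<exists>N\<in>?J. \<forall>A\<in>\<C>. \<bar>measure N A - measure \<eta> A\<bar> < e" if "finite \<C>" "\<C> \<subseteq> YY.cyls" "e > 0" for \<C> e
      using YY.ifun_closure_cyls[OF \<eta>(1) JP _ that(3,1,2)] \<phi> \<eta>(2) by simp
    note \<eta>' = YY.probsD[OF \<eta>(1)]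
    interpret finite_measure \<eta> by (rule \<eta>'(2))
    have sp: "space \<eta> = Yset \<times> Yset" by (rule YY.space_eq[OF \<eta>'(1)])
    have fm: "fst \<in> measurable \<eta> nu" "snd \<in> measurable \<eta> nu"
      using fst_measurable_Y snd_measurable_Y measurable_cong_sets[OF \<eta>'(1) sets_nu] by auto
    have marg: "measure \<eta> (C \<times> Yset) = measure nu C" "measure \<eta> (Yset \<times> C) = measure nu C" if C: "C \<in> Y.cyls" for C
    proof -
      have le: "\<bar>measure \<eta> (C \<times> Yset) - measure nu C\<bar> \<le> e \<and> \<bar>measure \<eta> (Yset \<times> C) - measure nu C\<bar> \<le> e" if e: "e > 0" for e
      proof -
        have "{C \<times> Yset, Yset \<times> C} \<subseteq> YY.cyls" using rect_cyls C Y.cyls.top by simp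
        then obtain N where N: "N \<in> ?J" "\<bar>measure N (C \<times> Yset) - measure \<eta> (C \<times> Yset)\<bar> < e"
          "\<bar>measure N (Yset \<times> C) - measure \<eta> (Yset \<times> C)\<bar> < e"
          using near[of "{C \<times> Yset, Yset \<times> C}" e] e by auto
        have "measure N (C \<times> Yset) = measure nu C" "measure N (Yset \<times> C) = measure nu C"
          using inv_probs_coupling[OF N(1)] Y.cyls_sets[OF C] by (auto simp: coupling_def)
        then show ?thesis using N by linarith
      qed
      have "\<bar>measure \<eta> (C \<times> Yset) - measure nu C\<bar> \<le> 0"
        by (rule field_le_epsilon) (use le in simp)
      moreover have "\<bar>measure \<eta> (Yset \<times> C) - measure nu C\<bar> \<le> 0"
        by (rule field_le_epsilon) (use le in simp)
      ultimately show "measure \<eta> (C \<times> Yset) = measure nu C" "measure \<eta> (Yset \<times> C) = measure nu C" by auto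
    qed
    have "distr \<eta> nu fst = nu"
    proof (rule Y.measure_eqI_cyls[OF _ finite_measure_distr[OF fm(1)] sets_nu nu.finite_measure_axioms])
      fix A assume A: "A \<in> Y.cyls"
      show "measure (distr \<eta> nu fst) A = measure nu A"
        using measure_distr[OF fm(1), of A] Y.cyls_sets[OF A] Y.cyls.sets_into_space[OF A] marg(1)[OF A]
        by (simp add: sp fst_vimage)
    qed simp
    moreover have "distr \<eta> nu snd = nu"
    proof (rule Y.measure_eqI_cyls[OF _ finite_measure_distr[OF fm(2)] sets_nu nu.finite_measure_axioms])
      fix A assume A: "A \<in> Y.cyls"
      show "measure (distr \<eta> nu snd) A = measure nu A"
        using measure_distr[OF fm(2), of A] Y.cyls_sets[OF A] Y.cyls.sets_into_space[OF A] marg(2)[OF A]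
        by (simp add: sp snd_vimage)
    qed simp
    ultimately have cp: "coupling \<eta>"
      using \<eta>(1) by (rule marginals_coupling[rotated])
    have rect: "measure \<eta> ((Tmap -` U \<inter> Yset) \<times> (Tmap -` V \<inter> Yset)) = measure \<eta> (U \<times> V)"
      if U: "U \<in> Y.cyls" and V: "V \<in> Y.cyls" for U V
    proof -
      let ?U = "Tmap -` U \<inter> Yset" and ?V = "Tmap -` V \<inter> Yset"
      have UV: "?U \<in> sets Y.bor" "?V \<in> sets Y.bor" by (intro Tmap_vimage_sets Y.cyls_sets U V)+
      have eps: "\<bar>measure \<eta> (?U \<times> ?V) - measure \<eta> (U \<times> V)\<bar> \<le> e" if e: "e > 0" for e
      proof -
        \<comment> \<open>Exchanging the rectangle costs 2e/6 for \<open>\<eta>\<close> and 2e/6 for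
          \<open>N\<close>; the two clopen rectangles cost e/6 each.\<close>
        have e6: "e / 6 > 0" using e by simp
        obtain C where C: "C \<in> Y.cyls" "measure nu (sdiff ?U C) < e / 6"
          using Y.approx_cyls[OF sets_nu nu.finite_measure_axioms UV(1) e6] by blast
        obtain D where D: "D \<in> Y.cyls" "measure nu (sdiff ?V D) < e / 6"
          using Y.approx_cyls[OF sets_nu nu.finite_measure_axioms UV(2) e6] by blast
        have "{C \<times> D, U \<times> V} \<subseteq> YY.cyls" using rect_cyls C D U V by simp
        then obtain N where N: "N \<in> ?J" "\<bar>measure N (C \<times> D) - measure \<eta> (C \<times> D)\<bar> < e / 6"
          "\<bar>measure N (U \<times> V) - measure \<eta> (U \<times> V)\<bar> < e / 6"
          using near[of "{C \<times> D, U \<times> V}" "e / 6"] e6 by auto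
        have "YY.invariant TT N" using N(1) by (simp add: YY.inv_probs_def)
        then have "measure N (TT -` (U \<times> V) \<inter> (Yset \<times> Yset)) = measure N (U \<times> V)"
          unfolding YY.invariant_def using rect_sets Y.cyls_sets U V by blast
        then have NUV: "measure N (?U \<times> ?V) = measure N (U \<times> V)"
          by (simp only: TT_vimage_rect[OF Y.cyls.sets_into_space[OF U] Y.cyls.sets_into_space[OF V]])
        show ?thesis
          using coupling_rect_diff[OF cp UV(1) Y.cyls_sets[OF C(1)] UV(2) Y.cyls_sets[OF D(1)]]
            coupling_rect_diff[OF inv_probs_coupling[OF N(1)] UV(1) Y.cyls_sets[OF C(1)] UV(2) Y.cyls_sets[OF D(1)]]
            N NUV C(2) D(2) by linarith
      qed
      have "\<bar>measure \<eta> (?U \<times> ?V) - measure \<eta> (U \<times> V)\<bar> \<le> 0"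
        by (rule field_le_epsilon) (simp only: add_0 eps)
      then show ?thesis by linarith
    qed
    have Tm: "TT \<in> measurable \<eta> \<eta>"
      using TT_measurable measurable_cong_sets[OF \<eta>'(1) \<eta>'(1)] by blast
    have "distr \<eta> \<eta> TT = \<eta>"
    proof (rule YY.measure_eqI_cyl[OF _ finite_measure_distr[OF Tm] \<eta>'(1,2)])
      fix n c
      let ?U = "Y.cyl n (fst (prod_decode c))" and ?V = "Y.cyl n (snd (prod_decode c))"
      have sub: "?U \<subseteq> Yset" "?V \<subseteq> Yset" by (auto simp: Y.cyl_def)
      have "measure (distr \<eta> \<eta> TT) (?U \<times> ?V) = measure \<eta> (TT -` (?U \<times> ?V) \<inter> (Yset \<times> Yset))"
        using measure_distr[OF Tm, of "?U \<times> ?V"] rect_sets[OF Y_cyl_sets Y_cyl_sets] by (simp add: \<eta>'(1) sp)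
      then show "measure (distr \<eta> \<eta> TT) (YY.cyl n c) = measure \<eta> (YY.cyl n c)"
        unfolding YY_cyl_decode TT_vimage_rect[OF sub] rect[OF Y.cyl_in_cyls Y.cyl_in_cyls] .
    qed (simp add: \<eta>'(1))
    then have "\<eta> \<in> ?J"
      using YY.distr_eq_iff_invariant[OF \<eta>'(1,2) TT_measurable] \<eta>(1) by (simp add: YY.inv_probs_def)
    then show ?thesis using \<eta>(2) by blast
  qed
  then show ?thesis
    by (metis closure_subset closed_closure subsetI subset_antisym)
qed

lemma compact_joinings: "compact (YY.ifun ` YY.inv_probs TT)"
proof -
  have "YY.ifun ` YY.inv_probs TT \<subseteq> YY.ifun ` YY.probs"
    by (auto simp: YY.inv_probs_def)
  then show ?thesis
    using closed_Int_compact[OF closed_joinings YY.compact_probs] by (simp add: Int_absorb2)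
qed

section \<open>Joinings supported on graphs of powers of T\<close>

definition graph_joining :: "nat \<Rightarrow> ((nat \<Rightarrow> nat) \<times> (nat \<Rightarrow> nat)) measure" where
  "graph_joining d = distr nu YY.bor (\<lambda>x. (x, (Tmap ^^ d) x))"

lemma funpow_Tmap_measurable: "(Tmap ^^ d) \<in> measurable Y.bor Y.bor"
proof (induction d)
  case (Suc d)
  then show ?case
    using measurable_comp[OF Suc Tmap_measurable] by (simp only: funpow.simps(2))
qed (simp add: id_def)

lemma funpow_Tmap_vimage_sets: "A \<in> sets Y.bor \<Longrightarrow> (Tmap ^^ d) -` A \<inter> Yset \<in> sets Y.bor"
  using measurable_sets[OF funpow_Tmap_measurable, of A d] by simp

lemma nu_invariantD: "A \<in> sets Y.bor \<Longrightarrow> measure nu (Tmap -` A \<inter> Yset) = measure nu A"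
  using nu_invariant by (simp add: Y.invariant_def)

lemma measure_nu_funpow:
  assumes "A \<in> sets Y.bor" shows "measure nu ((Tmap ^^ d) -` A \<inter> Yset) = measure nu A"
proof (induction d)
  case (Suc d)
  have eq: "(Tmap ^^ Suc d) -` A \<inter> Yset = Tmap -` ((Tmap ^^ d) -` A \<inter> Yset) \<inter> Yset"
    by (auto simp: funpow_swap1 Tmap_in)
  show ?case
    unfolding eq nu_invariantD[OF funpow_Tmap_vimage_sets[OF assms]] by (rule Suc)
qed (use Y_sets_subset[OF assms] in \<open>simp add: Int_absorb2\<close>)

lemma graph_map_measurable: "(\<lambda>x. (x, (Tmap ^^ d) x)) \<in> measurable nu YY.bor"
proof -
  have "(\<lambda>x. (x, (Tmap ^^ d) x)) \<in> measurable Y.bor YY.bor"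
    by (intro Pair_measurable_Y funpow_Tmap_measurable) simp
  then show ?thesis using measurable_cong_sets[OF sets_nu refl] by blast
qed

lemma measure_graph_joining:
  "S \<in> sets YY.bor \<Longrightarrow> measure (graph_joining d) S = measure nu {x \<in> Yset. (x, (Tmap ^^ d) x) \<in> S}"
  unfolding graph_joining_def
  using measure_distr[OF graph_map_measurable, of S d] by (simp add: vimage_def Int_def conj_commute)

lemma measure_graph_joining_rect:
  assumes "A \<in> sets Y.bor" "B \<in> sets Y.bor"
  shows "measure (graph_joining d) (A \<times> B) = measure nu (A \<inter> ((Tmap ^^ d) -` B \<inter> Yset))"
proof -
  have "{x \<in> Yset. (x, (Tmap ^^ d) x) \<in> A \<times> B} = A \<inter> ((Tmap ^^ d) -` B \<inter> Yset)"
    using Y_sets_subset[OF assms(1)] by auto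
  then show ?thesis using measure_graph_joining[OF rect_sets[OF assms]] by simp
qed

lemma graph_joining_probs: "graph_joining d \<in> YY.probs"
  unfolding YY.probs_def graph_joining_def
  using nu.prob_space_distr[OF graph_map_measurable] by simp

lemma graph_joining_inv: "graph_joining d \<in> YY.inv_probs TT"
proof -
  have "YY.invariant TT (graph_joining d)"
    unfolding YY.invariant_def
  proof
    fix S assume S: "S \<in> sets YY.bor"
    have S': "TT -` S \<inter> (Yset \<times> Yset) \<in> sets YY.bor"
      using measurable_sets[OF TT_measurable S] by simp
    let ?E = "{x \<in> Yset. (x, (Tmap ^^ d) x) \<in> S}"
    have E: "?E \<in> sets Y.bor"
      using measurable_sets[OF graph_map_measurable S, of d] by (simp add: vimage_def Int_def conj_commute)
    have "{x \<in> Yset. (x, (Tmap ^^ d) x) \<in> TT -` S \<inter> (Yset \<times> Yset)} = Tmap -` ?E \<inter> Yset"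
      by (auto simp: funpow_Tmap_in Tmap_in funpow_swap1)
    then show "measure (graph_joining d) (TT -` S \<inter> (Yset \<times> Yset)) = measure (graph_joining d) S"
      using measure_graph_joining[OF S'] measure_graph_joining[OF S] nu_invariantD[OF E] by simp
  qed
  then show ?thesis
    using graph_joining_probs by (simp add: YY.inv_probs_def)
qed

text \<open>The rectangles \<open>(Yset - E) \<times> B\<close> and
  \<open>E \<times> (Yset - B)\<close> miss the graph. Up to them \<open>A \<times> B\<close> is
  \<open>(A \<inter> E) \<times> Yset\<close>, whose mass is prescribed by the first
  marginal.\<close>

lemma joining_on_graph_eq:
  assumes \<eta>: "coupling \<eta>"
    and null: "\<And>S. S \<in> sets YY.bor \<Longrightarrow> measure (graph_joining d) S = 0 \<Longrightarrow> measure \<eta> S = 0"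
  shows "\<eta> = graph_joining d"
proof (rule YY.measure_eqI_cyl)
  have P: "\<eta> \<in> YY.probs" using \<eta> by (simp add: coupling_def)
  note \<eta>' = YY.probsD[OF P]
  show "sets \<eta> = sets YY.bor" "finite_measure \<eta>" by (fact \<eta>')+
  show "sets (graph_joining d) = sets YY.bor" "finite_measure (graph_joining d)"
    by (rule YY.probsD[OF graph_joining_probs])+
  interpret finite_measure \<eta> by (fact \<eta>'(2))
  fix n c
  define A where "A = Y.cyl n (fst (prod_decode c))"
  define B where "B = Y.cyl n (snd (prod_decode c))"
  define E where "E = (Tmap ^^ d) -` B \<inter> Yset"
  have s: "A \<in> sets Y.bor" "B \<in> sets Y.bor" "E \<in> sets Y.bor"
    unfolding A_def B_def E_def by (intro Y_cyl_sets funpow_Tmap_vimage_sets)+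
  have cB: "Yset - B \<in> sets Y.bor" and cE: "Yset - E \<in> sets Y.bor"
    using s Y_top_sets by auto
  have "measure (graph_joining d) ((Yset - E) \<times> B) = 0"
  proof -
    have "(Yset - E) \<inter> ((Tmap ^^ d) -` B \<inter> Yset) = {}" by (auto simp: E_def)
    then show ?thesis using measure_graph_joining_rect[OF cE s(2)] by simp
  qed
  then have n1: "measure \<eta> ((Yset - E) \<times> B) = 0" using null[OF rect_sets[OF cE s(2)]] by simp
  have "measure (graph_joining d) (E \<times> (Yset - B)) = 0"
  proof -
    have "E \<inter> ((Tmap ^^ d) -` (Yset - B) \<inter> Yset) = {}" by (auto simp: E_def)
    then show ?thesis using measure_graph_joining_rect[OF s(3) cB] by simp
  qed
  then have n2: "measure \<eta> (E \<times> (Yset - B)) = 0" using null[OF rect_sets[OF s(3) cB]] by simp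
  have AE: "A \<inter> E \<in> sets Y.bor" using s by auto
  have "\<bar>measure \<eta> (A \<times> B) - measure \<eta> ((A \<inter> E) \<times> Yset)\<bar> \<le> measure \<eta> ((Yset - E) \<times> B \<union> E \<times> (Yset - B))"
  proof (rule measure_sym_diff_le)
    show "A \<times> B \<in> sets \<eta>" "(A \<inter> E) \<times> Yset \<in> sets \<eta>" "(Yset - E) \<times> B \<union> E \<times> (Yset - B) \<in> sets \<eta>"
      unfolding \<eta>'(1) by (intro rect_sets sets.Un s AE cE cB Y_top_sets)+
    show "sdiff (A \<times> B) ((A \<inter> E) \<times> Yset) \<subseteq> (Yset - E) \<times> B \<union> E \<times> (Yset - B)"
      using s[THEN Y_sets_subset] by auto
  qed
  also have "\<dots> \<le> measure \<eta> ((Yset - E) \<times> B) + measure \<eta> (E \<times> (Yset - B))"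
    by (rule measure_Un_le) (simp_all only: \<eta>'(1) rect_sets s cE cB)
  finally have "measure \<eta> (A \<times> B) = measure \<eta> ((A \<inter> E) \<times> Yset)" using n1 n2 by simp
  also have "\<dots> = measure nu (A \<inter> E)" using \<eta> AE by (simp add: coupling_def)
  also have "\<dots> = measure (graph_joining d) (A \<times> B)"
    using measure_graph_joining_rect[OF s(1,2)] by (simp add: E_def)
  finally show "measure \<eta> (YY.cyl n c) = measure (graph_joining d) (YY.cyl n c)"
    unfolding YY_cyl_decode A_def B_def .
qed

text \<open>Both parts of a proper convex combination vanish on the null sets of the combination. So
  they are concentrated on the graph and, having marginal \<nu>, equal the graph joining.\<close>

lemma graph_joining_extreme:
  "YY.ifun (graph_joining d) extreme_point_of (YY.ifun ` YY.inv_probs TT)"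
  unfolding extreme_point_of_def
proof (intro conjI ballI)
  show "YY.ifun (graph_joining d) \<in> YY.ifun ` YY.inv_probs TT"
    using graph_joining_inv by blast
  fix a b assume "a \<in> YY.ifun ` YY.inv_probs TT" "b \<in> YY.ifun ` YY.inv_probs TT"
  then obtain M N where M: "M \<in> YY.inv_probs TT" "a = YY.ifun M" and N: "N \<in> YY.inv_probs TT" "b = YY.ifun N"
    by blast
  show "YY.ifun (graph_joining d) \<notin> open_segment a b"
  proof
    assume "YY.ifun (graph_joining d) \<in> open_segment a b"
    then obtain u where u: "0 < u" "u < 1" "YY.ifun (graph_joining d) = (1 - u) *\<^sub>R a + u *\<^sub>R b" and ab: "a \<noteq> b"
      by (auto simp: in_segment)
    have MF: "M \<in> YY.inv_fins TT" and NF: "N \<in> YY.inv_fins TT"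
      using M N YY.inv_probs_subset_fins by auto
    obtain L where L: "L \<in> YY.inv_fins TT"
      "\<And>A. A \<in> sets YY.bor \<Longrightarrow> measure L A = (1 - u) * measure M A + u * measure N A"
      "YY.height_functional L = (1 - u) *\<^sub>R YY.height_functional M + u *\<^sub>R YY.height_functional N"
      by (rule YY.inv_fins_lincomb[OF TT_measurable MF NF, of "1 - u" u]) (use u in auto)
    have "YY.ifun L = YY.ifun (graph_joining d)"
      using L(3) u(3) M(2) N(2) by (simp add: YY.height_functional_def)
    then have Lg: "L = graph_joining d"
      by (rule YY.ifun_inject[OF YY.inv_finsD[OF L(1)] YY.probsD(1,2)[OF graph_joining_probs]])
    have null: "measure M S = 0 \<and> measure N S = 0" if S: "S \<in> sets YY.bor" "measure (graph_joining d) S = 0" for S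
    proof -
      have "(1 - u) * measure M S + u * measure N S = 0"
        using L(2)[OF S(1)] S(2) Lg by simp
      moreover have "(1 - u) * measure M S \<ge> 0" "u * measure N S \<ge> 0" using u by auto
      ultimately have "(1 - u) * measure M S = 0" "u * measure N S = 0" by linarith+
      then show ?thesis using u by simp
    qed
    have "M = graph_joining d" "N = graph_joining d"
      using joining_on_graph_eq[OF inv_probs_coupling[OF M(1)]] joining_on_graph_eq[OF inv_probs_coupling[OF N(1)]] null
      by blast+
    then show False using ab M N by simp
  qed
qed

section \<open>Blocks\<close>

lemma Yset_crit:
  assumes x: "x \<in> odo_space" and c: "val n x = crit n" and r: "x (Suc n) \<notin> removed (Suc n)" "x (Suc n) \<noteq> radix (Suc n) - 2"
  shows "x \<in> Yset"
proof -
  have "x (Suc m) \<notin> removed (Suc m)" if m: "val m x = crit m" for m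
  proof (cases m n rule: linorder_cases)
    case less
    then have "val (Suc m) x = crit (Suc m)" using val_crit_mono[OF x _ c, of "Suc m"] by simp
    then have "x (Suc m) = radix (Suc m) - 2" using val_crit_Suc[OF x, of m] by simp
    then show ?thesis using crit_digit_kept by simp
  next
    case equal
    then show ?thesis using r by simp
  next
    case greater
    then have "val (Suc n) x = crit (Suc n)" using val_crit_mono[OF x _ m, of "Suc n"] by simp
    then show ?thesis using val_crit_Suc[OF x, of n] r by simp
  qed
  then show ?thesis using x by (simp add: Yset_iff)
qed

text \<open>The quotient counts the carries into position n + 1; the hypothesis excludes an overflow
  of that digit.\<close>

lemma digit_funpow:
  assumes x: "x \<in> odo_space" and lt: "(val n x + i) div hgt n + x (Suc n) < radix (Suc n)"
  shows "((odometer ^^ i) x) (Suc n) = (val n x + i) div hgt n + x (Suc n)"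
proof -
  let ?h = "hgt n"
  have eq: "val (Suc n) x + i = (val n x + i) + x (Suc n) * ?h" by simp
  have div: "(val (Suc n) x + i) div ?h = (val n x + i) div ?h + x (Suc n)"
    unfolding eq by (simp add: div_mult_self1)
  then have "val (Suc n) x + i < hgt (Suc n)"
    using lt by (simp only: hgt.simps) (metis hgt_pos div_less_iff_less_mult mult.commute)
  then have "val (Suc n) ((odometer ^^ i) x) = val (Suc n) x + i"
    using val_funpow[OF x, of "Suc n" i] by simp
  then show ?thesis
    using val_Suc_div[OF funpow_odometer_in[OF x], of n i] div by simp
qed

text \<open>\<open>uniform n b I\<close>: in every block of depth \<open>n\<close> whose digit at position \<open>n + 1\<close> lies in \<open>I\<close>,
  the critical level is kept (\<open>b\<close>) resp. removed (\<open>\<not> b\<close>).\<close>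

definition uniform :: "nat \<Rightarrow> bool \<Rightarrow> nat set \<Rightarrow> bool" where
  "uniform n b I \<longleftrightarrow> I \<subseteq> {..<radix (Suc n)} \<and>
     (\<forall>d\<in>I. if b then d \<notin> removed (Suc n) \<and> d \<noteq> radix (Suc n) - 2 else d \<in> removed (Suc n))"

text \<open>The number of points of Y in a block of depth n. All levels other than
  \<open>crit n\<close> are decided by the first n digits, so b records the one remaining
  alternative.\<close>

definition block_len :: "nat \<Rightarrow> bool \<Rightarrow> nat" where
  "block_len n b = (\<Sum>c<hgt n. if c = crit n then of_bool b else of_bool (\<exists>x\<in>Yset. val n x = c))"

lemma block_len_True: "block_len n True = Suc (block_len n False)"
proof -
  have "block_len n b = of_bool b + (\<Sum>c\<in>{..<hgt n} - {crit n}. of_bool (\<exists>x\<in>Yset. val n x = c))" for b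
  proof -
    have "block_len n b = (if crit n = crit n then of_bool b else of_bool (\<exists>x\<in>Yset. val n x = crit n)) +
      (\<Sum>c\<in>{..<hgt n} - {crit n}. if c = crit n then of_bool b else of_bool (\<exists>x\<in>Yset. val n x = c))"
      unfolding block_len_def by (rule sum.remove) (simp_all add: crit_less)
    also have "\<dots> = of_bool b + (\<Sum>c\<in>{..<hgt n} - {crit n}. of_bool (\<exists>x\<in>Yset. val n x = c))"
      by (intro arg_cong2[of _ _ _ _ "(+)"] sum.cong) auto
    finally show ?thesis .
  qed
  from this[of True] this[of False] show ?thesis by simp
qed

lemma uniform_crit:
  assumes "uniform n b I" "x \<in> odo_space" "x (Suc n) \<in> I" "val n x = crit n"
  shows "x \<in> Yset \<longleftrightarrow> b"
proof (cases b)
  case True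
  then have "x (Suc n) \<notin> removed (Suc n)" "x (Suc n) \<noteq> radix (Suc n) - 2"
    using assms(1,3) by (auto simp: uniform_def)
  then show ?thesis using Yset_crit[OF assms(2,4)] True by simp
next
  case False
  then have "x (Suc n) \<in> removed (Suc n)" using assms(1,3) by (auto simp: uniform_def)
  then show ?thesis using assms(4) False by (auto simp: Yset_iff)
qed

lemma uniform_cong:
  assumes u: "uniform n b I" and x: "x \<in> odo_space" "x (Suc n) \<in> I" and y: "y \<in> odo_space" "y (Suc n) \<in> I"
    and eq: "val n x = val n y"
  shows "x \<in> Yset \<longleftrightarrow> y \<in> Yset"
proof (cases "val n x = crit n")
  case True
  then show ?thesis using uniform_crit[OF u x] uniform_crit[OF u y] eq by simp
qed (use Yset_noncrit[OF x(1) y(1) eq] in simp)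

lemma div_block: "v < h \<Longrightarrow> i \<le> k * h \<Longrightarrow> (v + i) div h \<le> (k::nat)"
proof -
  assume "v < h" "i \<le> k * h"
  then have "v + i < Suc k * h" by simp
  then have "(v + i) div h < Suc k" by (rule less_mult_imp_div_less)
  then show ?thesis by simp
qed

text \<open>From any starting level, k block lengths cross at most k block boundaries.\<close>

lemma digit_range:
  assumes x: "x \<in> odo_space" and I: "{x (Suc n)..x (Suc n) + k} \<subseteq> I" and u: "uniform n b I" and i: "i \<le> k * hgt n"
  shows "((odometer ^^ i) x) (Suc n) \<in> I" "((odometer ^^ i) x) (Suc n) \<le> x (Suc n) + k"
proof -
  have le: "(val n x + i) div hgt n \<le> k"
    using div_block[OF val_less[OF x] i] .
  have "(val n x + i) div hgt n + x (Suc n) \<in> I"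
    using I le by auto
  then have "(val n x + i) div hgt n + x (Suc n) < radix (Suc n)"
    using u by (auto simp: uniform_def)
  from digit_funpow[OF x this] show "((odometer ^^ i) x) (Suc n) \<in> I" "((odometer ^^ i) x) (Suc n) \<le> x (Suc n) + k"
    using I le by auto
qed

abbreviation yvisits :: "(nat \<Rightarrow> nat) \<Rightarrow> nat \<Rightarrow> nat" where
  "yvisits \<equiv> visits odometer Yset"

lemma bij_betw_shift: "bij_betw (\<lambda>j. (v + j) mod h) {..<h} {..<(h::nat)}"
proof -
  have "inj_on (\<lambda>j. (v + j) mod h) {..<h}"
  proof (rule inj_onI)
    have le: "i = j" if "j < h" "i \<le> j" "(v + i) mod h = (v + j) mod h" for i j
    proof -
      have "h dvd (v + j) - (v + i)"
        using mod_eq_dvd_iff_nat[of "v + i" "v + j" h] that(2,3) by simp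
      then have "h dvd j - i" by simp
      then show ?thesis using that(1,2) nat_dvd_not_less[of "j - i" h] by (cases "i = j") auto
    qed
    fix i j assume "i \<in> {..<h}" "j \<in> {..<h}" "(v + i) mod h = (v + j) mod h"
    then show "i = j"
      using le[of j i] le[of i j] by (cases "i \<le> j") auto
  qed
  moreover have "(\<lambda>j. (v + j) mod h) ` {..<h} \<subseteq> {..<h}" by auto
  ultimately show ?thesis
    by (simp add: bij_betw_def endo_inj_surj)
qed

text \<open>From any starting level, \<open>hgt n\<close> steps meet every level once, in cyclic
  order. They may run into the next block, which is why the following digit has to lie in I as
  well.\<close>

lemma yvisits_block:
  assumes x: "x \<in> odo_space" and I: "{x (Suc n)..x (Suc n) + 1} \<subseteq> I" and u: "uniform n b I"
  shows "yvisits x (hgt n) = block_len n b"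
proof -
  let ?g = "\<lambda>c. if c = crit n then of_bool b else of_bool (\<exists>x\<in>Yset. val n x = c) :: nat"
  have "of_bool ((odometer ^^ j) x \<in> Yset) = ?g ((val n x + j) mod hgt n)" if "j < hgt n" for j
  proof -
    let ?y = "(odometer ^^ j) x"
    have y: "?y \<in> odo_space" by (rule funpow_odometer_in[OF x])
    have v: "val n ?y = (val n x + j) mod hgt n" by (rule val_funpow[OF x])
    show ?thesis
    proof (cases "val n ?y = crit n")
      case True
      have "?y (Suc n) \<in> I" using digit_range(1)[OF x I u, of j] that by simp
      then show ?thesis using uniform_crit[OF u y _ True] True v by simp
    next
      case False
      have "(\<exists>z\<in>Yset. val n z = val n ?y) \<longleftrightarrow> ?y \<in> Yset"
        using Yset_noncrit[OF y _ _ False] Yset_in_odo by metis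
      then show ?thesis using False by (simp add: v)
    qed
  qed
  then have "yvisits x (hgt n) = (\<Sum>j<hgt n. ?g ((val n x + j) mod hgt n))"
    unfolding visits_def by (intro sum.cong) auto
  also have "\<dots> = (\<Sum>c<hgt n. ?g c)"
    by (rule sum.reindex_bij_betw[OF bij_betw_shift])
  finally show ?thesis by (simp add: block_len_def)
qed

lemma val_funpow_period: "x \<in> odo_space \<Longrightarrow> val n ((odometer ^^ (k * hgt n)) x) = val n x"
  using val_funpow[of x n "k * hgt n"] val_less[of x n] by simp

lemma block_step:
  assumes x: "x \<in> Yset" and I: "{x (Suc n)..x (Suc n) + 1} \<subseteq> I" and u: "uniform n b I"
  shows "(Tmap ^^ block_len n b) x = (odometer ^^ hgt n) x" "(odometer ^^ hgt n) x \<in> Yset"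
proof -
  have xX: "x \<in> odo_space" using x by (rule Yset_in_odo)
  have xI: "x (Suc n) \<in> I" using I by auto
  show Y: "(odometer ^^ hgt n) x \<in> Yset"
    using uniform_cong[OF u xX _ funpow_odometer_in[OF xX] digit_range(1)[OF xX I u], of "hgt n"]
      val_funpow_period[OF xX, of n 1] xI x by simp
  show "(Tmap ^^ block_len n b) x = (odometer ^^ hgt n) x"
    using funpow_first_return[OF x Y] yvisits_block[OF xX I u] by (simp add: Tmap_def)
qed

text \<open>Synchronises T-time and odometer time over j blocks of one type. The resulting power of
  the odometer keeps the first n digits, so it is close to the identity.\<close>

lemma block_iter:
  assumes x: "x \<in> Yset" and u: "uniform n b I"
  shows "{x (Suc n)..x (Suc n) + j} \<subseteq> I \<Longrightarrow>
    (Tmap ^^ (j * block_len n b)) x = (odometer ^^ (j * hgt n)) x \<and> (odometer ^^ (j * hgt n)) x \<in> Yset \<and>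
    ((odometer ^^ (j * hgt n)) x) (Suc n) = x (Suc n) + j"
proof (induction j)
  case 0
  then show ?case using x by simp
next
  case (Suc j)
  let ?y = "(odometer ^^ (j * hgt n)) x" and ?N = "block_len n b"
  have xX: "x \<in> odo_space" using x by (rule Yset_in_odo)
  have IH: "(Tmap ^^ (j * ?N)) x = ?y" "?y \<in> Yset" "?y (Suc n) = x (Suc n) + j"
    using Suc.IH Suc.prems by (auto simp: subset_iff)
  have I: "{?y (Suc n)..?y (Suc n) + 1} \<subseteq> I" using Suc.prems IH(3) by auto
  note st = block_step[OF IH(2) I u]
  have o: "(odometer ^^ (Suc j * hgt n)) x = (odometer ^^ hgt n) ?y"
    by (simp add: funpow_add)
  have t: "(Tmap ^^ (Suc j * ?N)) x = (Tmap ^^ ?N) ((Tmap ^^ (j * ?N)) x)"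
    by (simp add: funpow_add)
  have "((odometer ^^ (Suc j * hgt n)) x) (Suc n) = x (Suc n) + Suc j"
  proof -
    have d: "(val n x + Suc j * hgt n) div hgt n = Suc j"
    proof -
      have "(val n x + Suc j * hgt n) div hgt n = Suc j + val n x div hgt n"
        by (rule div_mult_self1) (use hgt_pos[of n] in simp)
      then show ?thesis using val_less[OF xX, of n] by simp
    qed
    have "Suc j + x (Suc n) \<in> I" using Suc.prems by auto
    then have "Suc j + x (Suc n) < radix (Suc n)" using u by (auto simp: uniform_def)
    then show ?thesis using digit_funpow[OF xX, of n "Suc j * hgt n"] d by (simp only: add.commute)
  qed
  then show ?case
    using st IH(1) o t by simp
qed

section \<open>Equidistribution of a digit\<close>

text \<open>A word of length n and a further digit make a word of length n + 1, and words of equal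
  length have equal mass. So the digit is uniform and independent of the preceding ones.\<close>

lemma measure_cyls_digit:
  assumes I: "I \<subseteq> {..<radix (Suc n)}"
  shows "measure odo_measure {x \<in> odo_space. val n x \<in> B \<and> x (Suc n) \<in> I} =
    measure odo_measure {x \<in> odo_space. val n x \<in> B} * (real (card I) / real (radix (Suc n)))"
proof -
  let ?h = "hgt n" and ?a = "radix (Suc n)"
  define B' where "B' = B \<inter> {..<?h}"
  have fin: "finite B'" "finite I" using I by (auto simp: B'_def intro: finite_subset)
  have a: "real ?a \<noteq> 0" "real ?h \<noteq> 0" using radix_ge2[of "Suc n"] hgt_pos[of n] by simp_all
  define E where "E = (\<lambda>(c, d). c + d * ?h) ` (B' \<times> I)"
  have E_less: "c + d * ?h < hgt (Suc n)" if "c \<in> B'" "d \<in> I" for c d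
  proof -
    have "c + d * ?h < Suc d * ?h" using that by (simp add: B'_def)
    also have "\<dots> \<le> ?a * ?h" using that I by (intro mult_right_mono) auto
    finally show ?thesis by (simp add: mult.commute)
  qed
  have "inj_on (\<lambda>(c, d). c + d * ?h) (B' \<times> I)"
  proof (rule inj_onI, clarify)
    fix c d c' d' assume "c \<in> B'" "c' \<in> B'" and eq: "c + d * ?h = c' + d' * ?h"
    then have lt: "c < ?h" "c' < ?h" by (simp_all add: B'_def)
    have "(c + d * ?h) mod ?h = c" "(c' + d' * ?h) mod ?h = c'" using lt by simp_all
    then have "c = c'" using eq by simp
    then show "c = c' \<and> d = d'" using eq hgt_pos[of n] by simp
  qed
  then have cardE: "card E = card B' * card I"
    unfolding E_def by (simp add: card_image card_cartesian_product)
  have set_eq: "{x \<in> odo_space. val n x \<in> B \<and> x (Suc n) \<in> I} = {x \<in> odo_space. val (Suc n) x \<in> E}"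
  proof (intro Collect_cong conj_cong refl)
    fix x assume x: "x \<in> odo_space"
    show "val n x \<in> B \<and> x (Suc n) \<in> I \<longleftrightarrow> val (Suc n) x \<in> E"
    proof
      assume "val n x \<in> B \<and> x (Suc n) \<in> I"
      then have "(val n x, x (Suc n)) \<in> B' \<times> I" using val_less[OF x, of n] by (simp add: B'_def)
      then show "val (Suc n) x \<in> E" unfolding E_def by (rule rev_image_eqI) simp
    next
      assume "val (Suc n) x \<in> E"
      then obtain c d where cd: "c \<in> B'" "d \<in> I" "val (Suc n) x = c + d * ?h" by (auto simp: E_def)
      have "c < ?h" using cd by (simp add: B'_def)
      then have "(c + d * ?h) mod ?h = c" "(c + d * ?h) div ?h = d" by simp_all
      then have "val n x = c" "x (Suc n) = d"
        using val_Suc_mod[OF x, of n] val_Suc_div[OF x, of n] unfolding cd(3) by simp_all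
      then show "val n x \<in> B \<and> x (Suc n) \<in> I" using cd by (simp add: B'_def)
    qed
  qed
  have m: "measure odo_measure {x \<in> odo_space. val k x \<in> D} = real (card (D \<inter> {..<hgt k})) / real (hgt k)" for k D
  proof -
    have "measure odo_measure {x \<in> odo_space. val k x \<in> D} = (\<Sum>c\<in>D \<inter> {..<hgt k}. measure odo_measure (X.cyl k c))"
      using X.measure_cyls_decomp[OF sets_odo_measure odo.finite_measure_axioms, of k D] by (simp only: val_image)
    also have "\<dots> = (\<Sum>c\<in>D \<inter> {..<hgt k}. 1 / real (hgt k))"
      by (intro sum.cong refl odo_measure_cyl) auto
    finally show ?thesis by simp
  qed
  have "E \<inter> {..<hgt (Suc n)} = E"
    using E_less by (auto simp: E_def)
  then have "measure odo_measure {x \<in> odo_space. val n x \<in> B \<and> x (Suc n) \<in> I} = real (card B' * card I) / real (hgt (Suc n))"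
    unfolding set_eq m by (simp only: cardE)
  also have "\<dots> = (real (card B') / real ?h) * (real (card I) / real ?a)"
    by simp
  finally show ?thesis
    unfolding m B'_def .
qed

lemma odo_funpow_measure:
  "A \<in> sets X.bor \<Longrightarrow> measure odo_measure {x \<in> odo_space. (odometer ^^ j) x \<in> A} = measure odo_measure A"
proof (induction j)
  case 0
  then have "{x \<in> odo_space. (odometer ^^ 0) x \<in> A} = A" using sets.sets_into_space[of A X.bor] by auto
  then show ?case by simp
next
  case (Suc j)
  have eq: "{x \<in> odo_space. (odometer ^^ Suc j) x \<in> A} = odometer -` {x \<in> odo_space. (odometer ^^ j) x \<in> A} \<inter> odo_space"
    by (auto simp: funpow_swap1 odometer_in)
  show ?case
    unfolding eq odo_invariantD[OF funpow_vimage_sets[OF Suc.prems]] by (rule Suc.IH[OF Suc.prems])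
qed

text \<open>For clopen sets of depth at most n the error is zero:
  \<open>odometer ^^ (j * hgt n)\<close> fixes the first n digits, and digit n + 1 is independent of
  them. Approximation by clopen sets keeps the bound uniform in I and j, and later I changes with
  n.\<close>

lemma window:
  assumes A: "A \<in> sets X.bor" and B: "B \<in> sets X.bor" and e: "e > 0"
  shows "\<exists>m. \<forall>n\<ge>m. \<forall>I j. I \<subseteq> {..<radix (Suc n)} \<longrightarrow>
    \<bar>measure odo_measure {x \<in> A. x (Suc n) \<in> I \<and> (odometer ^^ (j * hgt n)) x \<in> B} -
     real (card I) / real (radix (Suc n)) * measure odo_measure (A \<inter> B)\<bar> < e"
proof -
  \<comment> \<open>The tolerance enters twice in comparing the windows and twice in comparing
    \<open>A \<inter> B\<close> with \<open>C \<inter> D\<close>.\<close>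
  have e4: "e / 4 > 0" using e by simp
  obtain C where C: "C \<in> X.cyls" "measure odo_measure (sdiff A C) < e / 4"
    using X.approx_cyls[OF sets_odo_measure odo.finite_measure_axioms A e4] by blast
  obtain D where D: "D \<in> X.cyls" "measure odo_measure (sdiff B D) < e / 4"
    using X.approx_cyls[OF sets_odo_measure odo.finite_measure_axioms B e4] by blast
  obtain m P Q where m: "C = {x \<in> odo_space. val m x \<in> P}" "D = {x \<in> odo_space. val m x \<in> Q}"
    using C(1) D(1) by (rule X.cyls_common)
  have AX: "A \<subseteq> odo_space" "B \<subseteq> odo_space" using A B sets.sets_into_space[of _ X.bor] by auto
  have Cs: "C \<in> sets X.bor" "D \<in> sets X.bor" using C D X.cyls_sets by auto
  have sd: "sdiff A C \<in> sets X.bor" "sdiff B D \<in> sets X.bor" using A B Cs by auto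
  have "\<bar>measure odo_measure {x \<in> A. x (Suc n) \<in> I \<and> (odometer ^^ (j * hgt n)) x \<in> B} -
     real (card I) / real (radix (Suc n)) * measure odo_measure (A \<inter> B)\<bar> < e"
    if n: "n \<ge> m" and I: "I \<subseteq> {..<radix (Suc n)}" for n I j
  proof -
    let ?S = "\<lambda>x. (odometer ^^ (j * hgt n)) x"
    define r where "r = real (card I) / real (radix (Suc n))"
    have "card I \<le> card {..<radix (Suc n)}" by (rule card_mono[OF _ I]) simp
    then have r: "0 \<le> r" "r \<le> 1" using radix_ge2[of "Suc n"] by (auto simp: r_def field_simps)
    define dI where "dI = {x \<in> odo_space. x (Suc n) \<in> I}"
    have dI: "dI \<in> sets X.bor"
      unfolding dI_def by (rule digit_sets)
    have sw: "{x \<in> A'. x (Suc n) \<in> I \<and> ?S x \<in> B'} = A' \<inter> dI \<inter> {x \<in> odo_space. ?S x \<in> B'}" if "A' \<subseteq> odo_space" for A' B'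
      using that by (auto simp: dI_def)
    define G where "G A' B' = {x \<in> A'. x (Suc n) \<in> I \<and> ?S x \<in> B'}" for A' B'
    have CX: "C \<subseteq> odo_space" "D \<subseteq> odo_space" by (auto simp: m)
    have Gs: "G A B \<in> sets X.bor" "G C D \<in> sets X.bor"
      unfolding G_def sw[OF AX(1)] sw[OF CX(1)] by (intro sets.Int A B Cs dI funpow_vimage_sets)+
    let ?R = "sdiff A C \<union> {x \<in> odo_space. ?S x \<in> sdiff B D}"
    have R: "?R \<in> sets X.bor" by (intro sets.Un[OF sd(1)] funpow_vimage_sets sd)
    have "\<bar>measure odo_measure (G A B) - measure odo_measure (G C D)\<bar> \<le> measure odo_measure ?R"
    proof (rule odo.measure_sym_diff_le)
      show "G A B \<in> sets odo_measure" "G C D \<in> sets odo_measure" "?R \<in> sets odo_measure"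
        using Gs R by simp_all
      show "sdiff (G A B) (G C D) \<subseteq> ?R"
        using AX CX unfolding G_def by blast
    qed
    also have "\<dots> \<le> measure odo_measure (sdiff A C) + measure odo_measure {x \<in> odo_space. ?S x \<in> sdiff B D}"
      by (rule measure_Un_le) (simp_all only: sets_odo_measure sd funpow_vimage_sets)
    also have "measure odo_measure {x \<in> odo_space. ?S x \<in> sdiff B D} = measure odo_measure (sdiff B D)"
      by (rule odo_funpow_measure[OF sd(2)])
    finally have 1: "\<bar>measure odo_measure (G A B) - measure odo_measure (G C D)\<bar> < e / 2"
      using C(2) D(2) by linarith
    obtain BC where BC: "C \<inter> D = {x \<in> odo_space. val n x \<in> BC}"
    proof -
      have "C \<inter> D = {x \<in> odo_space. val m x \<in> P \<inter> Q}" by (auto simp: m)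
      then show ?thesis using X.cyls_lift[OF n, of "P \<inter> Q"] that by simp
    qed
    have "G C D = {x \<in> odo_space. val n x \<in> BC \<and> x (Suc n) \<in> I}"
    proof -
      have "?S x \<in> D \<longleftrightarrow> x \<in> D" if x: "x \<in> odo_space" for x
        using val_eq_mono[OF funpow_odometer_in[OF x] x n val_funpow_period[OF x]] x funpow_odometer_in[OF x]
        by (simp add: m)
      then have "G C D = {x \<in> C \<inter> D. x (Suc n) \<in> I}"
        using CX unfolding G_def by blast
      then show ?thesis unfolding BC by auto
    qed
    then have 2: "measure odo_measure (G C D) = r * measure odo_measure (C \<inter> D)"
      using measure_cyls_digit[OF I, of BC] unfolding BC r_def by (simp only: mult.commute)
    have "\<bar>measure odo_measure (A \<inter> B) - measure odo_measure (C \<inter> D)\<bar> \<le> measure odo_measure (sdiff A C \<union> sdiff B D)"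
    proof (rule odo.measure_sym_diff_le)
      show "A \<inter> B \<in> sets odo_measure" "C \<inter> D \<in> sets odo_measure" "sdiff A C \<union> sdiff B D \<in> sets odo_measure"
        using A B Cs sd by auto
    qed auto
    also have "\<dots> \<le> measure odo_measure (sdiff A C) + measure odo_measure (sdiff B D)"
      by (rule measure_Un_le) (simp_all only: sets_odo_measure sd)
    finally have 3: "\<bar>measure odo_measure (A \<inter> B) - measure odo_measure (C \<inter> D)\<bar> < e / 2"
      using C(2) D(2) by linarith
    have "\<bar>r * measure odo_measure (C \<inter> D) - r * measure odo_measure (A \<inter> B)\<bar> =
        r * \<bar>measure odo_measure (A \<inter> B) - measure odo_measure (C \<inter> D)\<bar>"
      using r by (simp add: abs_mult[symmetric] right_diff_distrib[symmetric] abs_minus_commute abs_mult)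
    also have "\<dots> \<le> 1 * \<bar>measure odo_measure (A \<inter> B) - measure odo_measure (C \<inter> D)\<bar>"
      using r by (intro mult_right_mono) auto
    finally have "\<bar>r * measure odo_measure (C \<inter> D) - r * measure odo_measure (A \<inter> B)\<bar> < e / 2"
      using 3 by simp
    then have "\<bar>measure odo_measure (G A B) - r * measure odo_measure (A \<inter> B)\<bar> < e"
      using 1 unfolding 2 by linarith
    then show ?thesis by (simp only: G_def r_def)
  qed
  then show ?thesis by blast
qed

section \<open>Averages of two graph joinings\<close>

lemma pow10_even: "(10::nat) ^ (2 * k) = 10 ^ (2 * k') \<longleftrightarrow> k = k'"
  using power_inject_exp[of "10::nat" "2 * k" "2 * k'"] by simp

lemma removed_even:
  assumes "k \<ge> 2" shows "removed (10 ^ (2 * k)) = {..<k}"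
proof -
  have "10 ^ (2 * k) \<in> {10 ^ k :: nat | k. k \<ge> 2}"
    using assms by (intro CollectI exI[of _ "2 * k"]) simp
  moreover have "(\<exists>k'\<ge>2. (10::nat) ^ (2 * k) = 10 ^ (2 * k') \<and> d < k') \<longleftrightarrow> d < k" for d
    unfolding pow10_even using assms by auto
  ultimately show ?thesis
    unfolding removed_def by (simp only: simp_thms lessThan_def)
qed

lemma removed_odd:
  assumes "k \<ge> 2" "odd k" shows "removed (10 ^ k) = {}"
proof -
  have "10 ^ k \<in> {10 ^ k :: nat | k. k \<ge> 2}"
    using assms by blast
  moreover have "\<not> (\<exists>k'\<ge>2. (10::nat) ^ k = 10 ^ (2 * k') \<and> d < k')" for d
  proof
    assume "\<exists>k'\<ge>2. (10::nat) ^ k = 10 ^ (2 * k') \<and> d < k'"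
    then obtain k' where "(10::nat) ^ k = 10 ^ (2 * k')" by blast
    then have "k = 2 * k'" using power_inject_exp[of "10::nat" k "2 * k'"] by simp
    then show False using assms by simp
  qed
  ultimately show ?thesis
    unfolding removed_def by (simp only: simp_thms Collect_empty_eq)
qed

text \<open>The lower half of the 2k digits gives short blocks. The range of the long ones stops
  before the critical digit 2k - 2; the digit 2k - 1 is left out to keep an interval.\<close>

lemma uniform_even:
  assumes "k \<ge> 2"
  shows "uniform (10 ^ (2 * k) - 1) False {..<k}" "uniform (10 ^ (2 * k) - 1) True {k..<2 * k - 2}"
proof -
  have S: "Suc (10 ^ (2 * k) - 1) = 10 ^ (2 * k)" by simp
  have r: "radix (10 ^ (2 * k)) = 2 * k" using assms by (intro radix_pow) simp
  show "uniform (10 ^ (2 * k) - 1) False {..<k}" "uniform (10 ^ (2 * k) - 1) True {k..<2 * k - 2}"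
    unfolding uniform_def S r removed_even[OF assms] by auto
qed

lemma uniform_odd:
  assumes "k \<ge> 2" "odd k"
  shows "uniform (10 ^ k - 1) True {..<k - 2}"
proof -
  have S: "Suc (10 ^ k - 1) = 10 ^ k" by simp
  show ?thesis
    unfolding uniform_def S radix_pow[OF assms(1)] removed_odd[OF assms] by auto
qed

lemma measure_digit:
  assumes "I \<subseteq> {..<radix (Suc n)}"
  shows "measure odo_measure {x \<in> odo_space. x (Suc n) \<in> I} = real (card I) / real (radix (Suc n))"
  using measure_cyls_digit[OF assms, of UNIV] odo.prob_space by simp

lemma le_pow10: "m \<le> k \<Longrightarrow> m \<le> (10::nat) ^ k - 1"
proof -
  assume "m \<le> k"
  have "k < 10 ^ k" by (rule power_gt_expt) simp
  then show ?thesis using \<open>m \<le> k\<close> by linarith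
qed

text \<open>The arithmetic of \<open>midpoint_measure\<close>: s1 and s2 are the two main windows, r
  is the rest, and x and y are what the main terms of the windows lack to one half of p and
  q.\<close>

lemma midpoint_arith:
  fixes \<epsilon> :: real
  assumes "s = s1 + s2 + r" "\<bar>s1 - a\<bar> < \<epsilon>" "\<bar>s2 - b\<bar> < \<epsilon>" "p / 2 - a = x" "q / 2 - b = y"
    "0 \<le> x" "x \<le> x'" "0 \<le> y" "y \<le> y'" "x' + y' = z" "2 * z < \<epsilon>" "0 \<le> r" "r \<le> z"
  shows "\<bar>s - (p + q) / 2\<bar> < 3 * \<epsilon>"
proof -
  have "s - (p + q) / 2 = (s1 - a) + (s2 - b) + r - x - y"
    using assms(1,4,5) by (simp add: field_simps)
  moreover have "s1 - a < \<epsilon>" "- \<epsilon> < s1 - a" "s2 - b < \<epsilon>" "- \<epsilon> < s2 - b"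
    using assms(2,3) by (simp_all add: abs_less_iff)
  ultimately show ?thesis
    unfolding abs_less_iff using assms(6-) by (intro conjI; linarith)
qed

text \<open>Let N be the length of the long blocks, so that jN = j(N - 1) + j. On long blocks jN
  steps of T pass exactly j blocks; on short ones they pass j blocks and then apply
  \<open>Tmap ^^ j\<close>. By \<open>window\<close>, passing whole blocks has no effect on the
  masses in the limit, and each type of block carries half of the mass.\<close>

lemma midpoint_measure:
  assumes A: "A \<in> sets Y.bor" and B: "B \<in> sets Y.bor" and e: "e > 0"
  shows "\<forall>\<^sub>F k in sequentially.
    \<bar>measure nu (A \<inter> ((Tmap ^^ (j * block_len (10 ^ (2 * k) - 1) True)) -` B \<inter> Yset)) -
     (measure nu (A \<inter> B) + measure nu (A \<inter> ((Tmap ^^ j) -` B \<inter> Yset))) / 2\<bar> < e"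
proof -
  let ?\<mu> = "measure odo_measure"
  define B1 where "B1 = (Tmap ^^ j) -` B \<inter> Yset"
  have B1: "B1 \<in> sets Y.bor" unfolding B1_def by (rule funpow_Tmap_vimage_sets[OF B])
  have AY: "A \<subseteq> Yset" and X: "A \<in> sets X.bor" "B \<in> sets X.bor" "B1 \<in> sets X.bor"
    using A B B1 by (auto simp: sets_Y_iff)
  define \<epsilon> where "\<epsilon> = e * ?\<mu> Yset / 3"
  have \<epsilon>: "\<epsilon> > 0" using e measure_Yset_pos by (simp add: \<epsilon>_def)
  obtain m1 where m1: "\<And>n I j. n \<ge> m1 \<Longrightarrow> I \<subseteq> {..<radix (Suc n)} \<Longrightarrow>
    \<bar>?\<mu> {x \<in> A. x (Suc n) \<in> I \<and> (odometer ^^ (j * hgt n)) x \<in> B1} - real (card I) / real (radix (Suc n)) * ?\<mu> (A \<inter> B1)\<bar> < \<epsilon>"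
    using window[OF X(1,3) \<epsilon>] by blast
  obtain m2 where m2: "\<And>n I j. n \<ge> m2 \<Longrightarrow> I \<subseteq> {..<radix (Suc n)} \<Longrightarrow>
    \<bar>?\<mu> {x \<in> A. x (Suc n) \<in> I \<and> (odometer ^^ (j * hgt n)) x \<in> B} - real (card I) / real (radix (Suc n)) * ?\<mu> (A \<inter> B)\<bar> < \<epsilon>"
    using window[OF X(1,2) \<epsilon>] by blast
  obtain k1 :: nat where k1: "(2 * real j + 2) / \<epsilon> < real k1"
    using reals_Archimedean2 by blast
  \<comment> \<open>Beyond this bound both windows apply, the rest is below \<epsilon>, and the
    digit ranges have room for a margin of j.\<close>
  define k0 where "k0 = m1 + m2 + k1 + j + 4"
  have "\<bar>measure nu (A \<inter> ((Tmap ^^ (j * block_len (10 ^ (2 * k) - 1) True)) -` B \<inter> Yset)) -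
     (measure nu (A \<inter> B) + measure nu (A \<inter> B1)) / 2\<bar> < e" if k: "k \<ge> k0" for k
  proof -
    define n where "n = (10::nat) ^ (2 * k) - 1"
    have k2: "k \<ge> 2" and kj: "k \<ge> j + 2" using k by (simp_all add: k0_def)
    have m: "m1 \<le> 2 * k" "m2 \<le> 2 * k" using k by (simp_all add: k0_def)
    have n12: "n \<ge> m1" "n \<ge> m2"
      unfolding n_def by (rule le_pow10[OF m(1)], rule le_pow10[OF m(2)])
    have S: "Suc n = 10 ^ (2 * k)" by (simp add: n_def)
    have a: "radix (Suc n) = 2 * k" unfolding S using k2 by (intro radix_pow) simp
    note uF = uniform_even(1)[OF k2, folded n_def] and uT = uniform_even(2)[OF k2, folded n_def]
    let ?N = "block_len n True" and ?S = "odometer ^^ (j * hgt n)"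
    define E where "E = A \<inter> ((Tmap ^^ (j * ?N)) -` B \<inter> Yset)"
    have EY: "E \<in> sets Y.bor" unfolding E_def using A funpow_Tmap_vimage_sets[OF B] by blast
    then have E: "E \<in> sets X.bor" "E \<subseteq> Yset" by (simp_all add: sets_Y_iff)
    \<comment> \<open>Each range ends j digits early, so that the next j blocks are still of the
      same type. \<open>I3\<close> collects the other 2j + 2 of the 2k digits: two margins of j and
      the two digits above the long range.\<close>
    define I1 I2 I3 where "I1 = {..<k - j}" and "I2 = {k..<2 * k - 2 - j}" and "I3 = {..<2 * k} - (I1 \<union> I2)"
    have Is: "I1 \<subseteq> {..<radix (Suc n)}" "I2 \<subseteq> {..<radix (Suc n)}" "I3 \<subseteq> {..<radix (Suc n)}"
      unfolding a by (auto simp: I1_def I2_def I3_def)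
    have I12: "I1 \<inter> I2 = {}" by (auto simp: I1_def I2_def)
    have c1: "card I1 = k - j" and c2: "card I2 = k - 2 - j" by (simp_all add: I1_def I2_def)
    have "card I3 = card {..<2 * k} - card (I1 \<union> I2)"
      unfolding I3_def by (rule card_Diff_subset) (use Is a in \<open>auto simp: I1_def I2_def\<close>)
    also have "card (I1 \<union> I2) = (k - j) + (k - 2 - j)"
      using card_Un_disjoint[of I1 I2] I12 c1 c2 by (simp add: I1_def I2_def)
    finally have c3: "card I3 = 2 * j + 2" using kj by simp
    define W1 where "W1 = {x \<in> A. x (Suc n) \<in> I1 \<and> ?S x \<in> B1}"
    define W2 where "W2 = {x \<in> A. x (Suc n) \<in> I2 \<and> ?S x \<in> B}"
    have E1: "x \<in> E \<longleftrightarrow> ?S x \<in> B1" if x: "x \<in> A" "x (Suc n) \<in> I1" for x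
    proof -
      have xY: "x \<in> Yset" using x AY by blast
      have "{x (Suc n)..x (Suc n) + j} \<subseteq> {..<k}" using x(2) by (auto simp: I1_def)
      from block_iter[OF xY uF this] have b: "(Tmap ^^ (j * block_len n False)) x = ?S x" "?S x \<in> Yset" by simp_all
      \<comment> \<open>A short block has one point of Y less than a long one, so j steps of T are
        left over after j blocks.\<close>
      have "j * ?N = j + j * block_len n False" by (simp add: block_len_True)
      then have "(Tmap ^^ (j * ?N)) x = (Tmap ^^ j) (?S x)"
        using b(1) by (simp only: funpow_add comp_apply)
      then show ?thesis using x(1) xY b(2) by (simp add: E_def B1_def)
    qed
    have E2: "x \<in> E \<longleftrightarrow> ?S x \<in> B" if x: "x \<in> A" "x (Suc n) \<in> I2" for x
    proof -
      have xY: "x \<in> Yset" using x AY by blast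
      have "{x (Suc n)..x (Suc n) + j} \<subseteq> {k..<2 * k - 2}" using x(2) by (auto simp: I2_def)
      from block_iter[OF xY uT this] show ?thesis using x(1) xY by (simp add: E_def)
    qed
    have EA: "E \<subseteq> A" by (auto simp: E_def)
    have WE: "W1 = E \<inter> {x \<in> odo_space. x (Suc n) \<in> I1}" "W2 = E \<inter> {x \<in> odo_space. x (Suc n) \<in> I2}"
      unfolding W1_def W2_def using E1 E2 EA AY Yset_subset by blast+
    have Ws: "W1 \<in> sets X.bor" "W2 \<in> sets X.bor"
      unfolding WE by (intro sets.Int E(1) digit_sets)+
    have W12: "W1 \<inter> W2 = {}" using I12 by (auto simp: W1_def W2_def)
    have rest: "E - (W1 \<union> W2) \<subseteq> {x \<in> odo_space. x (Suc n) \<in> I3}"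
    proof
      fix x assume x: "x \<in> E - (W1 \<union> W2)"
      then have xX: "x \<in> odo_space" using E(2) Yset_subset by blast
      have "x (Suc n) < 2 * k" using odo_digit_less[OF xX, of "Suc n"] a by simp
      then show "x \<in> {x \<in> odo_space. x (Suc n) \<in> I3}"
        using x xX unfolding WE I3_def by auto
    qed
    have "?\<mu> (E - (W1 \<union> W2)) \<le> ?\<mu> {x \<in> odo_space. x (Suc n) \<in> I3}"
      by (rule odo.finite_measure_mono[OF rest]) (simp only: sets_odo_measure digit_sets)
    also have "\<dots> = (2 * real j + 2) / (2 * real k)"
      unfolding measure_digit[OF Is(3)] c3 a by simp
    also have "\<dots> = (real j + 1) / real k"
      using k2 by (simp add: field_simps)
    finally have r3: "?\<mu> (E - (W1 \<union> W2)) \<le> (real j + 1) / real k" .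
    have "?\<mu> E = ?\<mu> (W1 \<union> W2) + ?\<mu> (E - (W1 \<union> W2))"
    proof -
      have "W1 \<union> W2 \<subseteq> E" unfolding WE by auto
      then have "E = (W1 \<union> W2) \<union> (E - (W1 \<union> W2))" by blast
      then show ?thesis
        using odo.finite_measure_Union[of "W1 \<union> W2" "E - (W1 \<union> W2)"] Ws E(1) by auto
    qed
    moreover have "?\<mu> (W1 \<union> W2) = ?\<mu> W1 + ?\<mu> W2"
      using odo.finite_measure_Union[of W1 W2] Ws W12 by simp
    ultimately have sum: "?\<mu> E = ?\<mu> W1 + ?\<mu> W2 + ?\<mu> (E - (W1 \<union> W2))" by simp
    define p q where "p = ?\<mu> (A \<inter> B1)" and "q = ?\<mu> (A \<inter> B)"
    have pq: "0 \<le> p" "p \<le> 1" "0 \<le> q" "q \<le> 1" by (simp_all add: p_def q_def)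
    have w1: "\<bar>?\<mu> W1 - real (k - j) / real (2 * k) * p\<bar> < \<epsilon>"
      using m1[OF n12(1) Is(1), of j] unfolding c1 a W1_def p_def .
    have w2: "\<bar>?\<mu> W2 - real (k - 2 - j) / real (2 * k) * q\<bar> < \<epsilon>"
      using m2[OF n12(2) Is(2), of j] unfolding c2 a W2_def q_def .
    have kpos: "real k > 0" using k2 by simp
    have h1: "p / 2 - real (k - j) / real (2 * k) * p = real j / (2 * real k) * p"
      using kj kpos by (simp add: of_nat_diff field_simps)
    have h2: "q / 2 - real (k - 2 - j) / real (2 * k) * q = (real j + 2) / (2 * real k) * q"
      using kj kpos by (simp add: of_nat_diff field_simps)
    have g1: "0 \<le> real j / (2 * real k) * p" "real j / (2 * real k) * p \<le> real j / (2 * real k)"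
      using pq kpos by (simp, intro mult_left_le, simp_all)
    have g2: "0 \<le> (real j + 2) / (2 * real k) * q" "(real j + 2) / (2 * real k) * q \<le> (real j + 2) / (2 * real k)"
      using pq kpos by (simp, intro mult_left_le, simp_all)
    have tot: "real j / (2 * real k) + (real j + 2) / (2 * real k) = (real j + 1) / real k"
      using kpos by (simp add: field_simps)
    have "(2 * real j + 2) / \<epsilon> < real k" using k1 k by (simp add: k0_def)
    then have "(2 * real j + 2) / real k < \<epsilon>" using \<epsilon> kpos by (simp add: field_simps)
    then have small: "2 * ((real j + 1) / real k) < \<epsilon>" by (simp add: algebra_simps)
    have "?\<mu> (E - (W1 \<union> W2)) \<ge> 0" by simp
    then have "\<bar>?\<mu> E - (p + q) / 2\<bar> < 3 * \<epsilon>"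
      using midpoint_arith[OF sum w1 w2 h1 h2 g1 g2 tot small _ r3] by blast
    then have fin: "\<bar>?\<mu> E - (p + q) / 2\<bar> < e * ?\<mu> Yset" by (simp add: \<epsilon>_def)
    have "measure nu E - (measure nu (A \<inter> B) + measure nu (A \<inter> B1)) / 2 = (?\<mu> E - (p + q) / 2) / ?\<mu> Yset"
      using measure_nu[OF EY] measure_nu[of "A \<inter> B"] measure_nu[of "A \<inter> B1"] A B B1
      by (simp add: p_def q_def add_divide_distrib diff_divide_distrib algebra_simps)
    then have "\<bar>measure nu E - (measure nu (A \<inter> B) + measure nu (A \<inter> B1)) / 2\<bar> = \<bar>?\<mu> E - (p + q) / 2\<bar> / ?\<mu> Yset"
      using measure_Yset_pos by simp
    also have "\<dots> < e" using fin measure_Yset_pos by (simp add: pos_divide_less_eq)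
    finally show ?thesis by (simp only: E_def n_def)
  qed
  then show ?thesis
    unfolding B1_def by (intro eventually_sequentiallyI[of k0])
qed

text \<open>The midpoint is the limit of the graph joinings with index \<open>a + j * N k\<close>,
  where \<open>j = b - a\<close>. Replacing the second cell by its preimage under
  \<open>Tmap ^^ a\<close> reduces this to the average of the powers 0 and j.\<close>

lemma graph_joining_midpoint:
  assumes "a \<le> b"
  shows "(1 / 2) *\<^sub>R YY.ifun (graph_joining a) + (1 / 2) *\<^sub>R YY.ifun (graph_joining b) \<in> closure (YY.ifun ` range graph_joining)"
proof -
  have F: "graph_joining d \<in> YY.inv_fins TT" for d
    using graph_joining_inv YY.inv_probs_subset_fins by blast
  obtain L where L: "L \<in> YY.inv_fins TT"
    "\<And>A. A \<in> sets YY.bor \<Longrightarrow> measure L A = 1 / 2 * measure (graph_joining a) A + 1 / 2 * measure (graph_joining b) A"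
    "YY.height_functional L = (1 / 2) *\<^sub>R YY.height_functional (graph_joining a) + (1 / 2) *\<^sub>R YY.height_functional (graph_joining b)"
    by (rule YY.inv_fins_lincomb[OF TT_measurable F[of a] F[of b], of "1 / 2" "1 / 2"]) auto
  have "measure L (Yset \<times> Yset) = 1"
    using L(2)[OF YY.cyls_sets[OF YY.cyls.top]] YY.probsD(3)[OF graph_joining_probs] by simp
  then have LP: "L \<in> YY.probs" using YY.inv_finsD[OF L(1)] by (intro YY.probsI)
  have "YY.ifun L \<in> closure (YY.ifun ` range graph_joining)"
  proof (rule YY.ifun_closure_of_cyl[OF LP])
    show "range graph_joining \<subseteq> YY.probs" using graph_joining_probs by blast
    fix n :: nat and e :: real assume e: "e > 0"
    let ?C = "(\<lambda>z. prod_encode (val n (fst z), val n (snd z))) ` (Yset \<times> Yset)"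
    define j where "j = b - a"
    define N where "N k = block_len (10 ^ (2 * k) - 1) True" for k
    have "\<forall>\<^sub>F k in sequentially. \<forall>c\<in>?C. \<bar>measure (graph_joining (a + j * N k)) (YY.cyl n c) - measure L (YY.cyl n c)\<bar> < e"
    proof (rule eventually_ball_finite[OF YY.finite_code], intro ballI)
      fix c
      let ?U = "Y.cyl n (fst (prod_decode c))" and ?V = "Y.cyl n (snd (prod_decode c))"
      let ?W = "(Tmap ^^ a) -` ?V \<inter> Yset"
      have W: "?W \<in> sets Y.bor" by (rule funpow_Tmap_vimage_sets[OF Y_cyl_sets])
      have pre: "(Tmap ^^ i) -` ?W \<inter> Yset = (Tmap ^^ (a + i)) -` ?V \<inter> Yset" for i
        using funpow_Tmap_in by (auto simp: funpow_add)
      have m: "measure (graph_joining (a + i)) (YY.cyl n c) = measure nu (?U \<inter> ((Tmap ^^ i) -` ?W \<inter> Yset))" for i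
        unfolding YY_cyl_decode measure_graph_joining_rect[OF Y_cyl_sets Y_cyl_sets] pre ..
      have ma: "measure (graph_joining a) (YY.cyl n c) = measure nu (?U \<inter> ?W)"
        unfolding YY_cyl_decode measure_graph_joining_rect[OF Y_cyl_sets Y_cyl_sets] ..
      have ab: "a + j = b" using assms by (simp add: j_def)
      have mL: "measure L (YY.cyl n c) = (measure nu (?U \<inter> ?W) + measure nu (?U \<inter> ((Tmap ^^ j) -` ?W \<inter> Yset))) / 2"
        using L(2)[OF YY.cyls_sets[OF YY.cyl_in_cyls], of n c] m[of j] ma unfolding ab by simp
      show "\<forall>\<^sub>F k in sequentially. \<bar>measure (graph_joining (a + j * N k)) (YY.cyl n c) - measure L (YY.cyl n c)\<bar> < e"
        unfolding m mL N_def by (rule midpoint_measure[OF Y_cyl_sets W e])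
    qed
    then obtain k where "\<forall>c\<in>?C. \<bar>measure (graph_joining (a + j * N k)) (YY.cyl n c) - measure L (YY.cyl n c)\<bar> < e"
      using eventually_happens'[OF sequentially_bot] by blast
    then show "\<exists>M\<in>range graph_joining. \<forall>c\<in>?C. \<bar>measure M (YY.cyl n c) - measure L (YY.cyl n c)\<bar> < e"
      by blast
  qed
  moreover have "YY.ifun L = (1 / 2) *\<^sub>R YY.ifun (graph_joining a) + (1 / 2) *\<^sub>R YY.ifun (graph_joining b)"
    using L(3) by (simp add: YY.height_functional_def)
  ultimately show ?thesis by simp
qed

text \<open>Dyadic points of a segment are iterated midpoints, and closedness adds the
  others.\<close>

lemma convex_midpoint_closed:
  fixes K :: "('i \<Rightarrow> real) set"
  assumes cl: "closed K" and mid: "\<And>\<phi> \<psi>. \<phi> \<in> K \<Longrightarrow> \<psi> \<in> K \<Longrightarrow> (1 / 2) *\<^sub>R \<phi> + (1 / 2) *\<^sub>R \<psi> \<in> K"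
  shows "convex K"
proof (rule convexI)
  fix \<phi> \<psi> and u v :: real
  assume \<phi>: "\<phi> \<in> K" and \<psi>: "\<psi> \<in> K" and uv: "0 \<le> u" "0 \<le> v" "u + v = 1"
  define pt where "pt t = (\<lambda>f. (1 - t) * \<phi> f + t * \<psi> f)" for t :: real
  have dy: "k \<le> 2 ^ n \<Longrightarrow> pt (real k / 2 ^ n) \<in> K" for n k
  proof (induction n arbitrary: k)
    case 0
    have "pt 0 = \<phi>" "pt 1 = \<psi>" by (auto simp: pt_def)
    moreover have "k = 0 \<or> k = 1" using 0 by auto
    ultimately show ?case using \<phi> \<psi> by auto
  next
    case (Suc n)
    \<comment> \<open>Half of k, rounded down and up: \<open>k / 2 ^ Suc n\<close> is the midpoint
      of \<open>i / 2 ^ n\<close> and \<open>j / 2 ^ n\<close>.\<close>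
    define i j where "i = k div 2" and "j = (k + 1) div 2"
    have "i + j = k" unfolding i_def j_def by linarith
    then have ij: "real k = real i + real j" by (metis of_nat_add)
    have "i \<le> 2 ^ n" "j \<le> 2 ^ n" using Suc.prems unfolding i_def j_def by auto
    then have "(1 / 2) *\<^sub>R pt (real i / 2 ^ n) + (1 / 2) *\<^sub>R pt (real j / 2 ^ n) \<in> K"
      using Suc.IH by (intro mid)
    moreover have "(1 / 2) *\<^sub>R pt (real i / 2 ^ n) + (1 / 2) *\<^sub>R pt (real j / 2 ^ n) = pt (real k / 2 ^ Suc n)"
      unfolding ij by (simp add: fun_eq_iff pt_def scaleR_fun_def field_simps)
    ultimately show ?case by simp
  qed
  have v1: "v \<le> 1" using uv by simp
  have "pt v \<in> closure K"
  proof (rule closure_fun_iff[THEN iffD2], intro allI impI)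
    fix F :: "'i set" and e :: real assume F: "finite F" and e: "e > 0"
    define B where "B = Max (insert 0 ((\<lambda>f. \<bar>\<psi> f - \<phi> f\<bar>) ` F)) + 1"
    have B: "B > 0" "\<And>f. f \<in> F \<Longrightarrow> \<bar>\<psi> f - \<phi> f\<bar> \<le> B"
    proof -
      have "0 \<le> Max (insert 0 ((\<lambda>f. \<bar>\<psi> f - \<phi> f\<bar>) ` F))" using F by simp
      then show "B > 0" by (simp add: B_def)
      fix f assume "f \<in> F"
      then have "\<bar>\<psi> f - \<phi> f\<bar> \<le> Max (insert 0 ((\<lambda>f. \<bar>\<psi> f - \<phi> f\<bar>) ` F))" using F by (intro Max_ge) auto
      then show "\<bar>\<psi> f - \<phi> f\<bar> \<le> B" by (simp add: B_def)
    qed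
    obtain n where n: "(1 / 2 :: real) ^ n < e / B"
      using real_arch_pow_inv[of "e / B" "1 / 2"] e B(1) by auto
    define k where "k = nat \<lfloor>v * 2 ^ n\<rfloor>"
    have v2: "0 \<le> v * 2 ^ n" using uv by simp
    have kr: "real k = of_int \<lfloor>v * 2 ^ n\<rfloor>" using v2 by (simp add: k_def)
    have kle: "real k \<le> v * 2 ^ n" "v * 2 ^ n < real k + 1" unfolding kr by linarith+
    have "v * 2 ^ n \<le> 1 * 2 ^ n" using v1 by (intro mult_right_mono) auto
    then have "real k \<le> real (2 ^ n)"
      unfolding of_nat_power of_nat_numeral using kle(1) by linarith
    then have k: "k \<le> 2 ^ n" by (simp only: of_nat_le_iff)
    define s where "s = real k / 2 ^ n"
    have "s \<le> v" using kle(1) by (simp add: s_def pos_divide_le_eq)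
    have "v \<le> (real k + 1) / 2 ^ n" using kle(2) by (simp add: pos_le_divide_eq)
    then have "v - s \<le> (1 / 2) ^ n" by (simp add: s_def add_divide_distrib power_one_over)
    then have sv: "\<bar>s - v\<bar> \<le> (1 / 2) ^ n" using \<open>s \<le> v\<close> by simp
    have "\<bar>pt s f - pt v f\<bar> < e" if f: "f \<in> F" for f
    proof -
      have "pt s f - pt v f = (s - v) * (\<psi> f - \<phi> f)" by (simp add: pt_def algebra_simps)
      then have "\<bar>pt s f - pt v f\<bar> = \<bar>s - v\<bar> * \<bar>\<psi> f - \<phi> f\<bar>" by (simp only: abs_mult)
      also have "\<dots> \<le> (1 / 2) ^ n * B" using sv B(2)[OF f] by (intro mult_mono) auto
      also have "\<dots> < e" using n B(1) by (simp add: pos_less_divide_eq)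
      finally show ?thesis .
    qed
    then show "\<exists>\<omega>\<in>K. \<forall>f\<in>F. \<bar>\<omega> f - pt v f\<bar> < e"
      using dy[OF k] unfolding s_def by blast
  qed
  then have "pt v \<in> K" using cl by (simp add: closure_closed)
  moreover have "pt v = u *\<^sub>R \<phi> + v *\<^sub>R \<psi>"
  proof -
    have "u = 1 - v" using uv by simp
    then show ?thesis by (simp add: pt_def fun_eq_iff scaleR_fun_def)
  qed
  ultimately show "u *\<^sub>R \<phi> + v *\<^sub>R \<psi> \<in> K" by simp
qed

lemma convex_closure_graph_joinings: "convex (closure (YY.ifun ` range graph_joining))"
proof (rule convex_midpoint_closed)
  let ?S = "YY.ifun ` range graph_joining"
  have midS: "(1 / 2) *\<^sub>R \<alpha> + (1 / 2) *\<^sub>R \<beta> \<in> closure ?S" if ab: "\<alpha> \<in> ?S" "\<beta> \<in> ?S" for \<alpha> \<beta>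
  proof -
    obtain a b where "\<alpha> = YY.ifun (graph_joining a)" "\<beta> = YY.ifun (graph_joining b)" using ab by blast
    then show ?thesis
      using graph_joining_midpoint[of a b] graph_joining_midpoint[of b a]
      by (cases "a \<le> b") (simp_all add: add.commute)
  qed
  fix \<phi> \<psi> assume \<phi>: "\<phi> \<in> closure ?S" and \<psi>: "\<psi> \<in> closure ?S"
  show "(1 / 2) *\<^sub>R \<phi> + (1 / 2) *\<^sub>R \<psi> \<in> closure ?S"
  proof (rule closure_fun_iff[THEN iffD2], intro allI impI)
    fix F :: "((nat \<Rightarrow> nat) \<times> (nat \<Rightarrow> nat) \<Rightarrow> real) set" and e :: real
    assume F: "finite F" and e: "e > 0"
    then have e2: "e / 2 > 0" by simp
    obtain \<alpha> where \<alpha>: "\<alpha> \<in> ?S" "\<forall>f\<in>F. \<bar>\<alpha> f - \<phi> f\<bar> < e / 2"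
      using closure_fun_iff[THEN iffD1, OF \<phi>] F e2 by blast
    obtain \<beta> where \<beta>: "\<beta> \<in> ?S" "\<forall>f\<in>F. \<bar>\<beta> f - \<psi> f\<bar> < e / 2"
      using closure_fun_iff[THEN iffD1, OF \<psi>] F e2 by blast
    \<comment> \<open>The midpoint of \<open>\<alpha>\<close> and \<open>\<beta>\<close> is known
      only to be a limit of graph joinings, so a third approximation is taken.\<close>
    obtain \<gamma> where \<gamma>: "\<gamma> \<in> ?S" "\<forall>f\<in>F. \<bar>\<gamma> f - ((1 / 2) *\<^sub>R \<alpha> + (1 / 2) *\<^sub>R \<beta>) f\<bar> < e / 2"
      using closure_fun_iff[THEN iffD1, OF midS[OF \<alpha>(1) \<beta>(1)]] F e2 by blast
    have "\<bar>\<gamma> f - ((1 / 2) *\<^sub>R \<phi> + (1 / 2) *\<^sub>R \<psi>) f\<bar> < e" if f: "f \<in> F" for f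
    proof -
      have "\<bar>\<gamma> f - (\<alpha> f / 2 + \<beta> f / 2)\<bar> < e / 2"
        using \<gamma>(2) f by (simp add: scaleR_fun_def)
      then have "\<bar>\<gamma> f - (\<phi> f / 2 + \<psi> f / 2)\<bar> < e"
        using bspec[OF \<alpha>(2) f] bspec[OF \<beta>(2) f] by linarith
      then show ?thesis by (simp add: scaleR_fun_def)
    qed
    then show "\<exists>\<omega>\<in>?S. \<forall>f\<in>F. \<bar>\<omega> f - ((1 / 2) *\<^sub>R \<phi> + (1 / 2) *\<^sub>R \<psi>) f\<bar> < e"
      using \<gamma>(1) by blast
  qed
qed simp

section \<open>Cyclic approximation\<close>

text \<open>Within \<open>2 * hgt n\<close> steps the digit rises by at most 2. The margin thus
  keeps both orbits in blocks of one type, where membership in Y depends on the level alone.\<close>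

lemma yvisits_cong:
  assumes u: "uniform n True {..<K}" and x: "x \<in> odo_space" "x (Suc n) + 2 < K"
    and y: "y \<in> odo_space" "y (Suc n) + 2 < K" and eq: "val n x = val n y" and i: "i \<le> 2 * hgt n"
  shows "yvisits x i = yvisits y i"
  unfolding visits_def
proof (intro sum.cong refl arg_cong[of _ _ of_bool])
  fix j assume "j \<in> {..<i}"
  then have j: "j \<le> 2 * hgt n" using i by simp
  show "(odometer ^^ j) x \<in> Yset \<longleftrightarrow> (odometer ^^ j) y \<in> Yset"
  proof (rule uniform_cong[OF u])
    show "((odometer ^^ j) x) (Suc n) \<in> {..<K}"
      by (rule digit_range(1)[OF x(1) _ u j]) (use x(2) in auto)
    show "((odometer ^^ j) y) (Suc n) \<in> {..<K}"
      by (rule digit_range(1)[OF y(1) _ u j]) (use y(2) in auto)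
    show "val n ((odometer ^^ j) x) = val n ((odometer ^^ j) y)"
      unfolding val_funpow[OF x(1)] val_funpow[OF y(1)] eq ..
  qed (intro funpow_odometer_in x y)+
qed

lemma yvisits_two_blocks:
  assumes u: "uniform n True {..<K}" and x: "x \<in> odo_space" "x (Suc n) + 2 < K"
  shows "yvisits x (2 * hgt n) = 2 * block_len n True"
proof -
  let ?y = "(odometer ^^ hgt n) x"
  have "{x (Suc n)..x (Suc n) + 1} \<subseteq> {..<K}" using x(2) by auto
  note r = digit_range(2)[OF x(1) this u, of "hgt n"] yvisits_block[OF x(1) this u]
  have "{?y (Suc n)..?y (Suc n) + 1} \<subseteq> {..<K}" using r(1) x(2) by auto
  from yvisits_block[OF funpow_odometer_in[OF x(1)] this u] r(2) show ?thesis
    using visits_add[of odometer Yset x "hgt n" "hgt n"] by (simp add: mult_2)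
qed

text \<open>The two points visit Y at the same odometer times, so equal T-times lead to equal
  levels. The range of two periods leaves room for sums of two times that are each below one period,
  as in \<open>pair_count_indep\<close>.\<close>

lemma names_cong:
  assumes u: "uniform n True {..<K}" and x: "x \<in> Yset" "x (Suc n) + 2 < K"
    and y: "y \<in> Yset" "y (Suc n) + 2 < K" and eq: "val n x = val n y" and t: "t < 2 * block_len n True"
  shows "val n ((Tmap ^^ t) x) = val n ((Tmap ^^ t) y)"
proof -
  have X: "x \<in> odo_space" "y \<in> odo_space" using x y Yset_in_odo by auto
  have "t < yvisits x (2 * hgt n)" using t yvisits_two_blocks[OF u X(1) x(2)] by simp
  from visits_attained[OF this] obtain i where i: "i < 2 * hgt n" "(odometer ^^ i) x \<in> Yset" "yvisits x i = t"
    by blast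
  have vy: "yvisits y i = t" using yvisits_cong[OF u X(1) x(2) X(2) y(2) eq, of i] i by simp
  \<comment> \<open>Equal counters at i and at i + 1 show that y visits Y at time i just as x
    does.\<close>
  have iy: "(odometer ^^ i) y \<in> Yset"
  proof -
    have "yvisits x (Suc i) = yvisits y (Suc i)"
      using i(1) by (intro yvisits_cong[OF u X(1) x(2) X(2) y(2) eq]) simp
    then show ?thesis using i(2,3) vy
      by (cases "(odometer ^^ i) y \<in> Yset") (simp_all add: visits_Suc del: funpow.simps)
  qed
  have "(Tmap ^^ t) x = (odometer ^^ i) x" "(Tmap ^^ t) y = (odometer ^^ i) y"
    using funpow_first_return[OF x(1) i(2)] funpow_first_return[OF y(1) iy] i(3) vy by (simp_all add: Tmap_def)
  then show ?thesis
    using val_funpow[OF X(1), of n i] val_funpow[OF X(2), of n i] eq by simp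
qed

text \<open>One period of T is a passage of \<open>hgt n\<close> steps, which restores the level.
  The margin is 3 because the digit may rise by one before \<open>names_cong\<close> is
  applied.\<close>

lemma names_periodic:
  assumes u: "uniform n True {..<K}" and x: "x \<in> Yset" "x (Suc n) + 3 < K" and t: "t < 2 * block_len n True"
  shows "val n ((Tmap ^^ (t + block_len n True)) x) = val n ((Tmap ^^ t) x)"
proof -
  have xX: "x \<in> odo_space" using x Yset_in_odo by simp
  let ?y = "(odometer ^^ hgt n) x"
  have I: "{x (Suc n)..x (Suc n) + 1} \<subseteq> {..<K}" using x(2) by auto
  note st = block_step[OF x(1) I u]
  have d: "?y (Suc n) + 2 < K"
    using digit_range(2)[OF xX I u, of "hgt n"] x(2) by simp
  have v: "val n ?y = val n x" using val_funpow_period[OF xX, of n 1] by simp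
  have "(Tmap ^^ (t + block_len n True)) x = (Tmap ^^ t) ?y"
    using st(1) by (simp add: funpow_add)
  then show ?thesis
    using names_cong[OF u st(2) d x(1) _ v t] x(2) by simp
qed

text \<open>The odometer time in \<open>d\<close> is the cyclic distance from the level of x to that
  of y; \<open>hgt n\<close> is added first to avoid truncated subtraction.\<close>

lemma reach:
  assumes u: "uniform n True {..<K}" and x: "x \<in> Yset" "x (Suc n) + 1 < K" and y: "y \<in> Yset" "y (Suc n) < K"
  defines "d \<equiv> yvisits x ((val n y + hgt n - val n x) mod hgt n)"
  shows "d < block_len n True" "val n ((Tmap ^^ d) x) = val n y" "((Tmap ^^ d) x) (Suc n) \<le> x (Suc n) + 1"
proof -
  define i where "i = (val n y + hgt n - val n x) mod hgt n"
  have X: "x \<in> odo_space" "y \<in> odo_space" using x y Yset_in_odo by auto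
  have i: "i < hgt n" by (simp add: i_def)
  have I: "{x (Suc n)..x (Suc n) + 1} \<subseteq> {..<K}" using x(2) by auto
  have "(val n x + i) mod hgt n = (val n x + (val n y + hgt n - val n x)) mod hgt n"
    unfolding i_def by (rule mod_add_right_eq)
  also have "val n x + (val n y + hgt n - val n x) = val n y + hgt n"
    using val_less[OF X(1), of n] by simp
  also have "(val n y + hgt n) mod hgt n = val n y"
    using val_less[OF X(2), of n] by simp
  finally have v: "val n ((odometer ^^ i) x) = val n y"
    using val_funpow[OF X(1), of n i] by simp
  have dg: "((odometer ^^ i) x) (Suc n) \<in> {..<K}" "((odometer ^^ i) x) (Suc n) \<le> x (Suc n) + 1"
    using digit_range[OF X(1) I u, of i] i by simp_all
  have iY: "(odometer ^^ i) x \<in> Yset"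
    using uniform_cong[OF u funpow_odometer_in[OF X(1)] dg(1) X(2) _ v] y by simp
  have di: "d = yvisits x i" by (simp only: d_def i_def)
  have T: "(Tmap ^^ d) x = (odometer ^^ i) x"
    using funpow_first_return[OF x(1) iY] unfolding di Tmap_def .
  \<comment> \<open>Time i is itself a visit, which makes the bound on \<open>d\<close>
    strict.\<close>
  have "Suc d = yvisits x (Suc i)" using iY by (simp add: visits_Suc di)
  also have "\<dots> \<le> yvisits x (hgt n)" using i by (intro visits_mono) simp
  also have "\<dots> = block_len n True" by (rule yvisits_block[OF X(1) I u])
  finally show "d < block_len n True" by simp
  show "val n ((Tmap ^^ d) x) = val n y" "((Tmap ^^ d) x) (Suc n) \<le> x (Suc n) + 1"
    unfolding T using v dg by simp_all
qed

text \<open>Moving the window by one exchanges \<open>g e\<close> for \<open>g (N + e)\<close>.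
  Periodicity enters only over the first N values, as names are controlled over two periods.\<close>

lemma sum_shift_periodic:
  fixes g :: "nat \<Rightarrow> real"
  assumes "\<And>s. s < N \<Longrightarrow> g (s + N) = g s"
  shows "e \<le> N \<Longrightarrow> (\<Sum>t<N. g (t + e)) = (\<Sum>t<N. g t)"
proof (induction e)
  case (Suc e)
  have "g e + (\<Sum>t<N. g (t + Suc e)) = (\<Sum>t<N. g (t + e)) + g (N + e)"
    using sum.lessThan_Suc_shift[of "\<lambda>t. g (t + e)" N] sum.lessThan_Suc[of "\<lambda>t. g (t + e)" N] by simp
  moreover have "g (N + e) = g e" using assms[of e] Suc.prems by (simp add: add.commute)
  ultimately show ?case using Suc by simp
qed simp

text \<open>The orbit of z meets the level of x within one period, after e steps. From there on the
  names agree, and a count over a full period is unaffected by the shift by e.\<close>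

lemma pair_count_indep:
  fixes P :: "nat \<Rightarrow> nat \<Rightarrow> real"
  assumes u: "uniform n True {..<K}" and x: "x \<in> Yset" "x (Suc n) + 3 < K" and z: "z \<in> Yset" "z (Suc n) + 3 < K"
    and d: "d < block_len n True"
  shows "(\<Sum>t<block_len n True. P (val n ((Tmap ^^ t) x)) (val n ((Tmap ^^ (t + d)) x))) =
    (\<Sum>t<block_len n True. P (val n ((Tmap ^^ t) z)) (val n ((Tmap ^^ (t + d)) z)))"
proof -
  let ?N = "block_len n True"
  define g where "g t = P (val n ((Tmap ^^ t) z)) (val n ((Tmap ^^ (t + d)) z))" for t
  define e where "e = yvisits z ((val n x + hgt n - val n z) mod hgt n)"
  have re: "e < ?N" "val n ((Tmap ^^ e) z) = val n x" "((Tmap ^^ e) z) (Suc n) \<le> z (Suc n) + 1"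
    using reach[OF u z(1) _ x(1)] x(2) z(2) unfolding e_def by simp_all
  let ?z = "(Tmap ^^ e) z"
  have zY: "?z \<in> Yset" by (rule funpow_Tmap_in[OF z(1)])
  have nm: "val n ((Tmap ^^ t) x) = val n ((Tmap ^^ (t + e)) z)" if "t < 2 * ?N" for t
    using names_cong[OF u x(1) _ zY _ re(2)[symmetric] that] x(2) re(3) z(2) by (simp add: funpow_add)
  have "(\<Sum>t<?N. P (val n ((Tmap ^^ t) x)) (val n ((Tmap ^^ (t + d)) x))) = (\<Sum>t<?N. g (t + e))"
  proof (rule sum.cong[OF refl])
    fix t assume "t \<in> {..<?N}"
    then show "P (val n ((Tmap ^^ t) x)) (val n ((Tmap ^^ (t + d)) x)) = g (t + e)"
      using nm[of t] nm[of "t + d"] d by (simp add: g_def ac_simps)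
  qed
  also have "\<dots> = (\<Sum>t<?N. g t)"
  proof (rule sum_shift_periodic)
    fix s assume s: "s < ?N"
    have "val n ((Tmap ^^ (s + ?N)) z) = val n ((Tmap ^^ s) z)"
      using names_periodic[OF u z, of s] s by simp
    moreover have "val n ((Tmap ^^ (s + d + ?N)) z) = val n ((Tmap ^^ (s + d)) z)"
      using names_periodic[OF u z, of "s + d"] s d by simp
    moreover have "s + ?N + d = s + d + ?N" by simp
    ultimately show "g (s + ?N) = g s" by (simp only: g_def)
  qed (use re(1) in simp)
  finally show ?thesis by (simp only: g_def)
qed

text \<open>Double counting: integrate over \<open>Q\<close> the number of sets \<open>E t\<close>
  that contain a point.\<close>

lemma (in finite_measure) measure_count:
  fixes f :: real
  assumes E: "\<And>t. t < N \<Longrightarrow> E t \<in> sets M" and Q: "Q \<in> sets M"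
    and f: "\<And>x. x \<in> Q \<Longrightarrow> (\<Sum>t<N. of_bool (x \<in> E t)) = f"
  shows "(\<Sum>t<N. measure M (E t \<inter> Q)) = f * measure M Q"
proof -
  have "(\<Sum>t<N. measure M (E t \<inter> Q)) = (\<Sum>t<N. \<integral>x. indicator (E t \<inter> Q) x \<partial>M)"
    using E Q by (intro sum.cong refl) (simp add: Int_absorb2 sets.sets_into_space[OF sets.Int])
  also have "\<dots> = (\<integral>x. (\<Sum>t<N. indicator (E t \<inter> Q) x) \<partial>M)"
    using E Q by (intro Bochner_Integration.integral_sum[symmetric] integrable_real_indicator) (auto simp: emeasure_eq_measure)
  also have "\<dots> = (\<integral>x. f * indicator Q x \<partial>M)"
  proof (rule Bochner_Integration.integral_cong[OF refl])
    fix x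
    show "(\<Sum>t<N. indicator (E t \<inter> Q) x) = f * indicator Q x"
      using f[of x] by (cases "x \<in> Q") (simp_all add: indicator_def)
  qed
  also have "\<dots> = f * measure M Q"
    using sets.sets_into_space[OF Q] by (simp add: Int_absorb2)
  finally show ?thesis .
qed

lemma joining_funpow_rect:
  assumes \<eta>: "\<eta> \<in> YY.inv_probs TT" and A: "A \<in> sets Y.bor" and B: "B \<in> sets Y.bor"
  shows "measure \<eta> (((Tmap ^^ t) -` A \<inter> Yset) \<times> ((Tmap ^^ t) -` B \<inter> Yset)) = measure \<eta> (A \<times> B)"
proof (induction t)
  case 0
  then show ?case using Y_sets_subset[OF A] Y_sets_subset[OF B] by (simp add: Int_absorb2)
next
  case (Suc t)
  let ?A = "(Tmap ^^ t) -` A \<inter> Yset" and ?B = "(Tmap ^^ t) -` B \<inter> Yset"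
  have eq: "(Tmap ^^ Suc t) -` C \<inter> Yset = Tmap -` ((Tmap ^^ t) -` C \<inter> Yset) \<inter> Yset" for C
    by (auto simp: funpow_swap1 Tmap_in)
  have s: "?A \<times> ?B \<in> sets YY.bor" by (intro rect_sets funpow_Tmap_vimage_sets A B)
  have "YY.invariant TT \<eta>" using \<eta> by (simp add: YY.inv_probs_def)
  then have "measure \<eta> (TT -` (?A \<times> ?B) \<inter> (Yset \<times> Yset)) = measure \<eta> (?A \<times> ?B)"
    using s unfolding YY.invariant_def by blast
  then show ?case
    unfolding eq TT_vimage_rect[OF Int_lower2 Int_lower2] Suc .
qed

lemma good_sets: "{x \<in> Yset. x (Suc n) + 3 < K} \<in> sets Y.bor"
proof -
  have "{x \<in> Yset. x (Suc n) + 3 < K} = {x \<in> Yset. val (Suc n) x \<in> {v. v div hgt n + 3 < K}}"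
    by (intro Collect_cong conj_cong refl) (simp add: val_Suc_div Yset_in_odo del: val.simps)
  then show ?thesis by (simp only: Y.cyls_sets[OF Y.cylsI])
qed

text \<open>Most points run through the levels of the tower cyclically, so the name of a pair of such
  points over one period is determined by the difference \<open>d\<close> of their levels; it agrees with the
  names of the pairs \<open>(x, T\<^sup>d x)\<close>.\<close>

lemma cyclic_bound:
  assumes \<eta>: "\<eta> \<in> YY.inv_probs TT" and u: "uniform n True {..<K}" and mn: "m \<le> n" and K: "3 < K"
  shows "\<exists>c. (\<forall>d<block_len n True. 0 \<le> c d) \<and> (\<Sum>d<block_len n True. c d) = 1 \<and>
    (\<forall>v w. \<bar>measure \<eta> (Y.cyl m v \<times> Y.cyl m w) -
      (\<Sum>d<block_len n True. c d * measure (graph_joining d) (Y.cyl m v \<times> Y.cyl m w))\<bar>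
      \<le> 5 * measure nu (Yset - {x \<in> Yset. x (Suc n) + 3 < K}))"
proof -
  let ?N = "block_len n True" and ?h = "hgt n"
  have N0: "?N > 0" by (simp add: block_len_True)
  define G where "G = {x \<in> Yset. x (Suc n) + 3 < K}"
  have G: "G \<in> sets Y.bor" unfolding G_def by (rule good_sets)
  have GY: "G \<subseteq> Yset" by (auto simp: G_def)
  have P: "\<eta> \<in> YY.probs" using \<eta> by (simp add: YY.inv_probs_def)
  note \<eta>' = YY.probsD[OF P]
  interpret e: finite_measure \<eta> by (rule \<eta>'(2))
  have sp: "space \<eta> = Yset \<times> Yset" by (rule YY.space_eq[OF \<eta>'(1)])
  have cp: "coupling \<eta>" by (rule inv_probs_coupling[OF \<eta>])
  \<comment> \<open>The number of T-steps between two levels is the same for all good points. Fixing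
    a representative makes it a function of the levels, so that the sets \<open>Q d\<close> below
    are clopen.\<close>
  define rep where "rep v = (SOME x. x \<in> G \<and> val n x = v)" for v
  have rep: "rep (val n x) \<in> G" "val n (rep (val n x)) = val n x" if "x \<in> G" for x
    using someI[of "\<lambda>y. y \<in> G \<and> val n y = val n x" x] that unfolding rep_def by auto
  define dst where "dst v w = yvisits (rep v) ((w + ?h - v) mod ?h)" for v w
  have dst: "dst (val n x) (val n y) = yvisits x ((val n y + ?h - val n x) mod ?h)" if "x \<in> G" for x y
  proof -
    have i: "(val n y + ?h - val n x) mod ?h \<le> 2 * ?h"
      using mod_less_divisor[of ?h "val n y + ?h - val n x"] hgt_pos[of n] by linarith
    show ?thesis
      unfolding dst_def
      by (rule yvisits_cong[OF u _ _ _ _ rep(2)[OF that] i])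
        (use rep(1)[OF that] that in \<open>auto simp: G_def Yset_in_odo\<close>)
  qed
  define Q where "Q d = {z \<in> Yset \<times> Yset. fst z \<in> G \<and> snd z \<in> G \<and> dst (val n (fst z)) (val n (snd z)) = d}" for d
  define bad where "bad = Yset \<times> Yset - G \<times> G"
  have Q: "Q d \<in> sets YY.bor" for d
  proof -
    let ?P = "\<lambda>a b. a div ?h + 3 < K \<and> b div ?h + 3 < K \<and> dst (a mod ?h) (b mod ?h) = d"
    have "Q d = {z \<in> Yset \<times> Yset. ?P (val (Suc n) (fst z)) (val (Suc n) (snd z))}"
      unfolding Q_def G_def
      by (intro Collect_cong conj_cong refl) (auto simp: val_Suc_div val_Suc_mod Yset_in_odo simp del: val.simps)
    then show ?thesis using YY.cyls_sets[OF YY_code_set[of ?P "Suc n"]] by (simp only:)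
  qed
  have bad: "bad \<in> sets YY.bor"
    unfolding bad_def using rect_sets[OF Y_top_sets Y_top_sets] rect_sets[OF G G] by blast
  have dN: "dst (val n x) (val n y) < ?N" "val n ((Tmap ^^ dst (val n x) (val n y)) x) = val n y"
    "((Tmap ^^ dst (val n x) (val n y)) x) (Suc n) \<le> x (Suc n) + 1" if "x \<in> G" "y \<in> G" for x y
    unfolding dst[OF that(1)]
    using reach[OF u, of x y] that by (auto simp: G_def)
  have cover: "Yset \<times> Yset = bad \<union> (\<Union>d<?N. Q d)"
    using dN(1) GY by (auto simp: bad_def Q_def)
  have Qdisj: "disjoint_family_on Q {..<?N}" by (auto simp: disjoint_family_on_def Q_def)
  have Qbad: "Q d \<inter> bad = {}" for d by (auto simp: Q_def bad_def)
  have total: "measure \<eta> E = measure \<eta> (E \<inter> bad) + (\<Sum>d<?N. measure \<eta> (E \<inter> Q d))" if E: "E \<in> sets YY.bor" for E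
  proof -
    have EQ: "(\<Union>d<?N. E \<inter> Q d) \<in> sets \<eta>" "E \<inter> bad \<in> sets \<eta>"
      using E Q bad \<eta>'(1) by auto
    have "E \<subseteq> Yset \<times> Yset"
      using sets.sets_into_space[OF E] by simp
    then have "E = (E \<inter> bad) \<union> (\<Union>d<?N. E \<inter> Q d)"
      unfolding cover by blast
    then have "measure \<eta> E = measure \<eta> ((E \<inter> bad) \<union> (\<Union>d<?N. E \<inter> Q d))" by simp
    also have "\<dots> = measure \<eta> (E \<inter> bad) + measure \<eta> (\<Union>d<?N. E \<inter> Q d)"
      by (rule e.finite_measure_Union) (use EQ Qbad in auto)
    also have "measure \<eta> (\<Union>d<?N. E \<inter> Q d) = (\<Sum>d<?N. measure \<eta> (E \<inter> Q d))"
    proof (rule e.finite_measure_finite_Union)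
      show "disjoint_family_on (\<lambda>d. E \<inter> Q d) {..<?N}"
        using Qdisj unfolding disjoint_family_on_def by blast
    qed (use E Q \<eta>'(1) in auto)
    finally show ?thesis .
  qed
  define q where "q d = measure \<eta> (Q d)" for d
  define \<beta> where "\<beta> = measure \<eta> bad"
  define \<omega> where "\<omega> = measure nu (Yset - G)"
  have q0: "q d \<ge> 0" for d by (simp add: q_def)
  have \<beta>0: "\<beta> \<ge> 0" and \<omega>0: "\<omega> \<ge> 0" by (simp_all add: \<beta>_def \<omega>_def)
  have sum1: "\<beta> + (\<Sum>d<?N. q d) = 1"
  proof -
    have "Yset \<times> Yset \<in> sets YY.bor" by (rule rect_sets[OF Y_top_sets Y_top_sets])
    moreover have "Yset \<times> Yset \<inter> bad = bad" "Yset \<times> Yset \<inter> Q d = Q d" for d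
      by (auto simp: bad_def Q_def)
    ultimately show ?thesis
      using total[of "Yset \<times> Yset"] \<eta>'(3) by (simp add: q_def \<beta>_def)
  qed
  have \<beta>2: "\<beta> \<le> 2 * \<omega>"
  proof -
    have YG: "Yset - G \<in> sets Y.bor" using G Y_top_sets by blast
    have "bad = (Yset - G) \<times> Yset \<union> Yset \<times> (Yset - G)" by (auto simp: bad_def)
    then have "\<beta> \<le> measure \<eta> ((Yset - G) \<times> Yset) + measure \<eta> (Yset \<times> (Yset - G))"
      unfolding \<beta>_def by (simp only:) (rule measure_Un_le; simp only: \<eta>'(1) rect_sets YG Y_top_sets)
    then show ?thesis using cp YG by (simp add: coupling_def \<omega>_def)
  qed
  \<comment> \<open>The mass of the bad pairs is assigned to d = 0, so that the weights add up to
    1.\<close>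
  define c where "c d = q d + (if d = 0 then \<beta> else 0)" for d
  have c0: "0 \<le> c d" for d using q0 \<beta>0 by (simp add: c_def)
  have "(\<Sum>d<?N. if d = 0 then \<beta> else 0) = \<beta>"
    using N0 by simp
  then have c1: "(\<Sum>d<?N. c d) = 1"
    using sum1 by (simp add: c_def sum.distrib)
  \<comment> \<open>A reference point from which the counts \<open>f d\<close> are read off; by
    \<open>pair_count_indep\<close> every good point gives the same values.\<close>
  obtain z where z: "z \<in> Yset" "z (Suc n) + 3 < K"
  proof -
    have "odo_zero \<in> Yset" by (rule Yset_first_digit[OF odo_zero_in val_odo_zero])
    then show ?thesis using that[of odo_zero] K by (simp add: odo_zero_def)
  qed
  have "\<bar>measure \<eta> (Y.cyl m v \<times> Y.cyl m w) -
      (\<Sum>d<?N. c d * measure (graph_joining d) (Y.cyl m v \<times> Y.cyl m w))\<bar> \<le> 5 * \<omega>" for v w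
  proof -
    define R where "R a b = (of_bool (a mod hgt m = v \<and> b mod hgt m = w) :: real)" for a b
    define f where "f d = (\<Sum>t<?N. R (val n ((Tmap ^^ t) z)) (val n ((Tmap ^^ (t + d)) z)))" for d
    let ?A = "Y.cyl m v" and ?B = "Y.cyl m w"
    have vm: "val n y mod hgt m = val m y" if "y \<in> Yset" for y
      using val_mod[OF Yset_in_odo[OF that] mn] .
    have f0: "0 \<le> f d" and fN: "f d \<le> real ?N" for d
    proof -
      show "0 \<le> f d" unfolding f_def by (intro sum_nonneg) (simp add: R_def)
      have "f d \<le> (\<Sum>t<?N. 1)" unfolding f_def by (intro sum_mono) (simp add: R_def)
      then show "f d \<le> real ?N" by simp
    qed
    have fx: "(\<Sum>t<?N. R (val n ((Tmap ^^ t) x)) (val n ((Tmap ^^ (t + d)) x))) = f d"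
      if "x \<in> G" "d < ?N" for x d
      unfolding f_def by (rule pair_count_indep[OF u _ _ z that(2)]) (use that in \<open>auto simp: G_def\<close>)

    define E where "E t = ((Tmap ^^ t) -` ?A \<inter> Yset) \<times> ((Tmap ^^ t) -` ?B \<inter> Yset)" for t
    have E: "E t \<in> sets YY.bor" for t
      unfolding E_def by (intro rect_sets funpow_Tmap_vimage_sets Y_cyl_sets)
    \<comment> \<open>Every pair in \<open>Q d\<close> belongs to exactly \<open>f d\<close> of the
      sets \<open>E t\<close>: its second point is on the level of the d-th image of the first, so
      these two have the same name over a period.\<close>
    have EQ: "(\<Sum>t<?N. measure \<eta> (E t \<inter> Q d)) = f d * q d" if d: "d < ?N" for d
      unfolding q_def
    proof (rule e.measure_count)
      show "E t \<in> sets \<eta>" for t using E \<eta>'(1) by simp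
      show "Q d \<in> sets \<eta>" using Q \<eta>'(1) by simp
      fix p assume "p \<in> Q d"
      then have p: "fst p \<in> G" "snd p \<in> G" "dst (val n (fst p)) (val n (snd p)) = d" by (auto simp: Q_def)
      let ?x = "fst p" and ?y = "snd p"
      have XY: "?x \<in> Yset" "?y \<in> Yset" using p GY by auto
      let ?x' = "(Tmap ^^ d) ?x"
      have r: "val n ?x' = val n ?y" "?x' (Suc n) \<le> ?x (Suc n) + 1"
        using dN(2,3)[OF p(1,2)] unfolding p(3) by simp_all
      have "of_bool (p \<in> E t) = R (val n ((Tmap ^^ t) ?x)) (val n ((Tmap ^^ (t + d)) ?x))" if t: "t < ?N" for t
      proof -
        have tx: "(Tmap ^^ (t + d)) ?x = (Tmap ^^ t) ?x'" by (simp add: funpow_add)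
        have "val n ((Tmap ^^ t) ?x') = val n ((Tmap ^^ t) ?y)"
          by (rule names_cong[OF u funpow_Tmap_in[OF XY(1)] _ XY(2) _ r(1)])
            (use p(1,2) r(2) t in \<open>auto simp: G_def\<close>)
        then have "R (val n ((Tmap ^^ t) ?x)) (val n ((Tmap ^^ (t + d)) ?x)) =
          of_bool (val m ((Tmap ^^ t) ?x) = v \<and> val m ((Tmap ^^ t) ?y) = w)"
          unfolding tx R_def using vm[OF funpow_Tmap_in[OF XY(1)], of t] vm[OF funpow_Tmap_in[OF XY(2)], of t] by simp
        moreover have "p \<in> E t \<longleftrightarrow> val m ((Tmap ^^ t) ?x) = v \<and> val m ((Tmap ^^ t) ?y) = w"
          using XY funpow_Tmap_in[OF XY(1), of t] funpow_Tmap_in[OF XY(2), of t]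
          by (cases p) (simp add: E_def Y.cyl_def)
        ultimately show ?thesis by simp
      qed
      then have "(\<Sum>t<?N. of_bool (p \<in> E t)) = (\<Sum>t<?N. R (val n ((Tmap ^^ t) ?x)) (val n ((Tmap ^^ (t + d)) ?x)))"
        by (intro sum.cong) auto
      then show "(\<Sum>t<?N. of_bool (p \<in> E t)) = f d" using fx[OF p(1) d] by simp
    qed
    define r where "r = (\<Sum>t<?N. measure \<eta> (E t \<inter> bad))"
    have r0: "0 \<le> r" unfolding r_def by (intro sum_nonneg) simp
    have rN: "r \<le> real ?N * \<beta>"
    proof -
      have "r \<le> (\<Sum>t<?N. \<beta>)"
        unfolding r_def \<beta>_def by (intro sum_mono e.finite_measure_mono) (use bad \<eta>'(1) in auto)
      then show ?thesis by simp
    qed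
    \<comment> \<open>Invariance gives every \<open>E t\<close> the mass of \<open>E 0\<close>, so
      counting over one period evaluates this mass.\<close>
    have "real ?N * measure \<eta> (?A \<times> ?B) = (\<Sum>t<?N. measure \<eta> (E t))"
      unfolding E_def joining_funpow_rect[OF \<eta> Y_cyl_sets Y_cyl_sets] by simp
    also have "\<dots> = r + (\<Sum>t<?N. \<Sum>d<?N. measure \<eta> (E t \<inter> Q d))"
      unfolding total[OF E] sum.distrib r_def ..
    also have "(\<Sum>t<?N. \<Sum>d<?N. measure \<eta> (E t \<inter> Q d)) = (\<Sum>d<?N. f d * q d)"
      by (subst sum.swap) (intro sum.cong refl EQ, simp)
    finally have main: "real ?N * measure \<eta> (?A \<times> ?B) = r + (\<Sum>d<?N. f d * q d)" .

    define g where "g d = measure (graph_joining d) (?A \<times> ?B)" for d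
    have g0: "0 \<le> g d" "g d \<le> 1" for d
      using prob_space.prob_le_1[of "graph_joining d"] graph_joining_probs[of d] by (auto simp: g_def YY.probs_def)
    \<comment> \<open>The same count for a graph joining: a good x contributes exactly
      \<open>f d\<close>, and only points outside \<open>G\<close> cause an error.\<close>
    have gd: "\<bar>real ?N * g d - f d\<bar> \<le> real ?N * \<omega>" if d: "d < ?N" for d
    proof -
      define F where "F = ?A \<inter> ((Tmap ^^ d) -` ?B \<inter> Yset)"
      have F: "F \<in> sets Y.bor" unfolding F_def using Y_cyl_sets funpow_Tmap_vimage_sets by blast
      define H where "H t = (Tmap ^^ t) -` F \<inter> Yset" for t
      have H: "H t \<in> sets Y.bor" for t unfolding H_def by (rule funpow_Tmap_vimage_sets[OF F])
      have gF: "g d = measure nu F"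
        unfolding g_def F_def by (rule measure_graph_joining_rect[OF Y_cyl_sets Y_cyl_sets])
      have HG: "(\<Sum>t<?N. measure nu (H t \<inter> G)) = f d * measure nu G"
      proof (rule nu.measure_count)
        show "H t \<in> sets nu" for t using H by simp
        show "G \<in> sets nu" using G by simp
        fix x assume x: "x \<in> G"
        then have xY: "x \<in> Yset" using GY by blast
        have "of_bool (x \<in> H t) = R (val n ((Tmap ^^ t) x)) (val n ((Tmap ^^ (t + d)) x))" for t
        proof -
          have tx: "(Tmap ^^ d) ((Tmap ^^ t) x) = (Tmap ^^ (t + d)) x"
            by (simp add: funpow_add[symmetric, THEN fun_cong, simplified] add.commute)
          have "x \<in> H t \<longleftrightarrow> val m ((Tmap ^^ t) x) = v \<and> val m ((Tmap ^^ (t + d)) x) = w"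
            using xY funpow_Tmap_in[OF xY, of t] funpow_Tmap_in[OF xY, of "t + d"]
            by (simp add: H_def F_def Y.cyl_def tx)
          then show ?thesis
            unfolding R_def vm[OF funpow_Tmap_in[OF xY]] by simp
        qed
        then show "(\<Sum>t<?N. of_bool (x \<in> H t)) = f d"
          using fx[OF x d] by simp
      qed
      have split: "measure nu (H t) = measure nu (H t \<inter> G) + measure nu (H t - G)" for t
        using nu.finite_measure_Union[of "H t \<inter> G" "H t - G"] H G by (simp add: Int_Diff_Un Int_Diff_disjoint)
      define s where "s = (\<Sum>t<?N. measure nu (H t - G))"
      have s0: "0 \<le> s" unfolding s_def by (intro sum_nonneg) simp
      have "s \<le> (\<Sum>t<?N. \<omega>)"
        unfolding s_def \<omega>_def
        by (intro sum_mono nu.finite_measure_mono) (use G Y_top_sets in \<open>auto simp: H_def\<close>)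
      then have sN: "s \<le> real ?N * \<omega>" by simp
      have "real ?N * g d = (\<Sum>t<?N. measure nu (H t))"
        unfolding gF H_def measure_nu_funpow[OF F] by simp
      also have "\<dots> = f d * measure nu G + s"
        unfolding split sum.distrib HG s_def ..
      finally have 1: "real ?N * g d = f d * measure nu G + s" .
      have G1: "measure nu G = 1 - \<omega>"
        unfolding \<omega>_def using nu.prob_compl[of G] G by simp
      have 2: "real ?N * g d - f d = s - f d * \<omega>"
        unfolding 1 G1 by (simp add: algebra_simps)
      have "0 \<le> f d * \<omega>" "f d * \<omega> \<le> real ?N * \<omega>"
        using f0 fN \<omega>0 by (auto intro: mult_right_mono)
      then show ?thesis using 2 s0 sN by linarith
    qed
    have "\<bar>(\<Sum>d<?N. q d * (real ?N * g d)) - (\<Sum>d<?N. f d * q d)\<bar> = \<bar>\<Sum>d<?N. q d * (real ?N * g d - f d)\<bar>"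
      by (simp add: sum_subtractf[symmetric] right_diff_distrib mult.commute)
    also have "\<dots> \<le> (\<Sum>d<?N. \<bar>q d * (real ?N * g d - f d)\<bar>)"
      by (rule sum_abs)
    also have "\<dots> \<le> (\<Sum>d<?N. q d * (real ?N * \<omega>))"
      unfolding abs_mult using gd q0 by (intro sum_mono mult_mono) auto
    also have "\<dots> = (\<Sum>d<?N. q d) * (real ?N * \<omega>)"
      by (rule sum_distrib_right[symmetric])
    also have "\<dots> \<le> 1 * (real ?N * \<omega>)"
      using sum1 \<beta>0 \<omega>0 by (intro mult_right_mono) auto
    finally have 3: "\<bar>(\<Sum>d<?N. q d * (real ?N * g d)) - (\<Sum>d<?N. f d * q d)\<bar> \<le> real ?N * \<omega>" by simp
    have cg: "(\<Sum>d<?N. c d * g d) = (\<Sum>d<?N. q d * g d) + \<beta> * g 0"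
    proof -
      have "(\<Sum>d<?N. c d * g d) = (\<Sum>d<?N. q d * g d + (if d = 0 then \<beta> * g 0 else 0))"
        by (intro sum.cong refl) (auto simp: c_def algebra_simps)
      then show ?thesis using N0 by (simp add: sum.distrib)
    qed
    have 4: "real ?N * (\<Sum>d<?N. c d * g d) = (\<Sum>d<?N. q d * (real ?N * g d)) + real ?N * (\<beta> * g 0)"
      unfolding cg distrib_left sum_distrib_left by (simp add: mult.left_commute)
    have bg: "0 \<le> real ?N * (\<beta> * g 0)" "real ?N * (\<beta> * g 0) \<le> real ?N * \<beta>"
      using \<beta>0 g0[of 0] by (auto intro!: mult_left_mono mult_left_le)
    have Nb: "real ?N * \<beta> \<le> 2 * (real ?N * \<omega>)"
      using mult_left_mono[OF \<beta>2, of "real ?N"] by simp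
    \<comment> \<open>In units of \<open>\<omega>\<close>: at most 2 for the bad pairs under
      \<open>\<eta>\<close>, 2 for the mass moved to d = 0, and 1 for the graph joinings.\<close>
    have "\<bar>real ?N * measure \<eta> (?A \<times> ?B) - real ?N * (\<Sum>d<?N. c d * g d)\<bar> \<le> 5 * (real ?N * \<omega>)"
      unfolding main 4 using r0 rN 3 bg Nb by linarith
    then have "real ?N * \<bar>measure \<eta> (?A \<times> ?B) - (\<Sum>d<?N. c d * g d)\<bar> \<le> real ?N * (5 * \<omega>)"
      by (simp add: right_diff_distrib[symmetric] abs_mult)
    then have "\<bar>measure \<eta> (?A \<times> ?B) - (\<Sum>d<?N. c d * g d)\<bar> \<le> 5 * \<omega>"
      using N0 by (simp add: mult_le_cancel_left_pos)
    then show ?thesis by (simp only: g_def)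
  qed
  then show ?thesis
    using c0 c1 unfolding \<omega>_def G_def by (intro exI[of _ c]) simp
qed

text \<open>At position 10^k with k odd, k - 5 of the k digits are good, so the error in
  \<open>cyclic_bound\<close> is of order 1/k.\<close>

lemma cyclic_approx:
  assumes \<eta>: "\<eta> \<in> YY.inv_probs TT" and e: "e > 0"
  shows "\<exists>N c. (\<forall>d<N. 0 \<le> c d) \<and> (\<Sum>d<N. c d) = 1 \<and>
    (\<forall>v w. \<bar>measure \<eta> (Y.cyl m v \<times> Y.cyl m w) -
      (\<Sum>d<N. c d * measure (graph_joining d) (Y.cyl m v \<times> Y.cyl m w))\<bar> < e)"
proof -
  let ?M = "measure odo_measure Yset"
  \<comment> \<open>25 is the factor 5 of \<open>cyclic_bound\<close> times the 5 excluded
    digits.\<close>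
  obtain l :: nat where l: "25 / (e * ?M) < real l"
    using reals_Archimedean2 by blast
  \<comment> \<open>Odd, at least \<open>l\<close> and \<open>m\<close>, and at least 7, which
    leaves room for the margin 3 below k - 2.\<close>
  define k where "k = 2 * (l + m + 3) + 1"
  define n where "n = (10::nat) ^ k - 1"
  have k: "k \<ge> 2" "odd k" "k \<ge> 7" "l \<le> k" "m \<le> k" by (simp_all add: k_def)
  have S: "Suc n = 10 ^ k" by (simp add: n_def)
  have a: "radix (Suc n) = k" unfolding S by (rule radix_pow[OF k(1)])
  have u: "uniform n True {..<k - 2}" unfolding n_def by (rule uniform_odd[OF k(1,2)])
  have mn: "m \<le> n" unfolding n_def by (rule le_pow10[OF k(5)])
  let ?B = "Yset - {x \<in> Yset. x (Suc n) + 3 < k - 2}"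
  have B: "?B \<in> sets Y.bor" using good_sets Y_top_sets by blast
  have "measure odo_measure ?B \<le> measure odo_measure {x \<in> odo_space. x (Suc n) \<in> {k - 5..<k}}"
  proof (rule odo.finite_measure_mono)
    show "?B \<subseteq> {x \<in> odo_space. x (Suc n) \<in> {k - 5..<k}}"
    proof
      fix x assume x: "x \<in> ?B"
      then have "x \<in> odo_space" using Yset_in_odo by blast
      moreover from this have "x (Suc n) < k" using odo_digit_less[of x "Suc n"] a by simp
      ultimately show "x \<in> {x \<in> odo_space. x (Suc n) \<in> {k - 5..<k}}" using x k(3) by auto
    qed
  qed (simp only: sets_odo_measure digit_sets)
  also have "\<dots> = real (card {k - 5..<k}) / real k"
  proof -
    have "{k - 5..<k} \<subseteq> {..<radix (Suc n)}" by (auto simp: a)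
    from measure_digit[OF this] show ?thesis unfolding a .
  qed
  also have "\<dots> = 5 / real k" using k(3) by simp
  finally have "measure odo_measure ?B \<le> 5 / real k" .
  then have "measure nu ?B \<le> 5 / real k / ?M"
    unfolding measure_nu[OF B] using measure_Yset_pos by (intro divide_right_mono) auto
  moreover have "5 * (5 / real k / ?M) < e"
  proof -
    have "25 / (e * ?M) < real k" using l k(4) by linarith
    then have "25 < real k * (e * ?M)" using e measure_Yset_pos by (simp add: pos_divide_less_eq)
    then have "25 < e * (real k * ?M)" by (simp add: ac_simps)
    moreover have "real k * ?M > 0" using measure_Yset_pos k by simp
    ultimately show ?thesis by (simp add: pos_divide_less_eq)
  qed
  ultimately have small: "5 * measure nu ?B < e" by linarith
  have "3 < k - 2" using k(3) by simp
  from cyclic_bound[OF \<eta> u mn this] obtain c where c: "\<forall>d<block_len n True. 0 \<le> c d"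
    "(\<Sum>d<block_len n True. c d) = 1"
    "\<forall>v w. \<bar>measure \<eta> (Y.cyl m v \<times> Y.cyl m w) -
      (\<Sum>d<block_len n True. c d * measure (graph_joining d) (Y.cyl m v \<times> Y.cyl m w))\<bar> \<le> 5 * measure nu ?B"
    by blast
  show ?thesis
    using c(1,2) le_less_trans[OF c(3)[rule_format] small]
    by (intro exI[of _ "block_len n True"] exI[of _ c]) simp
qed

text \<open>Convex combinations of graph joinings stay in the closure, which is convex, and are
  again functionals of joinings. \<open>J\<close> collects the joinings with functional in the
  closure: the cell estimates of \<open>cyclic_approx\<close> then place \<open>\<eta>\<close> in
  the closure of the functionals of \<open>J\<close>, which lies in the closed set
  \<open>?K\<close>.\<close>

lemma joinings_subset_closure: "YY.ifun ` YY.inv_probs TT \<subseteq> closure (YY.ifun ` range graph_joining)"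
proof
  fix \<phi> assume "\<phi> \<in> YY.ifun ` YY.inv_probs TT"
  then obtain \<eta> where \<eta>: "\<eta> \<in> YY.inv_probs TT" "\<phi> = YY.ifun \<eta>" by blast
  let ?K = "closure (YY.ifun ` range graph_joining)"
  define J where "J = {M \<in> YY.inv_probs TT. YY.ifun M \<in> ?K}"
  have JP: "J \<subseteq> YY.probs" by (auto simp: J_def YY.inv_probs_def)
  have \<eta>P: "\<eta> \<in> YY.probs" using \<eta> by (simp add: YY.inv_probs_def)
  have gK: "YY.ifun (graph_joining d) \<in> ?K" for d
    by (rule closure_subset[THEN subsetD]) blast
  have gJ: "YY.ifun (graph_joining d) \<in> YY.ifun ` YY.inv_probs TT" for d
    using graph_joining_inv by blast
  have "YY.ifun \<eta> \<in> closure (YY.ifun ` J)"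
  proof (rule YY.ifun_closure_of_cyl[OF \<eta>P JP])
    fix n :: nat and e :: real assume e: "e > 0"
    let ?C = "(\<lambda>z. prod_encode (val n (fst z), val n (snd z))) ` (Yset \<times> Yset)"
    obtain N c where c: "\<forall>d<N. 0 \<le> c d" "(\<Sum>d<N. c d) = 1"
      "\<forall>v w. \<bar>measure \<eta> (Y.cyl n v \<times> Y.cyl n w) -
        (\<Sum>d<N. c d * measure (graph_joining d) (Y.cyl n v \<times> Y.cyl n w))\<bar> < e"
      using cyclic_approx[OF \<eta>(1) e, of n] by blast
    define \<psi> where "\<psi> = (\<Sum>d<N. c d *\<^sub>R YY.ifun (graph_joining d))"
    have \<psi>K: "\<psi> \<in> ?K"
      unfolding \<psi>_def using c gK by (intro convex_sum convex_closure_graph_joinings) auto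
    have "\<psi> \<in> YY.ifun ` YY.inv_probs TT"
      unfolding \<psi>_def using c gJ by (intro convex_sum YY.convex_inv_probs[OF TT_measurable]) auto
    then obtain M where M: "M \<in> YY.inv_probs TT" "\<psi> = YY.ifun M" by blast
    have MJ: "M \<in> J" using M \<psi>K by (simp add: J_def)
    have MP: "M \<in> YY.probs" using MJ JP by blast
    have "\<bar>measure M (YY.cyl n z) - measure \<eta> (YY.cyl n z)\<bar> < e" for z
    proof -
      let ?I = "indicator (YY.cyl n z) :: (nat \<Rightarrow> nat) \<times> (nat \<Rightarrow> nat) \<Rightarrow> real"
      have ev: "(\<Sum>d\<in>D. c d *\<^sub>R YY.ifun (graph_joining d)) f = (\<Sum>d\<in>D. c d * YY.ifun (graph_joining d) f)"
        if "finite D" for D f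
        using that by (induction D) (simp_all add: scaleR_fun_def)
      have "measure M (YY.cyl n z) = \<psi> ?I"
        unfolding M(2) by (rule YY.ifun_indicator[OF YY.probsD(1,2)[OF MP] YY.cyl_in_cyls, symmetric])
      also have "\<dots> = (\<Sum>d<N. c d * YY.ifun (graph_joining d) ?I)"
        unfolding \<psi>_def by (rule ev) simp
      also have "\<dots> = (\<Sum>d<N. c d * measure (graph_joining d) (YY.cyl n z))"
        by (simp only: YY.ifun_indicator[OF YY.probsD(1,2)[OF graph_joining_probs] YY.cyl_in_cyls])
      finally show ?thesis
        using c(3)[rule_format, of "fst (prod_decode z)" "snd (prod_decode z)"]
        unfolding YY_cyl_decode by (simp only: abs_minus_commute)
    qed
    then show "\<exists>M\<in>J. \<forall>z\<in>?C. \<bar>measure M (YY.cyl n z) - measure \<eta> (YY.cyl n z)\<bar> < e"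
      using MJ by blast
  qed
  also have "closure (YY.ifun ` J) \<subseteq> ?K"
    by (intro closure_minimal) (auto simp: J_def)
  finally show "\<phi> \<in> ?K" using \<eta>(2) by simp
qed

theorem proposition4p14:
  shows "poulsen_simplex (integral_functional ` self_joinings)"
proof -
  let ?K = "YY.ifun ` YY.inv_probs TT"
  have "YY.ifun ` range graph_joining \<subseteq> {x. x extreme_point_of ?K}"
    using graph_joining_extreme by blast
  then have "?K \<subseteq> closure {x. x extreme_point_of ?K}"
    by (intro order_trans[OF joinings_subset_closure] closure_mono)
  moreover have "choquet_simplex ?K"
    using graph_joining_inv by (intro YY.choquet_simplex_inv_probs TT_measurable compact_joinings) blast
  moreover have "metrizable_space (top_of_set ?K)"
    by (intro YY.metrizable_functionals compact_joinings) (auto simp: YY.inv_probs_def)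
  ultimately show ?thesis
    unfolding poulsen_simplex_def integral_functional_eq self_joinings_eq by blast
qed

end
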